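(* Let $w' \leq w$ be weaknesses in $\{s,p,l,c\}$, and let $\Psi$ be a class of $\mathcal F$-weights that is both $(w', w)$-created and $(\overline{w'}, \overline w)$-created. Further let $\mathcal S$ and $\mathcal T$ be $\Psi$-limit $\mathcal F$-sketches, and let $\mathbb C$ be a $\Psi$-complete $\mathcal F$-category. There is an isomorphism of $\Psi$-complete $\mathcal F$-categories $$\mathbb{M}\mathrm{od}_{w', w}(\mathcal S, \mathbb{M}\mathrm{od}_{\overline{w'}, \overline w}(\mathcal T, \mathbb C)) \cong \mathbb{M}\mathrm{od}_{\overline{w'}, \overline w}(\mathcal T, \mathbb{M}\mathrm{od}_{w', w}(\mathcal S, \mathbb C)),$$ where the objects on either side are the $\mathcal F$-functors sending the specified weighted cones to weighted limit cones.
   Context: **$\mathcal F$-categories.** $\mathcal F$ is the full subcategory of the arrow category $\mathrm{CAT}^{\to}$ of the category of small categories spanned by the full embeddings $A\colon A_\tau \to A_\lambda$ (fully faithful, injective-on-objects functors); it is complete, cocomplete and cartesian closed. An $\mathcal F$-category (enhanced 2-category) $\mathbb C$ is a category enriched in $\mathcal F$; equivalently, a 2-category $\mathbb C_\lambda$, whose 1-cells are called loose morphisms, with a wide, locally full sub-2-category $\mathbb C_\tau$, whose 1-cells are called tight. An $\mathcal F$-functor is a 2-functor $\mathbb C_\lambda\to\mathbb D_\lambda$ preserving tightness. $\mathcal F$ itself is an $\mathcal F$-category $\mathbb F$: loose morphisms $A\to B$ are functors $A_\lambda\to B_\lambda$, the tight ones are those restricting to $A_\tau \to B_\tau$, and 2-cells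 are natural transformations. All $\mathcal F$-categories and sketches are assumed small. **Weaknesses.** The set of weaknesses is $\{s,p,l,c\}$ (strict, pseudo, lax, colax), partially ordered by $s\le p$, $p\le l$, $p\le c$, with involution $\overline{(-)}$ fixing $s,p$ and exchanging $l,c$. For a square with top $f$, left $g$, right $h$, bottom $k$: an $l$-cell is a 2-cell $hf\Rightarrow kg$; a $c$-cell is a 2-cell $kg\Rightarrow hf$; a $p$-cell is an invertible $l$-cell; an $s$-cell is an identity 2-cell. **Functor $\mathcal F$-categories.** For $w'\le w$, $\mathbb{F}\mathrm{un}_{w',w}(\mathbb S,\mathbb C)$ is the $\mathcal F$-category with objects the $\mathcal F$-functors $\mathbb S\to\mathbb C$; loose morphisms $M\to N$ the $w$-natural transformations $\phi$ between the underlying 2-functors on loose parts (2-natural, pseudonatural, lax natural, colax natural for $w=s,p,l,c$: loose components $\phi_S\colon MS\to NS$, and for each loose $s\colon S\to S'$ a $w$-cell $\phi_s$ in the square with top $\phi_S$, left $M(s)$, right $N(s)$, bottom $\phi_{S'}$, subject to the usual axioms) such that $\phi_s$ is a $w'$-cell whenever $s$ is tight; such a morphism is tight when every $\phi_S$ is tight and every $\phi_s$ is a $w'$-cell; 2-cells are modifications. **Sketches and models.** An $\mathcal F$-weight is an $\mathcal F$-functor $W\colon\mathbb J\to\mathbb F$ with $\mathbb J$ small. A $W$-weighted cone over $D\colon\mathbb J\to\mathbb C$ is an object $X\in\mathbb C$ with an $\mathcal F$-natural transformation $\gamma\colon W\Rightarrow\mathbb C(X,D-)$; it is a limit cone when the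 induced $\mathbb C(C,X)\to[\mathbb J,\mathbb F](W,\mathbb C(C,D-))$ is invertible in $\mathcal F$ for every $C$. A (limit) $\mathcal F$-sketch $\mathcal S$ is a small $\mathcal F$-category $\mathbb S$ with a class of weighted cones in it; a $\Psi$-limit $\mathcal F$-sketch is one whose weights all belong to $\Psi$. A sketch morphism is an $\mathcal F$-functor sending specified cones to specified cones. An $\mathcal F$-category is viewed as a sketch by specifying its weighted limit cones, and is $\Psi$-complete if it has all $W$-weighted limits for $W\in\Psi$. A model of $\mathcal S$ in $\mathcal C$ is a sketch morphism $\mathcal S\to\mathcal C$, and $\mathbb{M}\mathrm{od}_{w',w}(\mathcal S,\mathcal C)$ is the full sub-$\mathcal F$-category of $\mathbb{F}\mathrm{un}_{w',w}(\mathbb S,\mathbb C)$ on the models. **Creation.** A class $\Psi$ of $\mathcal F$-weights is $(w',w)$-created if, for each $\Psi$-limit $\mathcal F$-sketch $\mathcal S$ and each $\Psi$-complete $\mathcal F$-category $\mathbb C$, the $\mathcal F$-category $\mathbb{M}\mathrm{od}_{w',w}(\mathcal S,\mathbb C)$ is $\Psi$-complete and the evaluation $\mathcal F$-functors $(-)(S)\colon\mathbb{M}\mathrm{od}_{w',w}(\mathcal S,\mathbb C)\to\mathbb C$, for $S\in\mathbb S$, preserve and jointly reflect $\Psi$-limits. *)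

theory Defs
  imports "HOL-Library.FuncSet"
begin

text \<open>
  Every map that forms part of the data of a functor, a transformation, a modification or a cone
  is required to be \<open>extensional\<close> (equal to \<open>undefined\<close> off its carrier). Equality in HOL of such
  data is then equality of the mathematical objects, so that isomorphisms of
  \<open>\<F>\<close>-categories of functors can be strict. All carriers are sets, i.e. everything is small.
\<close>

section \<open>Weaknesses\<close>

datatype weakness = Strict | Pseudo | Lax | Colax

instantiation weakness :: order
begin

definition less_eq_weakness :: "weakness \<Rightarrow> weakness \<Rightarrow> bool" where
  "v \<le> w \<longleftrightarrow> v = w \<or> v = Strict \<or> (v = Pseudo \<and> w \<noteq> Strict)"

definition less_weakness :: "weakness \<Rightarrow> weakness \<Rightarrow> bool" where
  "v < w \<longleftrightarrow> v \<le> w \<and> v \<noteq> (w :: weakness)"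

instance
  by standard (auto simp: less_eq_weakness_def less_weakness_def)

end

fun dual :: "weakness \<Rightarrow> weakness" where
  "dual Strict = Strict"
| "dual Pseudo = Pseudo"
| "dual Lax = Colax"
| "dual Colax = Lax"


section \<open>Categories and the objects of \<open>\<F>\<close>\<close>

record ('o, 'a) cat =
  cOb :: "'o set"
  cAr :: "'a set"
  cDom :: "'a \<Rightarrow> 'o"
  cCod :: "'a \<Rightarrow> 'o"
  cId :: "'o \<Rightarrow> 'a"
  cCmp :: "'a \<Rightarrow> 'a \<Rightarrow> 'a"

locale category =
  fixes A :: "('o, 'a, 'x) cat_scheme"
  assumes dom_in: "f \<in> cAr A \<Longrightarrow> cDom A f \<in> cOb A"
    and cod_in: "f \<in> cAr A \<Longrightarrow> cCod A f \<in> cOb A"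
    and id_in: "X \<in> cOb A \<Longrightarrow> cId A X \<in> cAr A"
    and dom_id: "X \<in> cOb A \<Longrightarrow> cDom A (cId A X) = X"
    and cod_id: "X \<in> cOb A \<Longrightarrow> cCod A (cId A X) = X"
    and cmp_in: "\<lbrakk>f \<in> cAr A; g \<in> cAr A; cDom A g = cCod A f\<rbrakk> \<Longrightarrow> cCmp A g f \<in> cAr A"
    and dom_cmp: "\<lbrakk>f \<in> cAr A; g \<in> cAr A; cDom A g = cCod A f\<rbrakk>
      \<Longrightarrow> cDom A (cCmp A g f) = cDom A f"
    and cod_cmp: "\<lbrakk>f \<in> cAr A; g \<in> cAr A; cDom A g = cCod A f\<rbrakk>
      \<Longrightarrow> cCod A (cCmp A g f) = cCod A g"
    and cmp_id: "f \<in> cAr A \<Longrightarrow> cCmp A f (cId A (cDom A f)) = f"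
    and id_cmp: "f \<in> cAr A \<Longrightarrow> cCmp A (cId A (cCod A f)) f = f"
    and cmp_assoc: "\<lbrakk>f \<in> cAr A; g \<in> cAr A; h \<in> cAr A; cDom A g = cCod A f; cDom A h = cCod A g\<rbrakk>
      \<Longrightarrow> cCmp A h (cCmp A g f) = cCmp A (cCmp A h g) f"

text \<open>
  A full embedding \<open>A\<^sub>\<tau> \<rightarrow> A\<^sub>\<lambda>\<close> is given by the category \<open>A\<^sub>\<lambda>\<close> together with the set \<open>tOb\<close> of
  objects in the image of \<open>A\<^sub>\<tau>\<close>, which is identified with the full subcategory on \<open>tOb\<close>.
\<close>

record ('o, 'a) fobj = "('o, 'a) cat" +
  tOb :: "'o set"

definition is_fobj :: "('o, 'a) fobj \<Rightarrow> bool" where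
  "is_fobj A \<longleftrightarrow> category A \<and> tOb A \<subseteq> cOb A"

record ('o, 'a, 'p, 'b) cfun =
  onOb :: "'o \<Rightarrow> 'p"
  onAr :: "'a \<Rightarrow> 'b"

definition is_functor ::
  "('o, 'a, 'x) cat_scheme \<Rightarrow> ('p, 'b, 'y) cat_scheme \<Rightarrow> ('o, 'a, 'p, 'b) cfun \<Rightarrow> bool" where
  "is_functor A B F \<longleftrightarrow>
     onOb F \<in> cOb A \<rightarrow>\<^sub>E cOb B \<and> onAr F \<in> cAr A \<rightarrow>\<^sub>E cAr B \<and>
     (\<forall>f\<in>cAr A. cDom B (onAr F f) = onOb F (cDom A f) \<and> cCod B (onAr F f) = onOb F (cCod A f)) \<and>
     (\<forall>X\<in>cOb A. onAr F (cId A X) = cId B (onOb F X)) \<and>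
     (\<forall>f\<in>cAr A. \<forall>g\<in>cAr A. cDom A g = cCod A f \<longrightarrow>
        onAr F (cCmp A g f) = cCmp B (onAr F g) (onAr F f))"

definition preserves_tight ::
  "('o, 'a) fobj \<Rightarrow> ('p, 'b) fobj \<Rightarrow> ('o, 'a, 'p, 'b) cfun \<Rightarrow> bool" where
  "preserves_tight A B F \<longleftrightarrow> (\<forall>X\<in>tOb A. onOb F X \<in> tOb B)"

definition cfun_id :: "('o, 'a, 'x) cat_scheme \<Rightarrow> ('o, 'a, 'o, 'a) cfun" where
  "cfun_id A = \<lparr>onOb = restrict (\<lambda>X. X) (cOb A), onAr = restrict (\<lambda>f. f) (cAr A)\<rparr>"

definition cfun_comp :: "('o, 'a, 'x) cat_scheme \<Rightarrow> ('p, 'b, 'q, 'c) cfun \<Rightarrow>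
    ('o, 'a, 'p, 'b) cfun \<Rightarrow> ('o, 'a, 'q, 'c) cfun" where
  "cfun_comp A G F =
     \<lparr>onOb = compose (cOb A) (onOb G) (onOb F), onAr = compose (cAr A) (onAr G) (onAr F)\<rparr>"

definition is_nat :: "('o, 'a, 'x) cat_scheme \<Rightarrow> ('p, 'b, 'y) cat_scheme \<Rightarrow>
    ('o, 'a, 'p, 'b) cfun \<Rightarrow> ('o, 'a, 'p, 'b) cfun \<Rightarrow> ('o \<Rightarrow> 'b) \<Rightarrow> bool" where
  "is_nat A B F G t \<longleftrightarrow>
     t \<in> cOb A \<rightarrow>\<^sub>E cAr B \<and>
     (\<forall>X\<in>cOb A. cDom B (t X) = onOb F X \<and> cCod B (t X) = onOb G X) \<and>
     (\<forall>f\<in>cAr A. cCmp B (t (cCod A f)) (onAr F f) = cCmp B (onAr G f) (t (cDom A f)))"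

definition f_invertible ::
  "('o, 'a) fobj \<Rightarrow> ('p, 'b) fobj \<Rightarrow> ('o, 'a, 'p, 'b) cfun \<Rightarrow> bool" where
  "f_invertible A B F \<longleftrightarrow>
     is_functor A B F \<and> preserves_tight A B F \<and>
     (\<exists>G. is_functor B A G \<and> preserves_tight B A G \<and>
        cfun_comp A G F = cfun_id A \<and> cfun_comp B F G = cfun_id B)"


section \<open>\<open>\<F>\<close>-categories\<close>

record ('o, 'm, 'c) fcat =
  Obj :: "'o set"
  Loose :: "'m set"
  Tight :: "'m set"
  Dom :: "'m \<Rightarrow> 'o"
  Cod :: "'m \<Rightarrow> 'o"
  Id1 :: "'o \<Rightarrow> 'm"
  Cmp :: "'m \<Rightarrow> 'm \<Rightarrow> 'm"  (infixr \<open>\<cdot>\<index>\<close> 75)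
  Cell :: "'c set"
  Src :: "'c \<Rightarrow> 'm"
  Trg :: "'c \<Rightarrow> 'm"
  Id2 :: "'m \<Rightarrow> 'c"
  VCmp :: "'c \<Rightarrow> 'c \<Rightarrow> 'c"  (infixr \<open>\<bullet>\<index>\<close> 65)
  HCmp :: "'c \<Rightarrow> 'c \<Rightarrow> 'c"  (infixr \<open>\<star>\<index>\<close> 75)

abbreviation lwhisk :: "('o, 'm, 'c) fcat \<Rightarrow> 'm \<Rightarrow> 'c \<Rightarrow> 'c"  (infixr \<open>\<rhd>\<index>\<close> 75) where
  "g \<rhd>\<^bsub>C\<^esub> x \<equiv> HCmp C (Id2 C g) x"

abbreviation rwhisk :: "('o, 'm, 'c) fcat \<Rightarrow> 'c \<Rightarrow> 'm \<Rightarrow> 'c"  (infixr \<open>\<lhd>\<index>\<close> 75) where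
  "x \<lhd>\<^bsub>C\<^esub> f \<equiv> HCmp C x (Id2 C f)"

text \<open>
  \<open>g \<cdot> f\<close>, \<open>y \<bullet> x\<close> and \<open>y \<star> x\<close> are all written in applicative order. Since the tight
  sub-2-category is wide and locally full, it is determined by its set of 1-cells.
\<close>

locale fcategory =
  fixes C :: "('o, 'm, 'c) fcat" (structure)
  assumes dom_in: "f \<in> Loose C \<Longrightarrow> Dom C f \<in> Obj C"
    and cod_in: "f \<in> Loose C \<Longrightarrow> Cod C f \<in> Obj C"
    and id1_in: "X \<in> Obj C \<Longrightarrow> Id1 C X \<in> Loose C"
    and dom_id1: "X \<in> Obj C \<Longrightarrow> Dom C (Id1 C X) = X"
    and cod_id1: "X \<in> Obj C \<Longrightarrow> Cod C (Id1 C X) = X"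
    and cmp_in: "\<lbrakk>f \<in> Loose C; g \<in> Loose C; Dom C g = Cod C f\<rbrakk> \<Longrightarrow> g \<cdot> f \<in> Loose C"
    and dom_cmp: "\<lbrakk>f \<in> Loose C; g \<in> Loose C; Dom C g = Cod C f\<rbrakk> \<Longrightarrow> Dom C (g \<cdot> f) = Dom C f"
    and cod_cmp: "\<lbrakk>f \<in> Loose C; g \<in> Loose C; Dom C g = Cod C f\<rbrakk> \<Longrightarrow> Cod C (g \<cdot> f) = Cod C g"
    and cmp_id1: "f \<in> Loose C \<Longrightarrow> f \<cdot> Id1 C (Dom C f) = f"
    and id1_cmp: "f \<in> Loose C \<Longrightarrow> Id1 C (Cod C f) \<cdot> f = f"
    and cmp_assoc: "\<lbrakk>f \<in> Loose C; g \<in> Loose C; h \<in> Loose C; Dom C g = Cod C f; Dom C h = Cod C g\<rbrakk>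
      \<Longrightarrow> h \<cdot> (g \<cdot> f) = (h \<cdot> g) \<cdot> f"
    and src_in: "x \<in> Cell C \<Longrightarrow> Src C x \<in> Loose C"
    and trg_in: "x \<in> Cell C \<Longrightarrow> Trg C x \<in> Loose C"
    and dom_trg: "x \<in> Cell C \<Longrightarrow> Dom C (Trg C x) = Dom C (Src C x)"
    and cod_trg: "x \<in> Cell C \<Longrightarrow> Cod C (Trg C x) = Cod C (Src C x)"
    and id2_in: "f \<in> Loose C \<Longrightarrow> Id2 C f \<in> Cell C"
    and src_id2: "f \<in> Loose C \<Longrightarrow> Src C (Id2 C f) = f"
    and trg_id2: "f \<in> Loose C \<Longrightarrow> Trg C (Id2 C f) = f"
    and vcmp_in: "\<lbrakk>x \<in> Cell C; y \<in> Cell C; Src C y = Trg C x\<rbrakk> \<Longrightarrow> y \<bullet> x \<in> Cell C"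
    and src_vcmp: "\<lbrakk>x \<in> Cell C; y \<in> Cell C; Src C y = Trg C x\<rbrakk> \<Longrightarrow> Src C (y \<bullet> x) = Src C x"
    and trg_vcmp: "\<lbrakk>x \<in> Cell C; y \<in> Cell C; Src C y = Trg C x\<rbrakk> \<Longrightarrow> Trg C (y \<bullet> x) = Trg C y"
    and vcmp_id2: "x \<in> Cell C \<Longrightarrow> x \<bullet> Id2 C (Src C x) = x"
    and id2_vcmp: "x \<in> Cell C \<Longrightarrow> Id2 C (Trg C x) \<bullet> x = x"
    and vcmp_assoc: "\<lbrakk>x \<in> Cell C; y \<in> Cell C; z \<in> Cell C; Src C y = Trg C x; Src C z = Trg C y\<rbrakk>
      \<Longrightarrow> z \<bullet> (y \<bullet> x) = (z \<bullet> y) \<bullet> x"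
    and hcmp_in: "\<lbrakk>x \<in> Cell C; y \<in> Cell C; Dom C (Src C y) = Cod C (Src C x)\<rbrakk>
      \<Longrightarrow> y \<star> x \<in> Cell C"
    and src_hcmp: "\<lbrakk>x \<in> Cell C; y \<in> Cell C; Dom C (Src C y) = Cod C (Src C x)\<rbrakk>
      \<Longrightarrow> Src C (y \<star> x) = Src C y \<cdot> Src C x"
    and trg_hcmp: "\<lbrakk>x \<in> Cell C; y \<in> Cell C; Dom C (Src C y) = Cod C (Src C x)\<rbrakk>
      \<Longrightarrow> Trg C (y \<star> x) = Trg C y \<cdot> Trg C x"
    and hcmp_id2_id1: "x \<in> Cell C \<Longrightarrow> x \<star> Id2 C (Id1 C (Dom C (Src C x))) = x"
    and id2_id1_hcmp: "x \<in> Cell C \<Longrightarrow> Id2 C (Id1 C (Cod C (Src C x))) \<star> x = x"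
    and hcmp_assoc: "\<lbrakk>x \<in> Cell C; y \<in> Cell C; z \<in> Cell C;
      Dom C (Src C y) = Cod C (Src C x); Dom C (Src C z) = Cod C (Src C y)\<rbrakk>
      \<Longrightarrow> z \<star> (y \<star> x) = (z \<star> y) \<star> x"
    and hcmp_id2: "\<lbrakk>f \<in> Loose C; g \<in> Loose C; Dom C g = Cod C f\<rbrakk>
      \<Longrightarrow> Id2 C g \<star> Id2 C f = Id2 C (g \<cdot> f)"
    and interchange: "\<lbrakk>x \<in> Cell C; x' \<in> Cell C; y \<in> Cell C; y' \<in> Cell C;
      Src C x' = Trg C x; Src C y' = Trg C y; Dom C (Src C y) = Cod C (Src C x)\<rbrakk>
      \<Longrightarrow> (y' \<bullet> y) \<star> (x' \<bullet> x) = (y' \<star> x') \<bullet> (y \<star> x)"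
    and tight_loose: "f \<in> Tight C \<Longrightarrow> f \<in> Loose C"
    and tight_id1: "X \<in> Obj C \<Longrightarrow> Id1 C X \<in> Tight C"
    and tight_cmp: "\<lbrakk>f \<in> Tight C; g \<in> Tight C; Dom C g = Cod C f\<rbrakk> \<Longrightarrow> g \<cdot> f \<in> Tight C"

definition full_sub :: "('o, 'm, 'c) fcat \<Rightarrow> 'o set \<Rightarrow> ('o, 'm, 'c) fcat" where
  "full_sub C P = C\<lparr>
     Obj := {X \<in> Obj C. X \<in> P},
     Loose := {f \<in> Loose C. Dom C f \<in> P \<and> Cod C f \<in> P},
     Tight := {f \<in> Tight C. Dom C f \<in> P \<and> Cod C f \<in> P},
     Cell := {x \<in> Cell C. Dom C (Src C x) \<in> P \<and> Cod C (Src C x) \<in> P}\<rparr>"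

record ('o, 'm, 'c, 'p, 'n, 'd) ffun =
  FOb :: "'o \<Rightarrow> 'p"
  FLo :: "'m \<Rightarrow> 'n"
  FCe :: "'c \<Rightarrow> 'd"

definition is_ffunctor ::
  "('o, 'm, 'c) fcat \<Rightarrow> ('p, 'n, 'd) fcat \<Rightarrow> ('o, 'm, 'c, 'p, 'n, 'd) ffun \<Rightarrow> bool" where
  "is_ffunctor A B F \<longleftrightarrow>
     FOb F \<in> Obj A \<rightarrow>\<^sub>E Obj B \<and> FLo F \<in> Loose A \<rightarrow>\<^sub>E Loose B \<and> FCe F \<in> Cell A \<rightarrow>\<^sub>E Cell B \<and>
     (\<forall>f\<in>Loose A. Dom B (FLo F f) = FOb F (Dom A f) \<and> Cod B (FLo F f) = FOb F (Cod A f)) \<and>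
     (\<forall>X\<in>Obj A. FLo F (Id1 A X) = Id1 B (FOb F X)) \<and>
     (\<forall>f\<in>Loose A. \<forall>g\<in>Loose A. Dom A g = Cod A f \<longrightarrow>
        FLo F (g \<cdot>\<^bsub>A\<^esub> f) = FLo F g \<cdot>\<^bsub>B\<^esub> FLo F f) \<and>
     (\<forall>x\<in>Cell A. Src B (FCe F x) = FLo F (Src A x) \<and> Trg B (FCe F x) = FLo F (Trg A x)) \<and>
     (\<forall>f\<in>Loose A. FCe F (Id2 A f) = Id2 B (FLo F f)) \<and>
     (\<forall>x\<in>Cell A. \<forall>y\<in>Cell A. Src A y = Trg A x \<longrightarrow>
        FCe F (y \<bullet>\<^bsub>A\<^esub> x) = FCe F y \<bullet>\<^bsub>B\<^esub> FCe F x) \<and>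
     (\<forall>x\<in>Cell A. \<forall>y\<in>Cell A. Dom A (Src A y) = Cod A (Src A x) \<longrightarrow>
        FCe F (y \<star>\<^bsub>A\<^esub> x) = FCe F y \<star>\<^bsub>B\<^esub> FCe F x) \<and>
     (\<forall>f\<in>Tight A. FLo F f \<in> Tight B)"

definition ffun_id :: "('o, 'm, 'c) fcat \<Rightarrow> ('o, 'm, 'c, 'o, 'm, 'c) ffun" where
  "ffun_id A = \<lparr>FOb = restrict (\<lambda>X. X) (Obj A), FLo = restrict (\<lambda>f. f) (Loose A),
     FCe = restrict (\<lambda>x. x) (Cell A)\<rparr>"

definition ffun_comp :: "('o, 'm, 'c) fcat \<Rightarrow> ('p, 'n, 'd, 'q, 'k, 'e) ffun \<Rightarrow>
    ('o, 'm, 'c, 'p, 'n, 'd) ffun \<Rightarrow> ('o, 'm, 'c, 'q, 'k, 'e) ffun" where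
  "ffun_comp A G F = \<lparr>FOb = compose (Obj A) (FOb G) (FOb F),
     FLo = compose (Loose A) (FLo G) (FLo F), FCe = compose (Cell A) (FCe G) (FCe F)\<rparr>"

definition isomorphic_fcat :: "('o, 'm, 'c) fcat \<Rightarrow> ('p, 'n, 'd) fcat \<Rightarrow> bool" where
  "isomorphic_fcat A B \<longleftrightarrow> (\<exists>F G. is_ffunctor A B F \<and> is_ffunctor B A G \<and>
     ffun_comp A G F = ffun_id A \<and> ffun_comp B F G = ffun_id B)"


section \<open>The \<open>\<F>\<close>-category \<open>\<F>\<close> and the representables\<close>

text \<open>A cell together with its boundary.\<close>

record ('e, 'd) arrow =
  asrc :: 'e
  atrg :: 'e
  adata :: 'd

type_synonym ('o, 'a) fmor = "(('o, 'a) fobj, ('o, 'a, 'o, 'a) cfun) arrow"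
type_synonym ('o, 'a) fcell = "(('o, 'a) fmor, 'o \<Rightarrow> 'a) arrow"

definition FF :: "(('o, 'a) fobj, ('o, 'a) fmor, ('o, 'a) fcell) fcat" where
  "FF = \<lparr>
     Obj = {A. is_fobj A},
     Loose = {f. is_fobj (asrc f) \<and> is_fobj (atrg f) \<and> is_functor (asrc f) (atrg f) (adata f)},
     Tight = {f. is_fobj (asrc f) \<and> is_fobj (atrg f) \<and> is_functor (asrc f) (atrg f) (adata f) \<and>
       preserves_tight (asrc f) (atrg f) (adata f)},
     Dom = asrc,
     Cod = atrg,
     Id1 = (\<lambda>A. \<lparr>asrc = A, atrg = A, adata = cfun_id A\<rparr>),
     Cmp = (\<lambda>g f. \<lparr>asrc = asrc f, atrg = atrg g,
       adata = cfun_comp (asrc f) (adata g) (adata f)\<rparr>),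
     Cell = {x. is_fobj (asrc (asrc x)) \<and> is_fobj (atrg (asrc x)) \<and>
       asrc (atrg x) = asrc (asrc x) \<and> atrg (atrg x) = atrg (asrc x) \<and>
       is_functor (asrc (asrc x)) (atrg (asrc x)) (adata (asrc x)) \<and>
       is_functor (asrc (asrc x)) (atrg (asrc x)) (adata (atrg x)) \<and>
       is_nat (asrc (asrc x)) (atrg (asrc x)) (adata (asrc x)) (adata (atrg x)) (adata x)},
     Src = asrc,
     Trg = atrg,
     Id2 = (\<lambda>f. \<lparr>asrc = f, atrg = f,
       adata = (\<lambda>X\<in>cOb (asrc f). cId (atrg f) (onOb (adata f) X))\<rparr>),
     VCmp = (\<lambda>y x. \<lparr>asrc = asrc x, atrg = atrg y,
       adata = (\<lambda>X\<in>cOb (asrc (asrc x)). cCmp (atrg (asrc x)) (adata y X) (adata x X))\<rparr>),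
     HCmp = (\<lambda>y x. \<lparr>
       asrc = \<lparr>asrc = asrc (asrc x), atrg = atrg (asrc y),
         adata = cfun_comp (asrc (asrc x)) (adata (asrc y)) (adata (asrc x))\<rparr>,
       atrg = \<lparr>asrc = asrc (atrg x), atrg = atrg (atrg y),
         adata = cfun_comp (asrc (atrg x)) (adata (atrg y)) (adata (atrg x))\<rparr>,
       adata = (\<lambda>X\<in>cOb (asrc (asrc x)). cCmp (atrg (asrc y))
         (adata y (onOb (adata (atrg x)) X)) (onAr (adata (asrc y)) (adata x X)))\<rparr>)\<rparr>"

definition hom_obj :: "('o, 'm, 'c) fcat \<Rightarrow> 'o \<Rightarrow> 'o \<Rightarrow> ('m, 'c) fobj" where
  "hom_obj C X Y = \<lparr>
     cOb = {f \<in> Loose C. Dom C f = X \<and> Cod C f = Y},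
     cAr = {x \<in> Cell C. Dom C (Src C x) = X \<and> Cod C (Src C x) = Y},
     cDom = Src C, cCod = Trg C, cId = Id2 C, cCmp = VCmp C,
     tOb = {f \<in> Tight C. Dom C f = X \<and> Cod C f = Y}\<rparr>"

definition hom_map :: "('o, 'm, 'c) fcat \<Rightarrow> 'o \<Rightarrow> 'm \<Rightarrow> ('m, 'c) fmor" where
  "hom_map C X g = \<lparr>asrc = hom_obj C X (Dom C g), atrg = hom_obj C X (Cod C g),
     adata = \<lparr>onOb = (\<lambda>f\<in>cOb (hom_obj C X (Dom C g)). g \<cdot>\<^bsub>C\<^esub> f),
              onAr = (\<lambda>x\<in>cAr (hom_obj C X (Dom C g)). g \<rhd>\<^bsub>C\<^esub> x)\<rparr>\<rparr>"

text \<open>The representable \<open>\<C>(X,-)\<close>.\<close>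

definition hom_functor ::
  "('o, 'm, 'c) fcat \<Rightarrow> 'o \<Rightarrow>
    ('o, 'm, 'c, ('m, 'c) fobj, ('m, 'c) fmor, ('m, 'c) fcell) ffun" where
  "hom_functor C X = \<lparr>
     FOb = (\<lambda>Y\<in>Obj C. hom_obj C X Y),
     FLo = (\<lambda>g\<in>Loose C. hom_map C X g),
     FCe = (\<lambda>y\<in>Cell C. \<lparr>asrc = hom_map C X (Src C y), atrg = hom_map C X (Trg C y),
        adata = (\<lambda>f\<in>cOb (hom_obj C X (Dom C (Src C y))). y \<lhd>\<^bsub>C\<^esub> f)\<rparr>)\<rparr>"


section \<open>Weights, weighted cones and weighted limits\<close>

record ('jo, 'j1, 'j2, 'wo, 'wa) weight =
  wJ :: "('jo, 'j1, 'j2) fcat"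
  wF :: "('jo, 'j1, 'j2, ('wo, 'wa) fobj, ('wo, 'wa) fmor, ('wo, 'wa) fcell) ffun"

definition is_weight :: "('jo, 'j1, 'j2, 'wo, 'wa) weight \<Rightarrow> bool" where
  "is_weight W \<longleftrightarrow> fcategory (wJ W) \<and> is_ffunctor (wJ W) FF (wF W)"

text \<open>
  The hom-object \<open>[\<J>,\<F>](W,V)\<close>: its objects are the 2-natural transformations \<open>W\<^sub>\<lambda> \<Rightarrow> V\<^sub>\<lambda>\<close>,
  the tight ones being the \<open>\<F>\<close>-natural transformations, i.e. those with tight components; its
  arrows are the modifications. The values of \<open>W\<close> and of \<open>V\<close> may be categories on different HOL
  types, which is why this is not expressed through the hom-categories of a single functor
  \<open>\<F>\<close>-category.
\<close>

definition loose_nat :: "('jo, 'j1, 'j2) fcat \<Rightarrow>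
    ('jo, 'j1, 'j2, ('wo, 'wa) fobj, ('wo, 'wa) fmor, ('wo, 'wa) fcell) ffun \<Rightarrow>
    ('jo, 'j1, 'j2, ('vo, 'va) fobj, ('vo, 'va) fmor, ('vo, 'va) fcell) ffun \<Rightarrow>
    ('jo \<Rightarrow> ('wo, 'wa, 'vo, 'va) cfun) \<Rightarrow> bool" where
  "loose_nat J W V \<phi> \<longleftrightarrow>
     \<phi> \<in> extensional (Obj J) \<and>
     (\<forall>j\<in>Obj J. is_functor (FOb W j) (FOb V j) (\<phi> j)) \<and>
     (\<forall>u\<in>Loose J.
        cfun_comp (FOb W (Dom J u)) (\<phi> (Cod J u)) (adata (FLo W u)) =
        cfun_comp (FOb W (Dom J u)) (adata (FLo V u)) (\<phi> (Dom J u))) \<and>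
     (\<forall>x\<in>Cell J. \<forall>a\<in>cOb (FOb W (Dom J (Src J x))).
        onAr (\<phi> (Cod J (Src J x))) (adata (FCe W x) a) =
        adata (FCe V x) (onOb (\<phi> (Dom J (Src J x))) a))"

definition f_nat :: "('jo, 'j1, 'j2) fcat \<Rightarrow>
    ('jo, 'j1, 'j2, ('wo, 'wa) fobj, ('wo, 'wa) fmor, ('wo, 'wa) fcell) ffun \<Rightarrow>
    ('jo, 'j1, 'j2, ('vo, 'va) fobj, ('vo, 'va) fmor, ('vo, 'va) fcell) ffun \<Rightarrow>
    ('jo \<Rightarrow> ('wo, 'wa, 'vo, 'va) cfun) \<Rightarrow> bool" where
  "f_nat J W V \<phi> \<longleftrightarrow>
     loose_nat J W V \<phi> \<and> (\<forall>j\<in>Obj J. preserves_tight (FOb W j) (FOb V j) (\<phi> j))"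

definition nat_modification :: "('jo, 'j1, 'j2) fcat \<Rightarrow>
    ('jo, 'j1, 'j2, ('wo, 'wa) fobj, ('wo, 'wa) fmor, ('wo, 'wa) fcell) ffun \<Rightarrow>
    ('jo, 'j1, 'j2, ('vo, 'va) fobj, ('vo, 'va) fmor, ('vo, 'va) fcell) ffun \<Rightarrow>
    ('jo \<Rightarrow> ('wo, 'wa, 'vo, 'va) cfun, 'jo \<Rightarrow> 'wo \<Rightarrow> 'va) arrow \<Rightarrow> bool" where
  "nat_modification J W V \<mu> \<longleftrightarrow>
     loose_nat J W V (asrc \<mu>) \<and> loose_nat J W V (atrg \<mu>) \<and>
     adata \<mu> \<in> extensional (Obj J) \<and>
     (\<forall>j\<in>Obj J. is_nat (FOb W j) (FOb V j) (asrc \<mu> j) (atrg \<mu> j) (adata \<mu> j)) \<and>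
     (\<forall>u\<in>Loose J. \<forall>a\<in>cOb (FOb W (Dom J u)).
        adata \<mu> (Cod J u) (onOb (adata (FLo W u)) a) =
        onAr (adata (FLo V u)) (adata \<mu> (Dom J u) a))"

definition nat_obj :: "('jo, 'j1, 'j2) fcat \<Rightarrow>
    ('jo, 'j1, 'j2, ('wo, 'wa) fobj, ('wo, 'wa) fmor, ('wo, 'wa) fcell) ffun \<Rightarrow>
    ('jo, 'j1, 'j2, ('vo, 'va) fobj, ('vo, 'va) fmor, ('vo, 'va) fcell) ffun \<Rightarrow>
    ('jo \<Rightarrow> ('wo, 'wa, 'vo, 'va) cfun,
     ('jo \<Rightarrow> ('wo, 'wa, 'vo, 'va) cfun, 'jo \<Rightarrow> 'wo \<Rightarrow> 'va) arrow) fobj" where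
  "nat_obj J W V = \<lparr>
     cOb = {\<phi>. loose_nat J W V \<phi>},
     cAr = {\<mu>. nat_modification J W V \<mu>},
     cDom = asrc,
     cCod = atrg,
     cId = (\<lambda>\<phi>. \<lparr>asrc = \<phi>, atrg = \<phi>,
       adata = (\<lambda>j\<in>Obj J. \<lambda>a\<in>cOb (FOb W j). cId (FOb V j) (onOb (\<phi> j) a))\<rparr>),
     cCmp = (\<lambda>\<nu> \<mu>. \<lparr>asrc = asrc \<mu>, atrg = atrg \<nu>,
       adata = (\<lambda>j\<in>Obj J. \<lambda>a\<in>cOb (FOb W j). cCmp (FOb V j) (adata \<nu> j a) (adata \<mu> j a))\<rparr>),
     tOb = {\<phi>. f_nat J W V \<phi>}\<rparr>"

record ('jo, 'j1, 'j2, 'wo, 'wa, 'o, 'm, 'c) wcone =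
  cWeight :: "('jo, 'j1, 'j2, 'wo, 'wa) weight"
  cDiag :: "('jo, 'j1, 'j2, 'o, 'm, 'c) ffun"
  cApex :: 'o
  cLeg :: "'jo \<Rightarrow> ('wo, 'wa, 'm, 'c) cfun"

definition is_cone ::
  "('o, 'm, 'c) fcat \<Rightarrow> ('jo, 'j1, 'j2, 'wo, 'wa, 'o, 'm, 'c) wcone \<Rightarrow> bool" where
  "is_cone C \<kappa> \<longleftrightarrow>
     is_weight (cWeight \<kappa>) \<and> is_ffunctor (wJ (cWeight \<kappa>)) C (cDiag \<kappa>) \<and> cApex \<kappa> \<in> Obj C \<and>
     f_nat (wJ (cWeight \<kappa>)) (wF (cWeight \<kappa>))
       (ffun_comp (wJ (cWeight \<kappa>)) (hom_functor C (cApex \<kappa>)) (cDiag \<kappa>)) (cLeg \<kappa>)"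

text \<open>The comparison \<open>\<C>(Y,X) \<rightarrow> [\<J>,\<F>](W, \<C>(Y,D-))\<close> induced by a cone with apex \<open>X\<close>.\<close>

definition induced_ob ::
  "('o, 'm, 'c) fcat \<Rightarrow> ('jo, 'j1, 'j2, 'wo, 'wa, 'o, 'm, 'c) wcone \<Rightarrow> 'm \<Rightarrow>
    'jo \<Rightarrow> ('wo, 'wa, 'm, 'c) cfun" where
  "induced_ob C \<kappa> f = (\<lambda>j\<in>Obj (wJ (cWeight \<kappa>)). \<lparr>
     onOb = (\<lambda>a\<in>cOb (FOb (wF (cWeight \<kappa>)) j). onOb (cLeg \<kappa> j) a \<cdot>\<^bsub>C\<^esub> f),
     onAr = (\<lambda>b\<in>cAr (FOb (wF (cWeight \<kappa>)) j). onAr (cLeg \<kappa> j) b \<lhd>\<^bsub>C\<^esub> f)\<rparr>)"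

definition induced ::
  "('o, 'm, 'c) fcat \<Rightarrow> ('jo, 'j1, 'j2, 'wo, 'wa, 'o, 'm, 'c) wcone \<Rightarrow> 'o \<Rightarrow>
    ('m, 'c, 'jo \<Rightarrow> ('wo, 'wa, 'm, 'c) cfun,
     ('jo \<Rightarrow> ('wo, 'wa, 'm, 'c) cfun, 'jo \<Rightarrow> 'wo \<Rightarrow> 'c) arrow) cfun" where
  "induced C \<kappa> Y = \<lparr>
     onOb = (\<lambda>f\<in>cOb (hom_obj C Y (cApex \<kappa>)). induced_ob C \<kappa> f),
     onAr = (\<lambda>x\<in>cAr (hom_obj C Y (cApex \<kappa>)). \<lparr>
       asrc = induced_ob C \<kappa> (Src C x), atrg = induced_ob C \<kappa> (Trg C x),
       adata = (\<lambda>j\<in>Obj (wJ (cWeight \<kappa>)). \<lambda>a\<in>cOb (FOb (wF (cWeight \<kappa>)) j).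
         onOb (cLeg \<kappa> j) a \<rhd>\<^bsub>C\<^esub> x)\<rparr>)\<rparr>"

definition limit_cone ::
  "('o, 'm, 'c) fcat \<Rightarrow> ('jo, 'j1, 'j2, 'wo, 'wa, 'o, 'm, 'c) wcone \<Rightarrow> bool" where
  "limit_cone C \<kappa> \<longleftrightarrow> is_cone C \<kappa> \<and>
     (\<forall>Y\<in>Obj C. f_invertible (hom_obj C Y (cApex \<kappa>))
        (nat_obj (wJ (cWeight \<kappa>)) (wF (cWeight \<kappa>))
          (ffun_comp (wJ (cWeight \<kappa>)) (hom_functor C Y) (cDiag \<kappa>)))
        (induced C \<kappa> Y))"

definition complete ::
  "('jo, 'j1, 'j2, 'wo, 'wa) weight set \<Rightarrow> ('o, 'm, 'c) fcat \<Rightarrow> bool" where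
  "complete \<Psi> C \<longleftrightarrow> (\<forall>W\<in>\<Psi>. \<forall>D. is_ffunctor (wJ W) C D \<longrightarrow>
     (\<exists>\<kappa>. limit_cone C \<kappa> \<and> cWeight \<kappa> = W \<and> cDiag \<kappa> = D))"

definition map_cone :: "('o, 'm, 'c, 'p, 'n, 'd) ffun \<Rightarrow>
    ('jo, 'j1, 'j2, 'wo, 'wa, 'o, 'm, 'c) wcone \<Rightarrow>
    ('jo, 'j1, 'j2, 'wo, 'wa, 'p, 'n, 'd) wcone" where
  "map_cone F \<kappa> = \<lparr>
     cWeight = cWeight \<kappa>,
     cDiag = ffun_comp (wJ (cWeight \<kappa>)) F (cDiag \<kappa>),
     cApex = FOb F (cApex \<kappa>),
     cLeg = (\<lambda>j\<in>Obj (wJ (cWeight \<kappa>)). \<lparr>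
       onOb = (\<lambda>a\<in>cOb (FOb (wF (cWeight \<kappa>)) j). FLo F (onOb (cLeg \<kappa> j) a)),
       onAr = (\<lambda>b\<in>cAr (FOb (wF (cWeight \<kappa>)) j). FCe F (onAr (cLeg \<kappa> j) b))\<rparr>)\<rparr>"


section \<open>Functor \<open>\<F>\<close>-categories\<close>

definition invertible_cell :: "('o, 'm, 'c) fcat \<Rightarrow> 'c \<Rightarrow> bool" where
  "invertible_cell C x \<longleftrightarrow> (\<exists>y\<in>Cell C. Src C y = Trg C x \<and> Trg C y = Src C x \<and>
     y \<bullet>\<^bsub>C\<^esub> x = Id2 C (Src C x) \<and> x \<bullet>\<^bsub>C\<^esub> y = Id2 C (Trg C x))"

text \<open>
  The direction of a cell in a square is fixed by the weakness \<open>w\<close> of the transformation it belongs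
  to: only for \<open>Colax\<close> does it point from \<open>k g\<close> to \<open>h f\<close>. The condition that such a cell be a
  \<open>w'\<close>-cell for some \<open>w' \<le> w\<close> is independent of this direction. In particular a \<open>Colax\<close>-directed
  cell counts as a \<open>Pseudo\<close>-cell when it is invertible, the lax-directed \<open>Pseudo\<close>-cell being then
  its inverse.
\<close>

definition directed_cell ::
  "('o, 'm, 'c) fcat \<Rightarrow> weakness \<Rightarrow> 'm \<Rightarrow> 'm \<Rightarrow> 'm \<Rightarrow> 'm \<Rightarrow> 'c \<Rightarrow> bool" where
  "directed_cell C w f g h k x \<longleftrightarrow> x \<in> Cell C \<and>
     (if w = Colax then Src C x = k \<cdot>\<^bsub>C\<^esub> g \<and> Trg C x = h \<cdot>\<^bsub>C\<^esub> f
      else Src C x = h \<cdot>\<^bsub>C\<^esub> f \<and> Trg C x = k \<cdot>\<^bsub>C\<^esub> g)"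

fun weak_cell :: "('o, 'm, 'c) fcat \<Rightarrow> weakness \<Rightarrow> 'c \<Rightarrow> bool" where
  "weak_cell C Strict x \<longleftrightarrow> x = Id2 C (Src C x)"
| "weak_cell C Pseudo x \<longleftrightarrow> invertible_cell C x"
| "weak_cell C Lax x \<longleftrightarrow> True"
| "weak_cell C Colax x \<longleftrightarrow> True"

record ('so, 's1, 'c1, 'c2) tdata =
  cmpt :: "'so \<Rightarrow> 'c1"
  ncell :: "'s1 \<Rightarrow> 'c2"

type_synonym ('so, 's1, 's2, 'co, 'c1, 'c2) trans =
  "(('so, 's1, 's2, 'co, 'c1, 'c2) ffun, ('so, 's1, 'c1, 'c2) tdata) arrow"
type_synonym ('so, 's1, 's2, 'co, 'c1, 'c2) modif =
  "(('so, 's1, 's2, 'co, 'c1, 'c2) trans, 'so \<Rightarrow> 'c2) arrow"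
type_synonym ('so, 's1, 's2, 'co, 'c1, 'c2) fun_fcat =
  "(('so, 's1, 's2, 'co, 'c1, 'c2) ffun, ('so, 's1, 's2, 'co, 'c1, 'c2) trans,
    ('so, 's1, 's2, 'co, 'c1, 'c2) modif) fcat"

definition is_wnat :: "weakness \<Rightarrow> ('so, 's1, 's2) fcat \<Rightarrow> ('co, 'c1, 'c2) fcat \<Rightarrow>
    ('so, 's1, 's2, 'co, 'c1, 'c2) trans \<Rightarrow> bool" where
  "is_wnat w S C \<phi> \<longleftrightarrow> (let M = asrc \<phi>; N = atrg \<phi>; \<phi>0 = cmpt (adata \<phi>); \<phi>1 = ncell (adata \<phi>) in
     is_ffunctor S C M \<and> is_ffunctor S C N \<and>
     \<phi>0 \<in> Obj S \<rightarrow>\<^sub>E Loose C \<and>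
     \<phi>1 \<in> Loose S \<rightarrow>\<^sub>E Cell C \<and>
     (\<forall>X\<in>Obj S. Dom C (\<phi>0 X) = FOb M X \<and> Cod C (\<phi>0 X) = FOb N X) \<and>
     (\<forall>s\<in>Loose S.
        directed_cell C w (\<phi>0 (Dom S s)) (FLo M s) (FLo N s) (\<phi>0 (Cod S s)) (\<phi>1 s) \<and>
        weak_cell C w (\<phi>1 s)) \<and>
     (\<forall>X\<in>Obj S. \<phi>1 (Id1 S X) = Id2 C (\<phi>0 X)) \<and>
     (\<forall>s\<in>Loose S. \<forall>r\<in>Loose S. Dom S r = Cod S s \<longrightarrow>
        \<phi>1 (r \<cdot>\<^bsub>S\<^esub> s) =
          (if w = Colax then (FLo N r \<rhd>\<^bsub>C\<^esub> \<phi>1 s) \<bullet>\<^bsub>C\<^esub> (\<phi>1 r \<lhd>\<^bsub>C\<^esub> FLo M s)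
           else (\<phi>1 r \<lhd>\<^bsub>C\<^esub> FLo M s) \<bullet>\<^bsub>C\<^esub> (FLo N r \<rhd>\<^bsub>C\<^esub> \<phi>1 s))) \<and>
     (\<forall>x\<in>Cell S.
        if w = Colax
        then (FCe N x \<lhd>\<^bsub>C\<^esub> \<phi>0 (Dom S (Src S x))) \<bullet>\<^bsub>C\<^esub> \<phi>1 (Src S x) =
             \<phi>1 (Trg S x) \<bullet>\<^bsub>C\<^esub> (\<phi>0 (Cod S (Src S x)) \<rhd>\<^bsub>C\<^esub> FCe M x)
        else \<phi>1 (Trg S x) \<bullet>\<^bsub>C\<^esub> (FCe N x \<lhd>\<^bsub>C\<^esub> \<phi>0 (Dom S (Src S x))) =
             (\<phi>0 (Cod S (Src S x)) \<rhd>\<^bsub>C\<^esub> FCe M x) \<bullet>\<^bsub>C\<^esub> \<phi>1 (Src S x)))"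

definition is_loose_trans :: "weakness \<Rightarrow> weakness \<Rightarrow> ('so, 's1, 's2) fcat \<Rightarrow>
    ('co, 'c1, 'c2) fcat \<Rightarrow> ('so, 's1, 's2, 'co, 'c1, 'c2) trans \<Rightarrow> bool" where
  "is_loose_trans w' w S C \<phi> \<longleftrightarrow>
     is_wnat w S C \<phi> \<and> (\<forall>s\<in>Tight S. weak_cell C w' (ncell (adata \<phi>) s))"

definition is_tight_trans :: "weakness \<Rightarrow> weakness \<Rightarrow> ('so, 's1, 's2) fcat \<Rightarrow>
    ('co, 'c1, 'c2) fcat \<Rightarrow> ('so, 's1, 's2, 'co, 'c1, 'c2) trans \<Rightarrow> bool" where
  "is_tight_trans w' w S C \<phi> \<longleftrightarrow>
     is_loose_trans w' w S C \<phi> \<and> (\<forall>X\<in>Obj S. cmpt (adata \<phi>) X \<in> Tight C) \<and>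
     (\<forall>s\<in>Loose S. weak_cell C w' (ncell (adata \<phi>) s))"

definition is_modif :: "weakness \<Rightarrow> weakness \<Rightarrow> ('so, 's1, 's2) fcat \<Rightarrow>
    ('co, 'c1, 'c2) fcat \<Rightarrow> ('so, 's1, 's2, 'co, 'c1, 'c2) modif \<Rightarrow> bool" where
  "is_modif w' w S C \<mu> \<longleftrightarrow> (let \<phi> = asrc \<mu>; \<psi> = atrg \<mu>; M = asrc \<phi>; N = atrg \<phi> in
     is_loose_trans w' w S C \<phi> \<and> is_loose_trans w' w S C \<psi> \<and>
     asrc \<psi> = M \<and> atrg \<psi> = N \<and>
     adata \<mu> \<in> Obj S \<rightarrow>\<^sub>E Cell C \<and>
     (\<forall>X\<in>Obj S. Src C (adata \<mu> X) = cmpt (adata \<phi>) X \<and> Trg C (adata \<mu> X) = cmpt (adata \<psi>) X) \<and>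
     (\<forall>s\<in>Loose S.
        if w = Colax
        then (FLo N s \<rhd>\<^bsub>C\<^esub> adata \<mu> (Dom S s)) \<bullet>\<^bsub>C\<^esub> ncell (adata \<phi>) s =
             ncell (adata \<psi>) s \<bullet>\<^bsub>C\<^esub> (adata \<mu> (Cod S s) \<lhd>\<^bsub>C\<^esub> FLo M s)
        else ncell (adata \<psi>) s \<bullet>\<^bsub>C\<^esub> (FLo N s \<rhd>\<^bsub>C\<^esub> adata \<mu> (Dom S s)) =
             (adata \<mu> (Cod S s) \<lhd>\<^bsub>C\<^esub> FLo M s) \<bullet>\<^bsub>C\<^esub> ncell (adata \<phi>) s))"

definition trans_id :: "('so, 's1, 's2) fcat \<Rightarrow> ('co, 'c1, 'c2) fcat \<Rightarrow>
    ('so, 's1, 's2, 'co, 'c1, 'c2) ffun \<Rightarrow> ('so, 's1, 's2, 'co, 'c1, 'c2) trans" where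
  "trans_id S C M = \<lparr>asrc = M, atrg = M, adata = \<lparr>
     cmpt = (\<lambda>X\<in>Obj S. Id1 C (FOb M X)),
     ncell = (\<lambda>s\<in>Loose S. Id2 C (FLo M s))\<rparr>\<rparr>"

definition trans_comp :: "weakness \<Rightarrow> ('so, 's1, 's2) fcat \<Rightarrow> ('co, 'c1, 'c2) fcat \<Rightarrow>
    ('so, 's1, 's2, 'co, 'c1, 'c2) trans \<Rightarrow> ('so, 's1, 's2, 'co, 'c1, 'c2) trans \<Rightarrow>
    ('so, 's1, 's2, 'co, 'c1, 'c2) trans" where
  "trans_comp w S C \<psi> \<phi> = \<lparr>asrc = asrc \<phi>, atrg = atrg \<psi>, adata = \<lparr>
     cmpt = (\<lambda>X\<in>Obj S. cmpt (adata \<psi>) X \<cdot>\<^bsub>C\<^esub> cmpt (adata \<phi>) X),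
     ncell = (\<lambda>s\<in>Loose S.
       let a = cmpt (adata \<psi>) (Cod S s) \<rhd>\<^bsub>C\<^esub> ncell (adata \<phi>) s;
           b = ncell (adata \<psi>) s \<lhd>\<^bsub>C\<^esub> cmpt (adata \<phi>) (Dom S s)
       in if w = Colax then b \<bullet>\<^bsub>C\<^esub> a else a \<bullet>\<^bsub>C\<^esub> b)\<rparr>\<rparr>"

definition Fun :: "weakness \<Rightarrow> weakness \<Rightarrow> ('so, 's1, 's2) fcat \<Rightarrow> ('co, 'c1, 'c2) fcat \<Rightarrow>
    ('so, 's1, 's2, 'co, 'c1, 'c2) fun_fcat" where
  "Fun w' w S C = \<lparr>
     Obj = {M. is_ffunctor S C M},
     Loose = {\<phi>. is_loose_trans w' w S C \<phi>},
     Tight = {\<phi>. is_tight_trans w' w S C \<phi>},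
     Dom = asrc,
     Cod = atrg,
     Id1 = trans_id S C,
     Cmp = trans_comp w S C,
     Cell = {\<mu>. is_modif w' w S C \<mu>},
     Src = asrc,
     Trg = atrg,
     Id2 = (\<lambda>\<phi>. \<lparr>asrc = \<phi>, atrg = \<phi>, adata = (\<lambda>X\<in>Obj S. Id2 C (cmpt (adata \<phi>) X))\<rparr>),
     VCmp = (\<lambda>\<nu> \<mu>. \<lparr>asrc = asrc \<mu>, atrg = atrg \<nu>,
       adata = (\<lambda>X\<in>Obj S. adata \<nu> X \<bullet>\<^bsub>C\<^esub> adata \<mu> X)\<rparr>),
     HCmp = (\<lambda>\<nu> \<mu>. \<lparr>asrc = trans_comp w S C (asrc \<nu>) (asrc \<mu>),
       atrg = trans_comp w S C (atrg \<nu>) (atrg \<mu>),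
       adata = (\<lambda>X\<in>Obj S. adata \<nu> X \<star>\<^bsub>C\<^esub> adata \<mu> X)\<rparr>)\<rparr>"


section \<open>Sketches, models and creation\<close>

record ('jo, 'j1, 'j2, 'wo, 'wa, 'o, 'm, 'c) sketch =
  sCat :: "('o, 'm, 'c) fcat"
  sCones :: "('jo, 'j1, 'j2, 'wo, 'wa, 'o, 'm, 'c) wcone set"

definition is_sketch :: "('jo, 'j1, 'j2, 'wo, 'wa, 'o, 'm, 'c) sketch \<Rightarrow> bool" where
  "is_sketch S \<longleftrightarrow> fcategory (sCat S) \<and> (\<forall>\<kappa>\<in>sCones S. is_cone (sCat S) \<kappa>)"

definition limit_sketch :: "('jo, 'j1, 'j2, 'wo, 'wa) weight set \<Rightarrow>
    ('jo, 'j1, 'j2, 'wo, 'wa, 'o, 'm, 'c) sketch \<Rightarrow> bool" where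
  "limit_sketch \<Psi> S \<longleftrightarrow> is_sketch S \<and> (\<forall>\<kappa>\<in>sCones S. cWeight \<kappa> \<in> \<Psi>)"

definition sketch_morphism :: "('jo, 'j1, 'j2, 'wo, 'wa, 'o, 'm, 'c) sketch \<Rightarrow>
    ('jo, 'j1, 'j2, 'wo, 'wa, 'p, 'n, 'd) sketch \<Rightarrow> ('o, 'm, 'c, 'p, 'n, 'd) ffun \<Rightarrow> bool" where
  "sketch_morphism S T F \<longleftrightarrow>
     is_ffunctor (sCat S) (sCat T) F \<and> (\<forall>\<kappa>\<in>sCones S. map_cone F \<kappa> \<in> sCones T)"

definition fcat_sketch ::
  "('o, 'm, 'c) fcat \<Rightarrow> ('jo, 'j1, 'j2, 'wo, 'wa, 'o, 'm, 'c) sketch" where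
  "fcat_sketch C = \<lparr>sCat = C, sCones = {\<kappa>. limit_cone C \<kappa>}\<rparr>"

definition Mod :: "weakness \<Rightarrow> weakness \<Rightarrow> ('jo, 'j1, 'j2, 'wo, 'wa, 'so, 's1, 's2) sketch \<Rightarrow>
    ('co, 'c1, 'c2) fcat \<Rightarrow> ('so, 's1, 's2, 'co, 'c1, 'c2) fun_fcat" where
  "Mod w' w S C = full_sub (Fun w' w (sCat S) C) {M. sketch_morphism S (fcat_sketch C) M}"

text \<open>Evaluation at \<open>X\<close>, as an \<open>\<F>\<close>-functor on a full sub-\<open>\<F>\<close>-category \<open>A\<close> of a functor category.\<close>

definition eval_at :: "('so, 's1, 's2, 'co, 'c1, 'c2) fun_fcat \<Rightarrow> 'so \<Rightarrow>
    (('so, 's1, 's2, 'co, 'c1, 'c2) ffun, ('so, 's1, 's2, 'co, 'c1, 'c2) trans,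
     ('so, 's1, 's2, 'co, 'c1, 'c2) modif, 'co, 'c1, 'c2) ffun" where
  "eval_at A X = \<lparr>FOb = (\<lambda>M\<in>Obj A. FOb M X), FLo = (\<lambda>\<phi>\<in>Loose A. cmpt (adata \<phi>) X),
     FCe = (\<lambda>\<mu>\<in>Cell A. adata \<mu> X)\<rparr>"

definition preserves_limits :: "('jo, 'j1, 'j2, 'wo, 'wa) weight set \<Rightarrow>
    ('o, 'm, 'c) fcat \<Rightarrow> ('p, 'n, 'd) fcat \<Rightarrow> ('o, 'm, 'c, 'p, 'n, 'd) ffun \<Rightarrow> bool" where
  "preserves_limits \<Psi> A B F \<longleftrightarrow>
     (\<forall>\<kappa>. cWeight \<kappa> \<in> \<Psi> \<and> limit_cone A \<kappa> \<longrightarrow> limit_cone B (map_cone F \<kappa>))"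

definition jointly_reflect_limits :: "('jo, 'j1, 'j2, 'wo, 'wa) weight set \<Rightarrow>
    ('o, 'm, 'c) fcat \<Rightarrow> ('p, 'n, 'd) fcat \<Rightarrow> ('o, 'm, 'c, 'p, 'n, 'd) ffun set \<Rightarrow> bool" where
  "jointly_reflect_limits \<Psi> A B \<F> \<longleftrightarrow>
     (\<forall>\<kappa>. cWeight \<kappa> \<in> \<Psi> \<and> is_cone A \<kappa> \<and> (\<forall>F\<in>\<F>. limit_cone B (map_cone F \<kappa>)) \<longrightarrow>
        limit_cone A \<kappa>)"

text \<open>
  HOL cannot quantify over types inside a formula, so the types on which the sketches and the
  \<open>\<F>\<close>-categories in the definition of creation live are parameters; \<open>created\<close> ranges over all
  \<open>\<Psi>\<close>-limit sketches and all \<open>\<Psi>\<close>-complete \<open>\<F>\<close>-categories on the given types. Creation in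
  the usual sense is the validity of \<open>created\<close> at all types.
\<close>

definition created :: "('jo, 'j1, 'j2, 'wo, 'wa) weight set \<Rightarrow> weakness \<Rightarrow> weakness \<Rightarrow>
    ('so, 's1, 's2) fcat itself \<Rightarrow> ('co, 'c1, 'c2) fcat itself \<Rightarrow> bool" where
  "created \<Psi> w' w _ _ \<longleftrightarrow>
     (\<forall>(S :: ('jo, 'j1, 'j2, 'wo, 'wa, 'so, 's1, 's2) sketch) (C :: ('co, 'c1, 'c2) fcat).
        limit_sketch \<Psi> S \<and> fcategory C \<and> complete \<Psi> C \<longrightarrow>
        complete \<Psi> (Mod w' w S C) \<and>
        (\<forall>X\<in>Obj (sCat S). preserves_limits \<Psi> (Mod w' w S C) C (eval_at (Mod w' w S C) X)) \<and>
        jointly_reflect_limits \<Psi> (Mod w' w S C) C (eval_at (Mod w' w S C) ` Obj (sCat S)))"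

end

(*
  A model of S in models of T assigns to X in S and Y in T an object M X Y of C, to arrows s and t
  arrows in each variable, and to the pair (s, t) a cell filling the resulting square.  Exchanging
  the variables exchanges the sides of that square, which reverses the direction of the cell; this
  is why the weaknesses of the two variables have to be dual to each other.  The coherence axioms
  then correspond one to one, so transposition is an isomorphism between the functor F-categories.
  It restricts to models: evaluation at Y preserves limits, so each transposed M(-, Y) is a
  model of S, and the evaluations at the objects X jointly reflect limits, so the transpose of M
  sends the cones of T to limit cones because every M(X, -) does.
*)
theory Submission
  imports Defs
begin

section \<open>Whiskering in a 2-category\<close>

text \<open>The obstacle to transposing cells unchanged is \<open>Pseudo\<close>:
  \<open>dual\<close> fixes it, so the direction prescribed for its cells stays the same, while
  exchanging the sides of a square reverses it. The cell must then be replaced by its inverse. For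
  \<open>Lax\<close> and \<open>Colax\<close> the dual weakness already prescribes the reversed
  direction and the same cell serves. \<open>Strict\<close> can be treated with
  \<open>Pseudo\<close>, an identity being its own inverse. The operation \<open>flip\<close>
  expresses this, and arguments about direction split accordingly into three cases.

  Transposition is built for functor categories and only then restricted. This is possible because a
  functor into models is a functor into all functors whose values happen to be models, which makes
  both iterated categories of models full subcategories of iterated functor categories. The inverse
  needs no construction of its own: it is transposition with the two sketches exchanged and the
  weaknesses dualised.

  Colax pasting facts are likewise not proved separately, but are the lax ones read in the
  2-category with reversed 2-cells.\<close>

abbreviation hom1 :: "('o, 'm, 'c) fcat \<Rightarrow> 'm \<Rightarrow> 'o \<Rightarrow> 'o \<Rightarrow> bool" where
  "hom1 C f X Y \<equiv> f \<in> Loose C \<and> Dom C f = X \<and> Cod C f = Y"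

abbreviation hom2 :: "('o, 'm, 'c) fcat \<Rightarrow> 'c \<Rightarrow> 'm \<Rightarrow> 'm \<Rightarrow> bool" where
  "hom2 C x f g \<equiv> x \<in> Cell C \<and> Src C x = f \<and> Trg C x = g"

text \<open>Reversing 2-cells turns lax squares into colax ones, so each pasting lemma is proved for
  the lax direction and instantiated here for the other.\<close>

definition co :: "('o, 'm, 'c) fcat \<Rightarrow> ('o, 'm, 'c) fcat" where
  "co C = C\<lparr>Src := Trg C, Trg := Src C, VCmp := (\<lambda>y x. VCmp C x y)\<rparr>"

lemma co_sel [simp]:
  "Obj (co C) = Obj C" "Loose (co C) = Loose C" "Tight (co C) = Tight C" "Dom (co C) = Dom C"
  "Cod (co C) = Cod C" "Id1 (co C) = Id1 C" "Cmp (co C) = Cmp C" "Cell (co C) = Cell C"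
  "Src (co C) = Trg C" "Trg (co C) = Src C" "Id2 (co C) = Id2 C"
  "VCmp (co C) y x = VCmp C x y" "HCmp (co C) = HCmp C"
  by (simp_all add: co_def)

context fcategory
begin

text \<open>The unit laws with the boundary as a separate premise: the simplifier rewrites
  \<open>Dom C f\<close> or \<open>Src C x\<close> first, after which the locale's form need not
  match any more.\<close>

lemma unit_simps [simp]:
  "\<lbrakk>f \<in> Loose C; Dom C f = X\<rbrakk> \<Longrightarrow> f \<cdot> Id1 C X = f"
  "\<lbrakk>f \<in> Loose C; Cod C f = X\<rbrakk> \<Longrightarrow> Id1 C X \<cdot> f = f"
  "\<lbrakk>x \<in> Cell C; Src C x = f\<rbrakk> \<Longrightarrow> x \<bullet> Id2 C f = x"
  "\<lbrakk>x \<in> Cell C; Trg C x = f\<rbrakk> \<Longrightarrow> Id2 C f \<bullet> x = x"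
  "\<lbrakk>x \<in> Cell C; Dom C (Src C x) = X\<rbrakk> \<Longrightarrow> x \<lhd> Id1 C X = x"
  "\<lbrakk>x \<in> Cell C; Cod C (Src C x) = X\<rbrakk> \<Longrightarrow> Id1 C X \<rhd> x = x"
  using cmp_id1 id1_cmp vcmp_id2 id2_vcmp hcmp_id2_id1 id2_id1_hcmp by auto

lemmas fcat_typing [simp] =
  dom_in cod_in id1_in dom_id1 cod_id1 cmp_in dom_cmp cod_cmp src_in trg_in dom_trg cod_trg
  id2_in src_id2 trg_id2 vcmp_in src_vcmp trg_vcmp hcmp_in src_hcmp trg_hcmp
  tight_loose tight_id1 tight_cmp

lemma co_fcategory: "fcategory (co C)"
proof -
  have "(y \<bullet> y') \<star> (x \<bullet> x') = (y \<star> x) \<bullet> (y' \<star> x')"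
    if "x \<in> Cell C" "x' \<in> Cell C" "y \<in> Cell C" "y' \<in> Cell C"
      "Trg C x' = Src C x" "Trg C y' = Src C y" "Dom C (Src C y) = Cod C (Src C x)" for x x' y y'
    using that interchange[of x' x y' y] by (metis cod_trg dom_trg)
  then show ?thesis
    by unfold_locales
      (auto simp: cmp_assoc vcmp_assoc hcmp_assoc hcmp_id2 hcmp_id2_id1 id2_id1_hcmp)
qed

lemma cmp_assoc': "\<lbrakk>f \<in> Loose C; g \<in> Loose C; h \<in> Loose C; Dom C g = Cod C f; Dom C h = Cod C g\<rbrakk>
    \<Longrightarrow> (h \<cdot> g) \<cdot> f = h \<cdot> (g \<cdot> f)"
  by (simp add: cmp_assoc)

lemma vcmp_assoc': "\<lbrakk>x \<in> Cell C; y \<in> Cell C; z \<in> Cell C; Src C y = Trg C x; Src C z = Trg C y\<rbrakk>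
    \<Longrightarrow> (z \<bullet> y) \<bullet> x = z \<bullet> (y \<bullet> x)"
  by (simp add: vcmp_assoc)

lemma hcmp_assoc': "\<lbrakk>x \<in> Cell C; y \<in> Cell C; z \<in> Cell C;
    Dom C (Src C y) = Cod C (Src C x); Dom C (Src C z) = Cod C (Src C y)\<rbrakk>
    \<Longrightarrow> (z \<star> y) \<star> x = z \<star> (y \<star> x)"
  by (simp add: hcmp_assoc)

lemma lwhisk_lwhisk: "\<lbrakk>f \<in> Loose C; g \<in> Loose C; x \<in> Cell C; Dom C g = Cod C f;
    Dom C f = Cod C (Src C x)\<rbrakk> \<Longrightarrow> g \<rhd> f \<rhd> x = (g \<cdot> f) \<rhd> x"
  by (simp add: hcmp_assoc hcmp_id2)

lemma lwhisk_vcmp: "\<lbrakk>g \<in> Loose C; x \<in> Cell C; y \<in> Cell C; Src C y = Trg C x;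
    Dom C g = Cod C (Src C x)\<rbrakk> \<Longrightarrow> g \<rhd> (y \<bullet> x) = (g \<rhd> y) \<bullet> (g \<rhd> x)"
  using interchange[of x y "Id2 C g" "Id2 C g"] vcmp_id2[of "Id2 C g"] by simp

lemma rwhisk_vcmp: "\<lbrakk>f \<in> Loose C; x \<in> Cell C; y \<in> Cell C; Src C y = Trg C x;
    Cod C f = Dom C (Src C x)\<rbrakk> \<Longrightarrow> (y \<bullet> x) \<lhd> f = (y \<lhd> f) \<bullet> (x \<lhd> f)"
  using interchange[of "Id2 C f" "Id2 C f" x y] vcmp_id2[of "Id2 C f"] by simp

text \<open>A normal form for pastings: whiskerings are distributed over vertical composites and
  merged, and everything is bracketed to the right. What remains between two pastings of the same
  diagram is interchange, supplied by \<open>whisk_swap\<close>.\<close>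

lemmas whisk_nf = cmp_assoc' vcmp_assoc' hcmp_assoc' lwhisk_lwhisk lwhisk_vcmp rwhisk_vcmp hcmp_id2

lemma hcmp_eq_left: "\<lbrakk>x \<in> Cell C; y \<in> Cell C; Dom C (Src C y) = Cod C (Src C x)\<rbrakk>
    \<Longrightarrow> (y \<lhd> Trg C x) \<bullet> (Src C y \<rhd> x) = y \<star> x"
  using interchange[of x "Id2 C (Trg C x)" "Id2 C (Src C y)" y] by simp

lemma hcmp_eq_right: "\<lbrakk>x \<in> Cell C; y \<in> Cell C; Dom C (Src C y) = Cod C (Src C x)\<rbrakk>
    \<Longrightarrow> (Trg C y \<rhd> x) \<bullet> (y \<lhd> Src C x) = y \<star> x"
  using interchange[of "Id2 C (Src C x)" x y "Id2 C (Trg C y)"] by simp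

text \<open>Both sides are the horizontal composite of \<open>y\<close> and
  \<open>x\<close>.\<close>

lemma whisk_swap:
  assumes "hom2 C x f f'" "hom2 C y g g'" "Dom C g = Cod C f"
  shows "(g' \<rhd> x) \<bullet> (y \<lhd> f) = (y \<lhd> f') \<bullet> (g \<rhd> x)"
  using hcmp_eq_left[of x y] hcmp_eq_right[of x y] assms by simp

text \<open>A two-by-two grid of lax squares can be pasted by rows or by columns. The only step
  beyond rebracketing is interchange of \<open>x\<close> and \<open>y'\<close>, the two squares that
  meet only in the corner \<open>B'\<close>. This is the composition law for structure cells of a
  composite transformation.\<close>

lemma lax_comp_comp:
  assumes "hom1 C m A A'" "hom1 C m' A' A''" "hom1 C n B B'" "hom1 C n' B' B''"
    "hom1 C p D D'" "hom1 C p' D' D''" "hom1 C f A B" "hom1 C f1 A' B'" "hom1 C f2 A'' B''"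
    "hom1 C g B D" "hom1 C g1 B' D'" "hom1 C g2 B'' D''"
    and x: "hom2 C x (n \<cdot> f) (f1 \<cdot> m)" and "hom2 C x' (n' \<cdot> f1) (f2 \<cdot> m')"
    and "hom2 C y (p \<cdot> g) (g1 \<cdot> n)" and y': "hom2 C y' (p' \<cdot> g1) (g2 \<cdot> n')"
  shows "(g2 \<rhd> ((x' \<lhd> m) \<bullet> (n' \<rhd> x))) \<bullet> (((y' \<lhd> n) \<bullet> (p' \<rhd> y)) \<lhd> f) =
    (((g2 \<rhd> x') \<bullet> (y' \<lhd> f1)) \<lhd> m) \<bullet> (p' \<rhd> ((g1 \<rhd> x) \<bullet> (y \<lhd> f)))" (is "?L = ?R")
proof -
  note [simp] = assms
  have "?L = (g2 \<rhd> x' \<lhd> m) \<bullet> (((g2 \<cdot> n') \<rhd> x) \<bullet> (y' \<lhd> (n \<cdot> f))) \<bullet> (p' \<rhd> y \<lhd> f)"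
    by (simp add: whisk_nf)
  also have "((g2 \<cdot> n') \<rhd> x) \<bullet> (y' \<lhd> (n \<cdot> f)) = (y' \<lhd> (f1 \<cdot> m)) \<bullet> ((p' \<cdot> g1) \<rhd> x)"
    by (rule whisk_swap[OF x y']) simp
  also have "(g2 \<rhd> x' \<lhd> m) \<bullet> \<dots> \<bullet> (p' \<rhd> y \<lhd> f) = ?R"
    by (simp add: whisk_nf)
  finally show ?thesis .
qed

text \<open>A 2-cell is pushed through two adjacent squares, by \<open>yc\<close> through the second
  and then by \<open>xb\<close> through the first. This is compatibility of a composite
  transformation with 2-cells.\<close>

lemma lax_comp_cell:
  assumes "hom1 C m A A'" "hom1 C m' A A'" "hom1 C n B B'" "hom1 C n' B B'"
    "hom1 C p D D'" "hom1 C p' D D'" "hom1 C f A B" "hom1 C f1 A' B'"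
    "hom1 C g B D" "hom1 C g1 B' D'"
    and "hom2 C x (n \<cdot> f) (f1 \<cdot> m)" and "hom2 C x' (n' \<cdot> f) (f1 \<cdot> m')"
    and "hom2 C y (p \<cdot> g) (g1 \<cdot> n)" and "hom2 C y' (p' \<cdot> g) (g1 \<cdot> n')"
    and "hom2 C a m m'" "hom2 C b n n'" "hom2 C c p p'"
    and xb: "x' \<bullet> (b \<lhd> f) = (f1 \<rhd> a) \<bullet> x" and yc: "y' \<bullet> (c \<lhd> g) = (g1 \<rhd> b) \<bullet> y"
  shows "((g1 \<rhd> x') \<bullet> (y' \<lhd> f)) \<bullet> (c \<lhd> (g \<cdot> f)) = ((g1 \<cdot> f1) \<rhd> a) \<bullet> ((g1 \<rhd> x) \<bullet> (y \<lhd> f))"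
    (is "?L = ?R")
proof -
  note [simp] = assms(1-17)
  have "?L = (g1 \<rhd> x') \<bullet> ((y' \<bullet> (c \<lhd> g)) \<lhd> f)"
    by (simp add: whisk_nf)
  also have "\<dots> = (g1 \<rhd> (x' \<bullet> (b \<lhd> f))) \<bullet> (y \<lhd> f)"
    unfolding yc by (simp add: whisk_nf)
  also have "\<dots> = ?R"
    unfolding xb by (simp add: whisk_nf)
  finally show ?thesis .
qed

end

section \<open>Invertible cells\<close>

definition inv2 :: "('o, 'm, 'c) fcat \<Rightarrow> 'c \<Rightarrow> 'c" where
  "inv2 C x = (THE y. hom2 C y (Trg C x) (Src C x) \<and>
     y \<bullet>\<^bsub>C\<^esub> x = Id2 C (Src C x) \<and> x \<bullet>\<^bsub>C\<^esub> y = Id2 C (Trg C x))"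

text \<open>The cell to be used when the sides of a square are exchanged and \<open>w\<close> is
  dualised. \<open>dual\<close> fixes \<open>Strict\<close> and \<open>Pseudo\<close>, so only there
  must the cell itself be reversed.\<close>

definition flip :: "('o, 'm, 'c) fcat \<Rightarrow> weakness \<Rightarrow> 'c \<Rightarrow> 'c" where
  "flip C w x = (if w = Strict \<or> w = Pseudo then inv2 C x else x)"

lemma dual_dual [simp]: "dual (dual w) = w"
  by (cases w) auto

lemma weak_cell_dual [simp]: "weak_cell C (dual w) x = weak_cell C w x"
  by (cases w) auto

lemma flip_dual: "flip C (dual w) = flip C w"
  by (cases w) (auto simp: flip_def fun_eq_iff)

context fcategory
begin

lemma inverse_unique:
  assumes x: "x \<in> Cell C" and y: "hom2 C y (Trg C x) (Src C x)" "y \<bullet> x = Id2 C (Src C x)"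
    and z: "hom2 C z (Trg C x) (Src C x)" "x \<bullet> z = Id2 C (Trg C x)"
  shows "y = z"
proof -
  have "y = y \<bullet> (x \<bullet> z)"
    using y z vcmp_id2[of y] by simp
  also have "\<dots> = (y \<bullet> x) \<bullet> z"
    by (rule vcmp_assoc) (use x y z in simp_all)
  also have "\<dots> = z"
    using y z id2_vcmp[of z] by simp
  finally show ?thesis .
qed

lemma inv2_eqI:
  assumes "x \<in> Cell C" "hom2 C y (Trg C x) (Src C x)"
    "y \<bullet> x = Id2 C (Src C x)" "x \<bullet> y = Id2 C (Trg C x)"
  shows "inv2 C x = y"
  unfolding inv2_def using assms by (intro the_equality) (auto intro: inverse_unique)

lemma inv2_props:
  assumes "x \<in> Cell C" "invertible_cell C x"
  shows "hom2 C (inv2 C x) (Trg C x) (Src C x)" "inv2 C x \<bullet> x = Id2 C (Src C x)"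
    "x \<bullet> inv2 C x = Id2 C (Trg C x)"
proof -
  from assms obtain y where "hom2 C y (Trg C x) (Src C x)"
    "y \<bullet> x = Id2 C (Src C x)" "x \<bullet> y = Id2 C (Trg C x)"
    unfolding invertible_cell_def by auto
  with inv2_eqI[OF assms(1) this]
  show "hom2 C (inv2 C x) (Trg C x) (Src C x)" "inv2 C x \<bullet> x = Id2 C (Src C x)"
    "x \<bullet> inv2 C x = Id2 C (Trg C x)" by auto
qed

lemma inv2_typing [simp]:
  assumes "x \<in> Cell C" "invertible_cell C x"
  shows "inv2 C x \<in> Cell C" "Src C (inv2 C x) = Trg C x" "Trg C (inv2 C x) = Src C x"
  using inv2_props[OF assms] by auto

lemma invertible_inv2: "x \<in> Cell C \<Longrightarrow> invertible_cell C x \<Longrightarrow> invertible_cell C (inv2 C x)"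
  unfolding invertible_cell_def[of C "inv2 C x"]
  by (rule bexI[of _ x]) (simp_all add: inv2_props)

lemma inv2_inv2: "x \<in> Cell C \<Longrightarrow> invertible_cell C x \<Longrightarrow> inv2 C (inv2 C x) = x"
  by (rule inv2_eqI) (simp_all add: inv2_props)

lemma vcmp_inverses:
  assumes "x \<in> Cell C" "x' \<in> Cell C" "Src C x' = Trg C x"
    "hom2 C y (Trg C x) (Src C x)" "y \<bullet> x = Id2 C (Src C x)"
    "hom2 C y' (Trg C x') (Src C x')" "y' \<bullet> x' = Id2 C (Src C x')"
  shows "(y \<bullet> y') \<bullet> (x' \<bullet> x) = Id2 C (Src C x)"
proof -
  note [simp] = assms(1-4) assms(6)
  have "(y \<bullet> y') \<bullet> (x' \<bullet> x) = y \<bullet> ((y' \<bullet> x') \<bullet> x)"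
    by (simp add: vcmp_assoc')
  also have "\<dots> = Id2 C (Src C x)"
    using id2_vcmp[of x] assms by simp
  finally show ?thesis .
qed

lemma inv2_vcmp:
  assumes "x \<in> Cell C" "invertible_cell C x" "y \<in> Cell C" "invertible_cell C y"
    "Src C y = Trg C x"
  shows "inv2 C (y \<bullet> x) = inv2 C x \<bullet> inv2 C y" "invertible_cell C (y \<bullet> x)"
proof -
  note p = inv2_props[OF assms(1,2)] inv2_props[OF assms(3,4)]
  have 1: "(inv2 C x \<bullet> inv2 C y) \<bullet> (y \<bullet> x) = Id2 C (Src C x)"
    by (rule vcmp_inverses) (simp_all add: assms p)
  have 2: "(y \<bullet> x) \<bullet> (inv2 C x \<bullet> inv2 C y) = Id2 C (Src C (inv2 C y))"
    by (rule vcmp_inverses) (simp_all add: assms p)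
  have 3: "hom2 C (inv2 C x \<bullet> inv2 C y) (Trg C (y \<bullet> x)) (Src C (y \<bullet> x))" "y \<bullet> x \<in> Cell C"
    by (simp_all add: assms)
  show "inv2 C (y \<bullet> x) = inv2 C x \<bullet> inv2 C y"
    by (rule inv2_eqI) (use 1 2 3 in \<open>simp_all add: assms\<close>)
  show "invertible_cell C (y \<bullet> x)"
    unfolding invertible_cell_def
    by (rule bexI[of _ "inv2 C x \<bullet> inv2 C y"]) (use 1 2 3 in \<open>simp_all add: assms\<close>)
qed

lemma inv2_lwhisk:
  assumes "x \<in> Cell C" "invertible_cell C x" "g \<in> Loose C" "Dom C g = Cod C (Src C x)"
  shows "inv2 C (g \<rhd> x) = g \<rhd> inv2 C x" "invertible_cell C (g \<rhd> x)"
proof -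
  note p = inv2_props[OF assms(1,2)]
  have 1: "(g \<rhd> inv2 C x) \<bullet> (g \<rhd> x) = Id2 C (g \<cdot> Src C x)"
    using p assms lwhisk_vcmp[of g x "inv2 C x"] by (simp add: hcmp_id2)
  have 2: "(g \<rhd> x) \<bullet> (g \<rhd> inv2 C x) = Id2 C (g \<cdot> Trg C x)"
    using p assms lwhisk_vcmp[of g "inv2 C x" x] by (simp add: hcmp_id2)
  have 3: "hom2 C (g \<rhd> inv2 C x) (g \<cdot> Trg C x) (g \<cdot> Src C x)"
    using assms by simp
  show "inv2 C (g \<rhd> x) = g \<rhd> inv2 C x"
    by (rule inv2_eqI) (simp_all add: assms 1 2)
  show "invertible_cell C (g \<rhd> x)"
    unfolding invertible_cell_def
    by (rule bexI[of _ "g \<rhd> inv2 C x"]) (simp_all add: assms 1 2)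
qed

lemma inv2_rwhisk:
  assumes "x \<in> Cell C" "invertible_cell C x" "f \<in> Loose C" "Cod C f = Dom C (Src C x)"
  shows "inv2 C (x \<lhd> f) = inv2 C x \<lhd> f" "invertible_cell C (x \<lhd> f)"
proof -
  note p = inv2_props[OF assms(1,2)]
  have 1: "(inv2 C x \<lhd> f) \<bullet> (x \<lhd> f) = Id2 C (Src C x \<cdot> f)"
    using p assms rwhisk_vcmp[of f x "inv2 C x"] by (simp add: hcmp_id2)
  have 2: "(x \<lhd> f) \<bullet> (inv2 C x \<lhd> f) = Id2 C (Trg C x \<cdot> f)"
    using p assms rwhisk_vcmp[of f "inv2 C x" x] by (simp add: hcmp_id2)
  have 3: "hom2 C (inv2 C x \<lhd> f) (Trg C x \<cdot> f) (Src C x \<cdot> f)"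
    using assms by simp
  show "inv2 C (x \<lhd> f) = inv2 C x \<lhd> f"
    by (rule inv2_eqI) (simp_all add: assms 1 2)
  show "invertible_cell C (x \<lhd> f)"
    unfolding invertible_cell_def
    by (rule bexI[of _ "inv2 C x \<lhd> f"]) (simp_all add: assms 1 2)
qed

lemma inv2_id2: "f \<in> Loose C \<Longrightarrow> inv2 C (Id2 C f) = Id2 C f"
  using inv2_eqI[of "Id2 C f" "Id2 C f"] vcmp_id2[of "Id2 C f"] by simp

lemma invertible_id2: "f \<in> Loose C \<Longrightarrow> invertible_cell C (Id2 C f)"
  unfolding invertible_cell_def using vcmp_id2[of "Id2 C f"]
  by (intro bexI[of _ "Id2 C f"]) auto

lemma weak_cell_invertible:
  "\<lbrakk>x \<in> Cell C; weak_cell C w x; w = Strict \<or> w = Pseudo\<rbrakk> \<Longrightarrow> invertible_cell C x"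
  using invertible_id2[of "Src C x"] by auto

lemma weak_cell_id2 [simp]: "f \<in> Loose C \<Longrightarrow> weak_cell C w (Id2 C f)"
  by (cases w) (auto simp: invertible_id2)

lemma weak_cell_vcmp: "\<lbrakk>x \<in> Cell C; y \<in> Cell C; Src C y = Trg C x;
    weak_cell C w x; weak_cell C w y\<rbrakk> \<Longrightarrow> weak_cell C w (y \<bullet> x)"
proof (cases w)
  case Strict
  assume a: "x \<in> Cell C" "y \<in> Cell C" "Src C y = Trg C x" "weak_cell C w x" "weak_cell C w y"
  with Strict have "y = Id2 C (Trg C x)" by simp
  then have "y \<bullet> x = x" using a by simp
  then show ?thesis using a by simp
qed (auto simp: inv2_vcmp)

lemma weak_cell_lwhisk: "\<lbrakk>x \<in> Cell C; g \<in> Loose C; Dom C g = Cod C (Src C x);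
    weak_cell C w x\<rbrakk> \<Longrightarrow> weak_cell C w (g \<rhd> x)"
proof (cases w)
  case Strict
  assume a: "x \<in> Cell C" "g \<in> Loose C" "Dom C g = Cod C (Src C x)" "weak_cell C w x"
  with Strict have "x = Id2 C (Src C x)" by simp
  then have "g \<rhd> x = Id2 C (g \<cdot> Src C x)"
    using a by (metis hcmp_id2 src_in)
  then show ?thesis using a Strict by simp
qed (auto simp: inv2_lwhisk)

lemma weak_cell_rwhisk: "\<lbrakk>x \<in> Cell C; f \<in> Loose C; Cod C f = Dom C (Src C x);
    weak_cell C w x\<rbrakk> \<Longrightarrow> weak_cell C w (x \<lhd> f)"
proof (cases w)
  case Strict
  assume a: "x \<in> Cell C" "f \<in> Loose C" "Cod C f = Dom C (Src C x)" "weak_cell C w x"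
  with Strict have "x = Id2 C (Src C x)" by simp
  then have "x \<lhd> f = Id2 C (Src C x \<cdot> f)"
    using a by (metis hcmp_id2 src_in)
  then show ?thesis using a Strict by simp
qed (auto simp: inv2_rwhisk)

lemma flip_strict: "x \<in> Cell C \<Longrightarrow> weak_cell C Strict x \<Longrightarrow> flip C w x = x"
  using inv2_id2[of "Src C x"] by (auto simp: flip_def)

lemma flip_in [simp]: "x \<in> Cell C \<Longrightarrow> weak_cell C w x \<Longrightarrow> flip C w x \<in> Cell C"
  using weak_cell_invertible[of x w] by (auto simp: flip_def)

lemma flip_flip [simp]: "x \<in> Cell C \<Longrightarrow> weak_cell C w x \<Longrightarrow> flip C w (flip C w x) = x"
  using weak_cell_invertible[of x w] by (auto simp: flip_def inv2_inv2)

lemma flip_id2 [simp]: "f \<in> Loose C \<Longrightarrow> flip C w (Id2 C f) = Id2 C f"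
  by (simp add: flip_def inv2_id2)

text \<open>Two weaknesses occur because a structure cell of a \<open>w\<close>-natural
  transformation may also have to be a \<open>w'\<close>-cell; reversing it must not destroy the
  latter property.\<close>

lemma weak_cell_flip [simp]:
  "\<lbrakk>x \<in> Cell C; weak_cell C w x; weak_cell C v x\<rbrakk> \<Longrightarrow> weak_cell C v (flip C w x)"
proof (cases v)
  case Strict
  assume "x \<in> Cell C" "weak_cell C w x" "weak_cell C v x"
  with Strict flip_strict[of x w] show ?thesis by simp
qed (use weak_cell_invertible[of x w] in \<open>auto simp: flip_def invertible_inv2\<close>)

text \<open>The new argument list is the square reflected in its diagonal. Reflection exchanges the
  two composite sides; \<open>dual\<close> compensates for this if the cell is lax or colax, the
  inverse does otherwise.\<close>

lemma directed_cell_flip: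
  "\<lbrakk>directed_cell C (dual w) f g h k x; weak_cell C w x\<rbrakk>
    \<Longrightarrow> directed_cell C w g f k h (flip C w x)"
  using weak_cell_invertible[of x w]
  by (cases w) (auto simp: directed_cell_def flip_def)

text \<open>
  Both the compatibility of a transformation with 2-cells and the modification axiom have the
  shape treated here: \<open>x\<close> and \<open>y\<close> are the structure cells.
\<close>

lemma flip_square:
  assumes "x \<in> Cell C" "weak_cell C w x" "y \<in> Cell C" "weak_cell C w y" "a \<in> Cell C" "b \<in> Cell C"
    and "if w = Lax then Src C a = Trg C x \<and> Trg C a = Trg C y \<and> Src C b = Src C x \<and> Trg C b = Src C y
      else Src C a = Src C x \<and> Trg C a = Src C y \<and> Src C b = Trg C x \<and> Trg C b = Trg C y"
    and eq: "if dual w = Colax then a \<bullet> x = y \<bullet> b else y \<bullet> a = b \<bullet> x"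
  shows "if w = Colax then b \<bullet> flip C w x = flip C w y \<bullet> a
    else flip C w y \<bullet> b = a \<bullet> flip C w x"
proof (cases "w = Strict \<or> w = Pseudo")
  case True
  note [simp] = assms(1-6)
  have i [simp]: "invertible_cell C x" "invertible_cell C y"
    using True assms weak_cell_invertible by blast+
  have e: "y \<bullet> a = b \<bullet> x" and [simp]: "Src C a = Src C x" "Trg C a = Src C y"
    "Src C b = Trg C x" "Trg C b = Trg C y"
    using True assms by auto
  have "inv2 C y \<bullet> b = inv2 C y \<bullet> (b \<bullet> (x \<bullet> inv2 C x))"
    using vcmp_id2[of b] by (simp add: inv2_props)
  also have "\<dots> = inv2 C y \<bullet> ((b \<bullet> x) \<bullet> inv2 C x)"
    by (simp add: vcmp_assoc')
  also have "\<dots> = (inv2 C y \<bullet> y) \<bullet> (a \<bullet> inv2 C x)"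
    unfolding e[symmetric] by (simp add: vcmp_assoc')
  also have "\<dots> = a \<bullet> inv2 C x"
    using id2_vcmp[of "a \<bullet> inv2 C x"] by (simp add: inv2_props)
  finally show ?thesis
    using True by (auto simp: flip_def)
next
  \<comment> \<open>For lax and colax cells \<open>flip\<close> does nothing, and the goal is the
    hypothesis with its sides exchanged.\<close>
  case False
  then show ?thesis using eq by (cases w) (auto simp: flip_def)
qed

text \<open>The equation \<open>e\<close> is a commuting hexagon in which \<open>a\<close> and
  \<open>b\<close> are opposite edges; inverting both edges leaves a commuting hexagon. It serves
  for the cube of structure cells when the weakness is strict or pseudo.\<close>

lemma cancel_invertible:
  assumes "a \<in> Cell C" "invertible_cell C a" "b \<in> Cell C" "invertible_cell C b"
    and "hom2 C u f g" "hom2 C v g (Src C a)" "hom2 C p (Trg C b) h" "hom2 C q h (Trg C a)"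
    and "Src C b = f"
    and e: "(a \<bullet> v) \<bullet> u = q \<bullet> (p \<bullet> b)"
  shows "(inv2 C a \<bullet> q) \<bullet> p = v \<bullet> (u \<bullet> inv2 C b)"
proof -
  note [simp] = assms(1-9)
  have "(inv2 C a \<bullet> q) \<bullet> p = inv2 C a \<bullet> (q \<bullet> (p \<bullet> (b \<bullet> inv2 C b)))"
    using vcmp_id2[of p] by (simp add: inv2_props vcmp_assoc')
  also have "\<dots> = inv2 C a \<bullet> ((q \<bullet> (p \<bullet> b)) \<bullet> inv2 C b)"
    by (simp add: vcmp_assoc')
  also have "\<dots> = (inv2 C a \<bullet> a) \<bullet> (v \<bullet> (u \<bullet> inv2 C b))"
    unfolding e[symmetric] by (simp add: vcmp_assoc')
  also have "\<dots> = v \<bullet> (u \<bullet> inv2 C b)"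
    using id2_vcmp[of "v \<bullet> (u \<bullet> inv2 C b)"] by (simp add: inv2_props)
  finally show ?thesis .
qed

end

section \<open>Transformations and modifications\<close>

context fcategory
begin

text \<open>Here \<open>u\<close> and \<open>uc\<close> are the components of a modification at the
  two ends of an arrow, and \<open>y\<close> is the structure cell of the transformation composed
  after it. The component \<open>u\<close> slides past \<open>y\<close> by interchange, and then the
  axiom \<open>h\<close> applies.\<close>

lemma lax_modif_lwhisk:
  assumes "hom1 C m A A'" "hom1 C n B B'" "hom1 C p D D'" "hom1 C f A B" "hom1 C f' A B"
    "hom1 C fc A' B'" "hom1 C fc' A' B'" "hom1 C g B D" "hom1 C gc B' D'"
    and "hom2 C x (n \<cdot> f) (fc \<cdot> m)" "hom2 C x' (n \<cdot> f') (fc' \<cdot> m)"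
    and y: "hom2 C y (p \<cdot> g) (gc \<cdot> n)" and u: "hom2 C u f f'" and "hom2 C uc fc fc'"
    and h: "x' \<bullet> (n \<rhd> u) = (uc \<lhd> m) \<bullet> x"
  shows "((gc \<rhd> x') \<bullet> (y \<lhd> f')) \<bullet> (p \<rhd> g \<rhd> u) =
    ((gc \<rhd> uc) \<lhd> m) \<bullet> ((gc \<rhd> x) \<bullet> (y \<lhd> f))" (is "?L = ?R")
proof -
  note [simp] = assms(1-14)
  have "?L = (gc \<rhd> x') \<bullet> ((y \<lhd> f') \<bullet> ((p \<cdot> g) \<rhd> u))"
    by (simp add: whisk_nf)
  also have "(y \<lhd> f') \<bullet> ((p \<cdot> g) \<rhd> u) = ((gc \<cdot> n) \<rhd> u) \<bullet> (y \<lhd> f)"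
    by (rule whisk_swap[OF u y, symmetric]) simp
  also have "(gc \<rhd> x') \<bullet> \<dots> = (gc \<rhd> (x' \<bullet> (n \<rhd> u))) \<bullet> (y \<lhd> f)"
    by (simp add: whisk_nf)
  also have "\<dots> = ?R"
    unfolding h by (simp add: whisk_nf)
  finally show ?thesis .
qed

text \<open>The same with the transformation composed before the modification: now the axiom
  \<open>h\<close> comes first and \<open>uc\<close> then slides past \<open>x\<close>.\<close>

lemma lax_modif_rwhisk:
  assumes "hom1 C m A A'" "hom1 C n B B'" "hom1 C p D D'" "hom1 C f A B"
    "hom1 C fc A' B'" "hom1 C g B D" "hom1 C g' B D" "hom1 C gc B' D'" "hom1 C gc' B' D'"
    and x: "hom2 C x (n \<cdot> f) (fc \<cdot> m)"
    and "hom2 C y (p \<cdot> g) (gc \<cdot> n)" "hom2 C y' (p \<cdot> g') (gc' \<cdot> n)"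
    and "hom2 C u g g'" and uc: "hom2 C uc gc gc'"
    and h: "y' \<bullet> (p \<rhd> u) = (uc \<lhd> n) \<bullet> y"
  shows "((gc' \<rhd> x) \<bullet> (y' \<lhd> f)) \<bullet> (p \<rhd> u \<lhd> f) =
    ((uc \<lhd> fc) \<lhd> m) \<bullet> ((gc \<rhd> x) \<bullet> (y \<lhd> f))" (is "?L = ?R")
proof -
  note [simp] = assms(1-14)
  have "?L = (gc' \<rhd> x) \<bullet> ((y' \<bullet> (p \<rhd> u)) \<lhd> f)"
    by (simp add: whisk_nf)
  also have "\<dots> = ((gc' \<rhd> x) \<bullet> (uc \<lhd> (n \<cdot> f))) \<bullet> (y \<lhd> f)"
    unfolding h by (simp add: whisk_nf)
  also have "(gc' \<rhd> x) \<bullet> (uc \<lhd> (n \<cdot> f)) = (uc \<lhd> (fc \<cdot> m)) \<bullet> (gc \<rhd> x)"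
    by (rule whisk_swap[OF x uc]) simp
  also have "\<dots> \<bullet> (y \<lhd> f) = ?R"
    by (simp add: whisk_nf)
  finally show ?thesis .
qed

text \<open>In the reversed 2-category the 2-cells of the hypotheses run backwards. Wherever a
  2-cell or a modification is involved, its source and target therefore trade places in the later
  instantiations.\<close>

lemmas colax_comp_comp = fcategory.lax_comp_comp[OF co_fcategory, unfolded co_sel]
lemmas colax_comp_cell = fcategory.lax_comp_cell[OF co_fcategory, unfolded co_sel]
lemmas colax_modif_lwhisk = fcategory.lax_modif_lwhisk[OF co_fcategory, unfolded co_sel]
lemmas colax_modif_rwhisk = fcategory.lax_modif_rwhisk[OF co_fcategory, unfolded co_sel]

end

section \<open>Introduction, elimination and extensionality rules for functors, transformations and
  modifications\<close>

abbreviation cm :: "('so, 's1, 's2, 'co, 'c1, 'c2) trans \<Rightarrow> 'so \<Rightarrow> 'c1" where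
  "cm \<phi> \<equiv> cmpt (adata \<phi>)"

abbreviation nc :: "('so, 's1, 's2, 'co, 'c1, 'c2) trans \<Rightarrow> 's1 \<Rightarrow> 'c2" where
  "nc \<phi> \<equiv> ncell (adata \<phi>)"

lemma ffunctorD:
  assumes "is_ffunctor A B F"
  shows "X \<in> Obj A \<Longrightarrow> FOb F X \<in> Obj B"
    "f \<in> Loose A \<Longrightarrow> FLo F f \<in> Loose B"
    "x \<in> Cell A \<Longrightarrow> FCe F x \<in> Cell B"
    "f \<in> Loose A \<Longrightarrow> Dom B (FLo F f) = FOb F (Dom A f)"
    "f \<in> Loose A \<Longrightarrow> Cod B (FLo F f) = FOb F (Cod A f)"
    "X \<in> Obj A \<Longrightarrow> FLo F (Id1 A X) = Id1 B (FOb F X)"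
    "\<lbrakk>f \<in> Loose A; g \<in> Loose A; Dom A g = Cod A f\<rbrakk>
      \<Longrightarrow> FLo F (g \<cdot>\<^bsub>A\<^esub> f) = FLo F g \<cdot>\<^bsub>B\<^esub> FLo F f"
    "x \<in> Cell A \<Longrightarrow> Src B (FCe F x) = FLo F (Src A x)"
    "x \<in> Cell A \<Longrightarrow> Trg B (FCe F x) = FLo F (Trg A x)"
    "f \<in> Loose A \<Longrightarrow> FCe F (Id2 A f) = Id2 B (FLo F f)"
    "\<lbrakk>x \<in> Cell A; y \<in> Cell A; Src A y = Trg A x\<rbrakk>
      \<Longrightarrow> FCe F (y \<bullet>\<^bsub>A\<^esub> x) = FCe F y \<bullet>\<^bsub>B\<^esub> FCe F x"
    "\<lbrakk>x \<in> Cell A; y \<in> Cell A; Dom A (Src A y) = Cod A (Src A x)\<rbrakk>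
      \<Longrightarrow> FCe F (y \<star>\<^bsub>A\<^esub> x) = FCe F y \<star>\<^bsub>B\<^esub> FCe F x"
    "f \<in> Tight A \<Longrightarrow> FLo F f \<in> Tight B"
  using assms by (auto simp: is_ffunctor_def PiE_iff)

lemma ffunctor_ext:
  assumes "is_ffunctor A B F"
  shows "FOb F \<in> extensional (Obj A)" "FLo F \<in> extensional (Loose A)" "FCe F \<in> extensional (Cell A)"
  using assms by (auto simp: is_ffunctor_def PiE_iff)

lemma ffunctor_eqI:
  assumes "is_ffunctor A B F" "is_ffunctor A B G"
    and "\<And>X. X \<in> Obj A \<Longrightarrow> FOb F X = FOb G X"
    and "\<And>f. f \<in> Loose A \<Longrightarrow> FLo F f = FLo G f"
    and "\<And>x. x \<in> Cell A \<Longrightarrow> FCe F x = FCe G x"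
  shows "F = G"
  using extensionalityI[OF ffunctor_ext(1)[OF assms(1)] ffunctor_ext(1)[OF assms(2)]]
    extensionalityI[OF ffunctor_ext(2)[OF assms(1)] ffunctor_ext(2)[OF assms(2)]]
    extensionalityI[OF ffunctor_ext(3)[OF assms(1)] ffunctor_ext(3)[OF assms(2)]]
  by (intro ffun.equality) (simp_all add: assms(3-5))

lemma wnatD:
  assumes "is_wnat w S C \<phi>"
  shows "is_ffunctor S C (asrc \<phi>)" "is_ffunctor S C (atrg \<phi>)"
    "X \<in> Obj S \<Longrightarrow> cm \<phi> X \<in> Loose C"
    "X \<in> Obj S \<Longrightarrow> Dom C (cm \<phi> X) = FOb (asrc \<phi>) X"
    "X \<in> Obj S \<Longrightarrow> Cod C (cm \<phi> X) = FOb (atrg \<phi>) X"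
    "s \<in> Loose S \<Longrightarrow> nc \<phi> s \<in> Cell C"
    "s \<in> Loose S \<Longrightarrow> directed_cell C w (cm \<phi> (Dom S s)) (FLo (asrc \<phi>) s) (FLo (atrg \<phi>) s)
       (cm \<phi> (Cod S s)) (nc \<phi> s)"
    "s \<in> Loose S \<Longrightarrow> Src C (nc \<phi> s) = (if w = Colax then cm \<phi> (Cod S s) \<cdot>\<^bsub>C\<^esub> FLo (asrc \<phi>) s
       else FLo (atrg \<phi>) s \<cdot>\<^bsub>C\<^esub> cm \<phi> (Dom S s))"
    "s \<in> Loose S \<Longrightarrow> Trg C (nc \<phi> s) = (if w = Colax then FLo (atrg \<phi>) s \<cdot>\<^bsub>C\<^esub> cm \<phi> (Dom S s)
       else cm \<phi> (Cod S s) \<cdot>\<^bsub>C\<^esub> FLo (asrc \<phi>) s)"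
    "s \<in> Loose S \<Longrightarrow> weak_cell C w (nc \<phi> s)"
    "X \<in> Obj S \<Longrightarrow> nc \<phi> (Id1 S X) = Id2 C (cm \<phi> X)"
    "\<lbrakk>s \<in> Loose S; r \<in> Loose S; Dom S r = Cod S s\<rbrakk> \<Longrightarrow> nc \<phi> (r \<cdot>\<^bsub>S\<^esub> s) =
          (if w = Colax
           then (FLo (atrg \<phi>) r \<rhd>\<^bsub>C\<^esub> nc \<phi> s) \<bullet>\<^bsub>C\<^esub> (nc \<phi> r \<lhd>\<^bsub>C\<^esub> FLo (asrc \<phi>) s)
           else (nc \<phi> r \<lhd>\<^bsub>C\<^esub> FLo (asrc \<phi>) s) \<bullet>\<^bsub>C\<^esub> (FLo (atrg \<phi>) r \<rhd>\<^bsub>C\<^esub> nc \<phi> s))"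
    "x \<in> Cell S \<Longrightarrow>
        if w = Colax
        then (FCe (atrg \<phi>) x \<lhd>\<^bsub>C\<^esub> cm \<phi> (Dom S (Src S x))) \<bullet>\<^bsub>C\<^esub> nc \<phi> (Src S x) =
             nc \<phi> (Trg S x) \<bullet>\<^bsub>C\<^esub> (cm \<phi> (Cod S (Src S x)) \<rhd>\<^bsub>C\<^esub> FCe (asrc \<phi>) x)
        else nc \<phi> (Trg S x) \<bullet>\<^bsub>C\<^esub> (FCe (atrg \<phi>) x \<lhd>\<^bsub>C\<^esub> cm \<phi> (Dom S (Src S x))) =
             (cm \<phi> (Cod S (Src S x)) \<rhd>\<^bsub>C\<^esub> FCe (asrc \<phi>) x) \<bullet>\<^bsub>C\<^esub> nc \<phi> (Src S x)"
    "cm \<phi> \<in> extensional (Obj S)" "nc \<phi> \<in> extensional (Loose S)"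
  using assms by (simp_all add: is_wnat_def Let_def PiE_iff directed_cell_def)

lemma wnatI:
  assumes "is_ffunctor S C (asrc \<phi>)" "is_ffunctor S C (atrg \<phi>)"
    "cm \<phi> \<in> extensional (Obj S)" "nc \<phi> \<in> extensional (Loose S)"
    "\<And>X. X \<in> Obj S \<Longrightarrow> hom1 C (cm \<phi> X) (FOb (asrc \<phi>) X) (FOb (atrg \<phi>) X)"
    "\<And>s. s \<in> Loose S \<Longrightarrow> directed_cell C w (cm \<phi> (Dom S s)) (FLo (asrc \<phi>) s) (FLo (atrg \<phi>) s)
       (cm \<phi> (Cod S s)) (nc \<phi> s)"
    "\<And>s. s \<in> Loose S \<Longrightarrow> weak_cell C w (nc \<phi> s)"
    "\<And>X. X \<in> Obj S \<Longrightarrow> nc \<phi> (Id1 S X) = Id2 C (cm \<phi> X)"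
    "\<And>s r. \<lbrakk>s \<in> Loose S; r \<in> Loose S; Dom S r = Cod S s\<rbrakk> \<Longrightarrow> nc \<phi> (r \<cdot>\<^bsub>S\<^esub> s) =
          (if w = Colax
           then (FLo (atrg \<phi>) r \<rhd>\<^bsub>C\<^esub> nc \<phi> s) \<bullet>\<^bsub>C\<^esub> (nc \<phi> r \<lhd>\<^bsub>C\<^esub> FLo (asrc \<phi>) s)
           else (nc \<phi> r \<lhd>\<^bsub>C\<^esub> FLo (asrc \<phi>) s) \<bullet>\<^bsub>C\<^esub> (FLo (atrg \<phi>) r \<rhd>\<^bsub>C\<^esub> nc \<phi> s))"
    "\<And>x. x \<in> Cell S \<Longrightarrow>
        if w = Colax
        then (FCe (atrg \<phi>) x \<lhd>\<^bsub>C\<^esub> cm \<phi> (Dom S (Src S x))) \<bullet>\<^bsub>C\<^esub> nc \<phi> (Src S x) =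
             nc \<phi> (Trg S x) \<bullet>\<^bsub>C\<^esub> (cm \<phi> (Cod S (Src S x)) \<rhd>\<^bsub>C\<^esub> FCe (asrc \<phi>) x)
        else nc \<phi> (Trg S x) \<bullet>\<^bsub>C\<^esub> (FCe (atrg \<phi>) x \<lhd>\<^bsub>C\<^esub> cm \<phi> (Dom S (Src S x))) =
             (cm \<phi> (Cod S (Src S x)) \<rhd>\<^bsub>C\<^esub> FCe (asrc \<phi>) x) \<bullet>\<^bsub>C\<^esub> nc \<phi> (Src S x)"
  shows "is_wnat w S C \<phi>"
  using assms by (simp add: is_wnat_def Let_def PiE_iff directed_cell_def)

lemma trans_eqI:
  fixes \<phi> \<psi> :: "('so, 's1, 's2, 'co, 'c1, 'c2) trans"
  assumes "is_wnat w S C \<phi>" "is_wnat w S C \<psi>" "asrc \<phi> = asrc \<psi>" "atrg \<phi> = atrg \<psi>"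
    "\<And>X. X \<in> Obj S \<Longrightarrow> cm \<phi> X = cm \<psi> X" "\<And>s. s \<in> Loose S \<Longrightarrow> nc \<phi> s = nc \<psi> s"
  shows "\<phi> = \<psi>"
  using extensionalityI[OF wnatD(14)[OF assms(1)] wnatD(14)[OF assms(2)]]
    extensionalityI[OF wnatD(15)[OF assms(1)] wnatD(15)[OF assms(2)]]
  by (intro arrow.equality tdata.equality) (simp_all add: assms(3-6))

lemma loose_transD:
  assumes "is_loose_trans w' w S C \<phi>"
  shows "is_wnat w S C \<phi>" "s \<in> Tight S \<Longrightarrow> weak_cell C w' (nc \<phi> s)"
  using assms by (auto simp: is_loose_trans_def)

lemma tight_transD:
  assumes "is_tight_trans w' w S C \<phi>"
  shows "is_loose_trans w' w S C \<phi>" "X \<in> Obj S \<Longrightarrow> cm \<phi> X \<in> Tight C"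
    "s \<in> Loose S \<Longrightarrow> weak_cell C w' (nc \<phi> s)"
  using assms by (auto simp: is_tight_trans_def)

lemma modifD:
  assumes "is_modif w' w S C \<mu>"
  shows "is_loose_trans w' w S C (asrc \<mu>)" "is_loose_trans w' w S C (atrg \<mu>)"
    "asrc (atrg \<mu>) = asrc (asrc \<mu>)" "atrg (atrg \<mu>) = atrg (asrc \<mu>)"
    "X \<in> Obj S \<Longrightarrow> adata \<mu> X \<in> Cell C"
    "X \<in> Obj S \<Longrightarrow> Src C (adata \<mu> X) = cm (asrc \<mu>) X"
    "X \<in> Obj S \<Longrightarrow> Trg C (adata \<mu> X) = cm (atrg \<mu>) X"
    "s \<in> Loose S \<Longrightarrow>
        if w = Colax
        then (FLo (atrg (asrc \<mu>)) s \<rhd>\<^bsub>C\<^esub> adata \<mu> (Dom S s)) \<bullet>\<^bsub>C\<^esub> nc (asrc \<mu>) s =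
             nc (atrg \<mu>) s \<bullet>\<^bsub>C\<^esub> (adata \<mu> (Cod S s) \<lhd>\<^bsub>C\<^esub> FLo (asrc (asrc \<mu>)) s)
        else nc (atrg \<mu>) s \<bullet>\<^bsub>C\<^esub> (FLo (atrg (asrc \<mu>)) s \<rhd>\<^bsub>C\<^esub> adata \<mu> (Dom S s)) =
             (adata \<mu> (Cod S s) \<lhd>\<^bsub>C\<^esub> FLo (asrc (asrc \<mu>)) s) \<bullet>\<^bsub>C\<^esub> nc (asrc \<mu>) s"
    "adata \<mu> \<in> extensional (Obj S)"
  using assms by (simp_all add: is_modif_def Let_def PiE_iff)

lemma modifI:
  assumes "is_loose_trans w' w S C (asrc \<mu>)" "is_loose_trans w' w S C (atrg \<mu>)"
    "asrc (atrg \<mu>) = asrc (asrc \<mu>)" "atrg (atrg \<mu>) = atrg (asrc \<mu>)"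
    "adata \<mu> \<in> extensional (Obj S)"
    "\<And>X. X \<in> Obj S \<Longrightarrow> hom2 C (adata \<mu> X) (cm (asrc \<mu>) X) (cm (atrg \<mu>) X)"
    "\<And>s. s \<in> Loose S \<Longrightarrow>
        if w = Colax
        then (FLo (atrg (asrc \<mu>)) s \<rhd>\<^bsub>C\<^esub> adata \<mu> (Dom S s)) \<bullet>\<^bsub>C\<^esub> nc (asrc \<mu>) s =
             nc (atrg \<mu>) s \<bullet>\<^bsub>C\<^esub> (adata \<mu> (Cod S s) \<lhd>\<^bsub>C\<^esub> FLo (asrc (asrc \<mu>)) s)
        else nc (atrg \<mu>) s \<bullet>\<^bsub>C\<^esub> (FLo (atrg (asrc \<mu>)) s \<rhd>\<^bsub>C\<^esub> adata \<mu> (Dom S s)) =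
             (adata \<mu> (Cod S s) \<lhd>\<^bsub>C\<^esub> FLo (asrc (asrc \<mu>)) s) \<bullet>\<^bsub>C\<^esub> nc (asrc \<mu>) s"
  shows "is_modif w' w S C \<mu>"
  using assms by (simp add: is_modif_def Let_def PiE_iff)

lemma modif_eqI:
  fixes \<mu> \<nu> :: "('so, 's1, 's2, 'co, 'c1, 'c2) modif"
  assumes "is_modif w' w S C \<mu>" "is_modif w' w S C \<nu>" "asrc \<mu> = asrc \<nu>" "atrg \<mu> = atrg \<nu>"
    "\<And>X. X \<in> Obj S \<Longrightarrow> adata \<mu> X = adata \<nu> X"
  shows "\<mu> = \<nu>"
  using extensionalityI[OF modifD(9)[OF assms(1)] modifD(9)[OF assms(2)]]
  by (intro arrow.equality) (simp_all add: assms(3-5))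

lemma Fun_sel [simp]:
  "Obj (Fun w' w S C) = {M. is_ffunctor S C M}"
  "Loose (Fun w' w S C) = {\<phi>. is_loose_trans w' w S C \<phi>}"
  "Tight (Fun w' w S C) = {\<phi>. is_tight_trans w' w S C \<phi>}"
  "Dom (Fun w' w S C) = asrc"
  "Cod (Fun w' w S C) = atrg"
  "Id1 (Fun w' w S C) = trans_id S C"
  "Cmp (Fun w' w S C) = trans_comp w S C"
  "Cell (Fun w' w S C) = {\<mu>. is_modif w' w S C \<mu>}"
  "Src (Fun w' w S C) = asrc"
  "Trg (Fun w' w S C) = atrg"
  "Id2 (Fun w' w S C) \<phi> = \<lparr>asrc = \<phi>, atrg = \<phi>, adata = (\<lambda>X\<in>Obj S. Id2 C (cm \<phi> X))\<rparr>"
  "VCmp (Fun w' w S C) \<nu> \<mu> = \<lparr>asrc = asrc \<mu>, atrg = atrg \<nu>,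
       adata = (\<lambda>X\<in>Obj S. adata \<nu> X \<bullet>\<^bsub>C\<^esub> adata \<mu> X)\<rparr>"
  "HCmp (Fun w' w S C) \<nu> \<mu> = \<lparr>asrc = trans_comp w S C (asrc \<nu>) (asrc \<mu>),
       atrg = trans_comp w S C (atrg \<nu>) (atrg \<mu>),
       adata = (\<lambda>X\<in>Obj S. adata \<nu> X \<star>\<^bsub>C\<^esub> adata \<mu> X)\<rparr>"
  by (simp_all add: Fun_def)

lemma trans_comp_sel [simp]:
  "asrc (trans_comp w S C \<psi> \<phi>) = asrc \<phi>"
  "atrg (trans_comp w S C \<psi> \<phi>) = atrg \<psi>"
  "X \<in> Obj S \<Longrightarrow> cm (trans_comp w S C \<psi> \<phi>) X = cm \<psi> X \<cdot>\<^bsub>C\<^esub> cm \<phi> X"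
  "s \<in> Loose S \<Longrightarrow> nc (trans_comp w S C \<psi> \<phi>) s =
     (if w = Colax then (nc \<psi> s \<lhd>\<^bsub>C\<^esub> cm \<phi> (Dom S s)) \<bullet>\<^bsub>C\<^esub> (cm \<psi> (Cod S s) \<rhd>\<^bsub>C\<^esub> nc \<phi> s)
      else (cm \<psi> (Cod S s) \<rhd>\<^bsub>C\<^esub> nc \<phi> s) \<bullet>\<^bsub>C\<^esub> (nc \<psi> s \<lhd>\<^bsub>C\<^esub> cm \<phi> (Dom S s)))"
  by (simp_all add: trans_comp_def Let_def)

lemma trans_id_sel [simp]:
  "asrc (trans_id S C M) = M"
  "atrg (trans_id S C M) = M"
  "X \<in> Obj S \<Longrightarrow> cm (trans_id S C M) X = Id1 C (FOb M X)"
  "s \<in> Loose S \<Longrightarrow> nc (trans_id S C M) s = Id2 C (FLo M s)"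
  by (simp_all add: trans_id_def)

section \<open>Functor \<F>-categories are \<F>-categories\<close>

locale fcat_pair = S: fcategory S + C: fcategory C
  for S :: "('so, 's1, 's2) fcat" and C :: "('co, 'c1, 'c2) fcat"
begin

lemma wnat_id:
  assumes M: "is_ffunctor S C M"
  shows "is_wnat w S C (trans_id S C M)"
proof -
  note [simp] = ffunctorD[OF M]
  show ?thesis
    by (rule wnatI)
      (auto simp: M directed_cell_def C.hcmp_id2 trans_id_def)
qed

lemma tight_trans_id: "is_ffunctor S C M \<Longrightarrow> is_tight_trans w' w S C (trans_id S C M)"
  using wnat_id ffunctorD[of S C M] by (simp add: is_tight_trans_def is_loose_trans_def)

lemma wnat_comp:
  assumes p: "is_wnat w S C \<phi>" and q: "is_wnat w S C \<psi>" and e: "asrc \<psi> = atrg \<phi>"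
  shows "is_wnat w S C (trans_comp w S C \<psi> \<phi>)"
proof -
  note D = wnatD(3-6,8-9)[OF p] wnatD(3-6,8-9)[OF q]
    ffunctorD[OF wnatD(1)[OF p]] ffunctorD[OF wnatD(2)[OF p]] ffunctorD[OF wnatD(2)[OF q]]
  note [simp] = D e wnatD(11)[OF p] wnatD(11)[OF q]
  show ?thesis
  proof (rule wnatI, goal_cases)
    case (9 s r)
    \<comment> \<open>The corner objects occur only in the premises of the pasting rules, so they
      cannot be found by unification with the goal.\<close>
    then show ?case
      by (simp add: wnatD(12)[OF p] wnatD(12)[OF q])
        (intro conjI impI
          C.lax_comp_comp[where A = "FOb (asrc \<phi>) (Dom S s)" and A' = "FOb (asrc \<phi>) (Cod S s)"
            and A'' = "FOb (asrc \<phi>) (Cod S r)" and B = "FOb (atrg \<phi>) (Dom S s)"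
            and B' = "FOb (atrg \<phi>) (Cod S s)" and B'' = "FOb (atrg \<phi>) (Cod S r)"
            and D = "FOb (atrg \<psi>) (Dom S s)"
            and D' = "FOb (atrg \<psi>) (Cod S s)" and D'' = "FOb (atrg \<psi>) (Cod S r)"]
          C.colax_comp_comp[where A = "FOb (asrc \<phi>) (Dom S s)" and A' = "FOb (asrc \<phi>) (Cod S s)"
            and A'' = "FOb (asrc \<phi>) (Cod S r)" and B = "FOb (atrg \<phi>) (Dom S s)"
            and B' = "FOb (atrg \<phi>) (Cod S s)" and B'' = "FOb (atrg \<phi>) (Cod S r)"
            and D = "FOb (atrg \<psi>) (Dom S s)"
            and D' = "FOb (atrg \<psi>) (Cod S s)" and D'' = "FOb (atrg \<psi>) (Cod S r)"]; simp)
  next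
    case (10 x)
    define s where "s = Src S x"
    define s' where "s' = Trg S x"
    have [simp]: "x \<in> Cell S" "Src S x = s" "Trg S x = s'" "s \<in> Loose S" "s' \<in> Loose S"
      "Dom S s' = Dom S s" "Cod S s' = Cod S s"
      using 10 by (simp_all add: s_def s'_def)
    show ?case
    proof (cases "w = Colax")
      case True
      have "(FCe (atrg \<psi>) x \<lhd>\<^bsub>C\<^esub> (cm \<psi> (Dom S s) \<cdot>\<^bsub>C\<^esub> cm \<phi> (Dom S s))) \<bullet>\<^bsub>C\<^esub>
          (nc \<psi> s \<lhd>\<^bsub>C\<^esub> cm \<phi> (Dom S s)) \<bullet>\<^bsub>C\<^esub> (cm \<psi> (Cod S s) \<rhd>\<^bsub>C\<^esub> nc \<phi> s) =
        ((nc \<psi> s' \<lhd>\<^bsub>C\<^esub> cm \<phi> (Dom S s)) \<bullet>\<^bsub>C\<^esub> (cm \<psi> (Cod S s) \<rhd>\<^bsub>C\<^esub> nc \<phi> s')) \<bullet>\<^bsub>C\<^esub>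
          ((cm \<psi> (Cod S s) \<cdot>\<^bsub>C\<^esub> cm \<phi> (Cod S s)) \<rhd>\<^bsub>C\<^esub> FCe (asrc \<phi>) x)"
        by (rule C.colax_comp_cell[where A = "FOb (asrc \<phi>) (Dom S s)"
            and A' = "FOb (asrc \<phi>) (Cod S s)" and B = "FOb (atrg \<phi>) (Dom S s)"
            and B' = "FOb (atrg \<phi>) (Cod S s)" and D = "FOb (atrg \<psi>) (Dom S s)"
            and D' = "FOb (atrg \<psi>) (Cod S s)" and b = "FCe (atrg \<phi>) x"
            and m = "FLo (asrc \<phi>) s'" and m' = "FLo (asrc \<phi>) s"
            and n = "FLo (atrg \<phi>) s'" and n' = "FLo (atrg \<phi>) s"
            and p = "FLo (atrg \<psi>) s'" and p' = "FLo (atrg \<psi>) s"])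
          (use wnatD(13)[OF p, of x] wnatD(13)[OF q, of x] True in simp_all)
      then show ?thesis using True by simp
    next
      case False
      have "((cm \<psi> (Cod S s) \<rhd>\<^bsub>C\<^esub> nc \<phi> s') \<bullet>\<^bsub>C\<^esub> (nc \<psi> s' \<lhd>\<^bsub>C\<^esub> cm \<phi> (Dom S s))) \<bullet>\<^bsub>C\<^esub>
          (FCe (atrg \<psi>) x \<lhd>\<^bsub>C\<^esub> (cm \<psi> (Dom S s) \<cdot>\<^bsub>C\<^esub> cm \<phi> (Dom S s))) =
        ((cm \<psi> (Cod S s) \<cdot>\<^bsub>C\<^esub> cm \<phi> (Cod S s)) \<rhd>\<^bsub>C\<^esub> FCe (asrc \<phi>) x) \<bullet>\<^bsub>C\<^esub>
          ((cm \<psi> (Cod S s) \<rhd>\<^bsub>C\<^esub> nc \<phi> s) \<bullet>\<^bsub>C\<^esub> (nc \<psi> s \<lhd>\<^bsub>C\<^esub> cm \<phi> (Dom S s)))"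
        by (rule C.lax_comp_cell[where A = "FOb (asrc \<phi>) (Dom S s)"
            and A' = "FOb (asrc \<phi>) (Cod S s)" and B = "FOb (atrg \<phi>) (Dom S s)"
            and B' = "FOb (atrg \<phi>) (Cod S s)" and D = "FOb (atrg \<psi>) (Dom S s)"
            and D' = "FOb (atrg \<psi>) (Cod S s)" and b = "FCe (atrg \<phi>) x"
            and m = "FLo (asrc \<phi>) s" and m' = "FLo (asrc \<phi>) s'"
            and n = "FLo (atrg \<phi>) s" and n' = "FLo (atrg \<phi>) s'"
            and p = "FLo (atrg \<psi>) s" and p' = "FLo (atrg \<psi>) s'"])
          (use wnatD(13)[OF p, of x] wnatD(13)[OF q, of x] False in simp_all)
      then show ?thesis using False by simp
    qed
  next
    case (7 s)
    then show ?case
      using wnatD(10)[OF p, of s] wnatD(10)[OF q, of s]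
      by (cases "w = Colax")
        (simp_all add: C.weak_cell_vcmp C.weak_cell_lwhisk C.weak_cell_rwhisk C.cmp_assoc)
  next
    case (6 s)
    then show ?case by (simp add: directed_cell_def C.cmp_assoc)
  qed (auto simp: wnatD[OF p] wnatD[OF q] C.hcmp_id2 trans_comp_def)
qed

lemma loose_trans_comp:
  assumes p: "is_loose_trans w' w S C \<phi>" and q: "is_loose_trans w' w S C \<psi>"
    and e: "asrc \<psi> = atrg \<phi>"
  shows "is_loose_trans w' w S C (trans_comp w S C \<psi> \<phi>)"
proof -
  note wp = loose_transD(1)[OF p] and wq = loose_transD(1)[OF q]
  note [simp] = wnatD(3-6,8-9)[OF wp] wnatD(3-6,8-9)[OF wq] e
    ffunctorD[OF wnatD(1)[OF wp]] ffunctorD[OF wnatD(2)[OF wp]] ffunctorD[OF wnatD(2)[OF wq]]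
  show ?thesis
    unfolding is_loose_trans_def using wnat_comp[OF wp wq e]
    by (auto simp: loose_transD(2)[OF p] loose_transD(2)[OF q] C.cmp_assoc
      intro!: C.weak_cell_vcmp C.weak_cell_lwhisk C.weak_cell_rwhisk)
qed

lemma tight_trans_comp:
  assumes p: "is_tight_trans w' w S C \<phi>" and q: "is_tight_trans w' w S C \<psi>"
    and e: "asrc \<psi> = atrg \<phi>"
  shows "is_tight_trans w' w S C (trans_comp w S C \<psi> \<phi>)"
proof -
  note lp = tight_transD(1)[OF p] and lq = tight_transD(1)[OF q]
  note wp = loose_transD(1)[OF lp] and wq = loose_transD(1)[OF lq]
  note [simp] = wnatD(3-6,8-9)[OF wp] wnatD(3-6,8-9)[OF wq] e
    ffunctorD[OF wnatD(1)[OF wp]] ffunctorD[OF wnatD(2)[OF wp]] ffunctorD[OF wnatD(2)[OF wq]]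
  show ?thesis
    unfolding is_tight_trans_def using loose_trans_comp[OF lp lq e]
    by (auto simp: tight_transD[OF p] tight_transD[OF q] C.cmp_assoc
      intro!: C.weak_cell_vcmp C.weak_cell_lwhisk C.weak_cell_rwhisk)
qed

lemma trans_comp_id:
  assumes p: "is_wnat w S C \<phi>"
  shows "trans_comp w S C \<phi> (trans_id S C (asrc \<phi>)) = \<phi>"
    and "trans_comp w S C (trans_id S C (atrg \<phi>)) \<phi> = \<phi>"
proof -
  note [simp] = wnatD(3-6,8-9)[OF p]
    ffunctorD[OF wnatD(1)[OF p]] ffunctorD[OF wnatD(2)[OF p]]
  show "trans_comp w S C \<phi> (trans_id S C (asrc \<phi>)) = \<phi>"
    by (rule trans_eqI[OF wnat_comp p]) (simp_all add: p wnat_id C.hcmp_id2 wnatD(1)[OF p])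
  show "trans_comp w S C (trans_id S C (atrg \<phi>)) \<phi> = \<phi>"
    by (rule trans_eqI[OF wnat_comp p]) (simp_all add: p wnat_id C.hcmp_id2 wnatD(2)[OF p])
qed

lemma trans_comp_assoc:
  assumes p: "is_wnat w S C \<phi>" and q: "is_wnat w S C \<psi>" and r: "is_wnat w S C \<chi>"
    and e: "asrc \<psi> = atrg \<phi>" "asrc \<chi> = atrg \<psi>"
  shows "trans_comp w S C \<chi> (trans_comp w S C \<psi> \<phi>) = trans_comp w S C (trans_comp w S C \<chi> \<psi>) \<phi>"
proof -
  note [simp] = wnatD(3-6,8-9)[OF p] wnatD(3-6,8-9)[OF q] wnatD(3-6,8-9)[OF r] e
    ffunctorD[OF wnatD(1)[OF p]] ffunctorD[OF wnatD(2)[OF p]] ffunctorD[OF wnatD(2)[OF q]]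
    ffunctorD[OF wnatD(2)[OF r]]
  show ?thesis
    by (rule trans_eqI[where w = w and S = S and C = C])
      (simp_all add: p q r wnat_comp C.whisk_nf)
qed

lemma modif_id:
  assumes "is_loose_trans w' w S C \<phi>"
  shows "is_modif w' w S C (Id2 (Fun w' w S C) \<phi>)"
proof -
  note p = loose_transD(1)[OF assms]
  note [simp] = wnatD(3-6,8-9)[OF p] ffunctorD[OF wnatD(1)[OF p]] ffunctorD[OF wnatD(2)[OF p]]
  show ?thesis
    by (rule modifI) (simp_all add: assms C.hcmp_id2)
qed

lemma modif_vcmp:
  assumes m: "is_modif w' w S C \<mu>" and n: "is_modif w' w S C \<nu>" and e: "asrc \<nu> = atrg \<mu>"
  shows "is_modif w' w S C (VCmp (Fun w' w S C) \<nu> \<mu>)"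
proof -
  note p = loose_transD(1)[OF modifD(1)[OF m]] and q = loose_transD(1)[OF modifD(2)[OF m]]
    and r = loose_transD(1)[OF modifD(2)[OF n]]
  note [simp] = wnatD(3-6,8-9)[OF p] ffunctorD[OF wnatD(1)[OF p]] ffunctorD[OF wnatD(2)[OF p]]
    wnatD(3-6,8-9)[OF q] wnatD(3-6,8-9)[OF r] modifD(3-7)[OF m] modifD(3-7)[OF n] e
  show ?thesis
  proof (rule modifI, goal_cases)
    case (7 s)
    let ?X = "Dom S s" and ?Y = "Cod S s"
    let ?M = "FLo (asrc (asrc \<mu>)) s" and ?N = "FLo (atrg (asrc \<mu>)) s"
    show ?case
    proof (cases "w = Colax")
      case True
      have "(?N \<rhd>\<^bsub>C\<^esub> (adata \<nu> ?X \<bullet>\<^bsub>C\<^esub> adata \<mu> ?X)) \<bullet>\<^bsub>C\<^esub> nc (asrc \<mu>) s =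
          (?N \<rhd>\<^bsub>C\<^esub> adata \<nu> ?X) \<bullet>\<^bsub>C\<^esub> ((?N \<rhd>\<^bsub>C\<^esub> adata \<mu> ?X) \<bullet>\<^bsub>C\<^esub> nc (asrc \<mu>) s)"
        using 7 True by (simp add: C.whisk_nf)
      also have "\<dots> = ((?N \<rhd>\<^bsub>C\<^esub> adata \<nu> ?X) \<bullet>\<^bsub>C\<^esub> nc (atrg \<mu>) s) \<bullet>\<^bsub>C\<^esub> (adata \<mu> ?Y \<lhd>\<^bsub>C\<^esub> ?M)"
        using 7 True modifD(8)[OF m, of s] by (simp add: C.whisk_nf)
      also have "\<dots> = nc (atrg \<nu>) s \<bullet>\<^bsub>C\<^esub> ((adata \<nu> ?Y \<bullet>\<^bsub>C\<^esub> adata \<mu> ?Y) \<lhd>\<^bsub>C\<^esub> ?M)"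
        using 7 True modifD(8)[OF n, of s] by (simp add: C.whisk_nf)
      finally show ?thesis using 7 True by simp
    next
      case False
      have "nc (atrg \<nu>) s \<bullet>\<^bsub>C\<^esub> (?N \<rhd>\<^bsub>C\<^esub> (adata \<nu> ?X \<bullet>\<^bsub>C\<^esub> adata \<mu> ?X)) =
          (nc (atrg \<nu>) s \<bullet>\<^bsub>C\<^esub> (?N \<rhd>\<^bsub>C\<^esub> adata \<nu> ?X)) \<bullet>\<^bsub>C\<^esub> (?N \<rhd>\<^bsub>C\<^esub> adata \<mu> ?X)"
        using 7 False by (simp add: C.whisk_nf)
      also have "\<dots> = (adata \<nu> ?Y \<lhd>\<^bsub>C\<^esub> ?M) \<bullet>\<^bsub>C\<^esub> (nc (atrg \<mu>) s \<bullet>\<^bsub>C\<^esub> (?N \<rhd>\<^bsub>C\<^esub> adata \<mu> ?X))"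
        using 7 False modifD(8)[OF n, of s] by (simp add: C.whisk_nf)
      also have "\<dots> = ((adata \<nu> ?Y \<bullet>\<^bsub>C\<^esub> adata \<mu> ?Y) \<lhd>\<^bsub>C\<^esub> ?M) \<bullet>\<^bsub>C\<^esub> nc (asrc \<mu>) s"
        using 7 False modifD(8)[OF m, of s] by (simp add: C.whisk_nf)
      finally show ?thesis using 7 False by simp
    qed
  qed (simp_all add: modifD[OF m] modifD[OF n])
qed

lemma modif_lwhisk:
  assumes m: "is_modif w' w S C \<mu>" and l: "is_loose_trans w' w S C \<psi>"
    and e: "asrc \<psi> = atrg (asrc \<mu>)"
  shows "is_modif w' w S C (\<psi> \<rhd>\<^bsub>Fun w' w S C\<^esub> \<mu>)"
proof -
  note p = loose_transD(1)[OF modifD(1)[OF m]] and q = loose_transD(1)[OF modifD(2)[OF m]]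
    and r = loose_transD(1)[OF l]
  note [simp] = wnatD(3-6,8-9)[OF p] ffunctorD[OF wnatD(1)[OF p]] ffunctorD[OF wnatD(2)[OF p]]
    wnatD(3-6,8-9)[OF q] wnatD(3-6,8-9)[OF r] modifD(3-7)[OF m] e ffunctorD[OF wnatD(2)[OF r]]
  show ?thesis
  proof (rule modifI, goal_cases)
    case (7 s)
    let ?M = "asrc (asrc \<mu>)" and ?N = "atrg (asrc \<mu>)"
    show ?case
      using 7 modifD(8)[OF m, of s]
        C.lax_modif_lwhisk[where A = "FOb ?M (Dom S s)" and A' = "FOb ?M (Cod S s)"
          and B = "FOb ?N (Dom S s)" and B' = "FOb ?N (Cod S s)"
          and D = "FOb (atrg \<psi>) (Dom S s)" and D' = "FOb (atrg \<psi>) (Cod S s)"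
          and m = "FLo ?M s" and n = "FLo ?N s" and p = "FLo (atrg \<psi>) s"
          and f = "cm (asrc \<mu>) (Dom S s)" and fc = "cm (asrc \<mu>) (Cod S s)"
          and f' = "cm (atrg \<mu>) (Dom S s)" and fc' = "cm (atrg \<mu>) (Cod S s)"
          and g = "cm \<psi> (Dom S s)" and gc = "cm \<psi> (Cod S s)"
          and x = "nc (asrc \<mu>) s" and x' = "nc (atrg \<mu>) s" and y = "nc \<psi> s"
          and u = "adata \<mu> (Dom S s)" and uc = "adata \<mu> (Cod S s)"]
        C.colax_modif_lwhisk[where A = "FOb ?M (Dom S s)" and A' = "FOb ?M (Cod S s)"
          and B = "FOb ?N (Dom S s)" and B' = "FOb ?N (Cod S s)"
          and D = "FOb (atrg \<psi>) (Dom S s)" and D' = "FOb (atrg \<psi>) (Cod S s)"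
          and m = "FLo ?M s" and n = "FLo ?N s" and p = "FLo (atrg \<psi>) s"
          and f = "cm (atrg \<mu>) (Dom S s)" and fc = "cm (atrg \<mu>) (Cod S s)"
          and f' = "cm (asrc \<mu>) (Dom S s)" and fc' = "cm (asrc \<mu>) (Cod S s)"
          and g = "cm \<psi> (Dom S s)" and gc = "cm \<psi> (Cod S s)"
          and x = "nc (atrg \<mu>) s" and x' = "nc (asrc \<mu>) s" and y = "nc \<psi> s"
          and u = "adata \<mu> (Dom S s)" and uc = "adata \<mu> (Cod S s)"]
      by (cases "w = Colax") simp_all
  qed (simp_all add: modifD[OF m] l loose_trans_comp)
qed

lemma modif_rwhisk:
  assumes m: "is_modif w' w S C \<nu>" and l: "is_loose_trans w' w S C \<phi>"
    and e: "asrc (asrc \<nu>) = atrg \<phi>"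
  shows "is_modif w' w S C (\<nu> \<lhd>\<^bsub>Fun w' w S C\<^esub> \<phi>)"
proof -
  note p = loose_transD(1)[OF modifD(1)[OF m]] and q = loose_transD(1)[OF modifD(2)[OF m]]
    and r = loose_transD(1)[OF l]
  note [simp] = wnatD(3-6,8-9)[OF p] ffunctorD[OF wnatD(2)[OF p]] ffunctorD[OF wnatD(1)[OF r]]
    wnatD(3-6,8-9)[OF q] wnatD(3-6,8-9)[OF r] modifD(3-7)[OF m] e ffunctorD[OF wnatD(2)[OF r]]
  show ?thesis
  proof (rule modifI, goal_cases)
    case (7 s)
    let ?M = "asrc \<phi>" and ?N = "atrg \<phi>" and ?P = "atrg (asrc \<nu>)"
    show ?case
      using 7 modifD(8)[OF m, of s]
        C.lax_modif_rwhisk[where A = "FOb ?M (Dom S s)" and A' = "FOb ?M (Cod S s)"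
          and B = "FOb ?N (Dom S s)" and B' = "FOb ?N (Cod S s)"
          and D = "FOb ?P (Dom S s)" and D' = "FOb ?P (Cod S s)"
          and m = "FLo ?M s" and n = "FLo ?N s" and p = "FLo ?P s"
          and f = "cm \<phi> (Dom S s)" and fc = "cm \<phi> (Cod S s)"
          and g = "cm (asrc \<nu>) (Dom S s)" and gc = "cm (asrc \<nu>) (Cod S s)"
          and g' = "cm (atrg \<nu>) (Dom S s)" and gc' = "cm (atrg \<nu>) (Cod S s)"
          and x = "nc \<phi> s" and y = "nc (asrc \<nu>) s" and y' = "nc (atrg \<nu>) s"
          and u = "adata \<nu> (Dom S s)" and uc = "adata \<nu> (Cod S s)"]
        C.colax_modif_rwhisk[where A = "FOb ?M (Dom S s)" and A' = "FOb ?M (Cod S s)"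
          and B = "FOb ?N (Dom S s)" and B' = "FOb ?N (Cod S s)"
          and D = "FOb ?P (Dom S s)" and D' = "FOb ?P (Cod S s)"
          and m = "FLo ?M s" and n = "FLo ?N s" and p = "FLo ?P s"
          and f = "cm \<phi> (Dom S s)" and fc = "cm \<phi> (Cod S s)"
          and g = "cm (atrg \<nu>) (Dom S s)" and gc = "cm (atrg \<nu>) (Cod S s)"
          and g' = "cm (asrc \<nu>) (Dom S s)" and gc' = "cm (asrc \<nu>) (Cod S s)"
          and x = "nc \<phi> s" and y = "nc (atrg \<nu>) s" and y' = "nc (asrc \<nu>) s"
          and u = "adata \<nu> (Dom S s)" and uc = "adata \<nu> (Cod S s)"]
      by (cases "w = Colax") simp_all
  qed (simp_all add: modifD[OF m] l loose_trans_comp)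
qed

lemma modif_hcmp:
  assumes m: "is_modif w' w S C \<mu>" and n: "is_modif w' w S C \<nu>"
    and e: "asrc (asrc \<nu>) = atrg (asrc \<mu>)"
  shows "is_modif w' w S C (HCmp (Fun w' w S C) \<nu> \<mu>)"
proof -
  let ?F = "Fun w' w S C"
  note p = loose_transD(1)[OF modifD(1)[OF m]] and q = loose_transD(1)[OF modifD(1)[OF n]]
  note [simp] = wnatD(3-6)[OF p] wnatD(3-6)[OF q] modifD(3-7)[OF m] modifD(3-7)[OF n] e
  \<comment> \<open>Writing the horizontal composite as a vertical composite of two whiskerings
    reduces the modification axiom to the three cases already treated.\<close>
  have eq: "HCmp ?F \<nu> \<mu> = VCmp ?F (\<nu> \<lhd>\<^bsub>?F\<^esub> atrg \<mu>) (asrc \<nu> \<rhd>\<^bsub>?F\<^esub> \<mu>)"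
  proof -
    have "adata \<nu> X \<star>\<^bsub>C\<^esub> adata \<mu> X =
        (adata \<nu> X \<lhd>\<^bsub>C\<^esub> cm (atrg \<mu>) X) \<bullet>\<^bsub>C\<^esub> (cm (asrc \<nu>) X \<rhd>\<^bsub>C\<^esub> adata \<mu> X)"
      if "X \<in> Obj S" for X
      using C.hcmp_eq_left[of "adata \<mu> X" "adata \<nu> X"] that by simp
    then show ?thesis by (auto intro!: restrict_ext)
  qed
  show ?thesis
    unfolding eq by (rule modif_vcmp)
      (use modif_lwhisk[OF m modifD(1)[OF n]] modif_rwhisk[OF n modifD(2)[OF m]] in simp_all)
qed

text \<open>The case numbers follow the order of the locale assumptions. Laws for modifications hold
  because they hold componentwise in \<open>C\<close>; as a modification carries its boundary, the
  horizontal unit and associativity laws also need those laws for transformations.\<close>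

lemma fcategory_Fun: "fcategory (Fun w' w S C)"
proof (unfold_locales, goal_cases)
  case (1 \<phi>) then show ?case by (auto intro: wnatD(1) loose_transD(1))
next
  case (2 \<phi>) then show ?case by (auto intro: wnatD(2) loose_transD(1))
next
  case (3 M) then show ?case using tight_trans_id tight_transD(1) by (simp add: tight_transD)
next
  case (6 \<phi> \<psi>) then show ?case by (simp add: loose_trans_comp)
next
  case (11 \<phi> \<psi> \<chi>) then show ?case by (simp add: loose_transD trans_comp_assoc)
next
  case (16 \<phi>) then show ?case using modif_id by simp
next
  case (19 \<mu> \<nu>) then show ?case using modif_vcmp[of w' w \<mu> \<nu>] by simp
next
  case (22 \<mu>)
  then show ?case
    by (intro modif_eqI[where w = w and w' = w' and S = S and C = C])
      (use modif_vcmp[of w' w "Id2 (Fun w' w S C) (asrc \<mu>)" \<mu>] modif_id[of w' w "asrc \<mu>"]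
        in \<open>simp_all add: modifD\<close>)
next
  case (23 \<mu>)
  then show ?case
    by (intro modif_eqI[where w = w and w' = w' and S = S and C = C])
      (use modif_vcmp[of w' w \<mu> "Id2 (Fun w' w S C) (atrg \<mu>)"] modif_id[of w' w "atrg \<mu>"]
        in \<open>simp_all add: modifD\<close>)
next
  case (24 \<mu> \<nu> \<pi>)
  then show ?case by (auto intro!: restrict_ext simp: modifD C.vcmp_assoc)
next
  case (25 \<mu> \<nu>) then show ?case using modif_hcmp[of w' w \<mu> \<nu>] by simp
next
  case (28 \<mu>)
  then have m: "is_modif w' w S C \<mu>" by simp
  note a = loose_transD(1)[OF modifD(1)[OF m]] and b = loose_transD(1)[OF modifD(2)[OF m]]
  show ?case
    by (rule modif_eqI[OF _ m])
      (use 28 modif_rwhisk[OF m tight_transD(1)[OF tight_trans_id[OF wnatD(1)[OF a]]]]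
         trans_comp_id(1)[OF a] trans_comp_id(1)[OF b]
        in \<open>simp_all add: modifD[OF m] wnatD[OF a]\<close>)
next
  case (29 \<mu>)
  then have m: "is_modif w' w S C \<mu>" by simp
  note a = loose_transD(1)[OF modifD(1)[OF m]] and b = loose_transD(1)[OF modifD(2)[OF m]]
  show ?case
    by (rule modif_eqI[OF _ m])
      (use 29 modif_lwhisk[OF m tight_transD(1)[OF tight_trans_id[OF wnatD(2)[OF a]]]]
         trans_comp_id(2)[OF a] trans_comp_id(2)[OF b]
        in \<open>simp_all add: modifD[OF m] wnatD[OF a]\<close>)
next
  case (30 \<mu> \<nu> \<pi>)
  then have m: "is_modif w' w S C \<mu>" "is_modif w' w S C \<nu>" "is_modif w' w S C \<pi>" by simp_all
  note a = loose_transD(1)[OF modifD(1)[OF m(1)]] loose_transD(1)[OF modifD(1)[OF m(2)]]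
    loose_transD(1)[OF modifD(1)[OF m(3)]]
    and b = loose_transD(1)[OF modifD(2)[OF m(1)]] loose_transD(1)[OF modifD(2)[OF m(2)]]
    loose_transD(1)[OF modifD(2)[OF m(3)]]
  show ?case
    using 30 trans_comp_assoc[OF a] trans_comp_assoc[OF b]
    by (auto intro!: restrict_ext simp: modifD[OF m(1)] modifD[OF m(2)] modifD[OF m(3)]
      wnatD[OF a(1)] wnatD[OF a(2)] wnatD[OF a(3)] C.hcmp_assoc)
next
  case (31 \<phi> \<psi>)
  then show ?case
    using wnatD(3-5)[OF loose_transD(1), of w' w S C]
    by (auto intro!: restrict_ext simp: C.hcmp_id2)
next
  case (32 \<mu> \<mu>' \<nu> \<nu>')
  then have m: "is_modif w' w S C \<mu>" "is_modif w' w S C \<nu>" "is_modif w' w S C \<mu>'" "is_modif w' w S C \<nu>'"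
    by simp_all
  note a = loose_transD(1)[OF modifD(1)[OF m(1)]] loose_transD(1)[OF modifD(1)[OF m(2)]]
  show ?case
    using 32
    by (auto intro!: restrict_ext C.interchange simp: modifD[OF m(1)] modifD[OF m(2)]
      modifD[OF m(3)] modifD[OF m(4)] wnatD[OF a(1)] wnatD[OF a(2)])
next
  case (34 M) then show ?case by (simp add: tight_trans_id)
next
  case (35 \<phi> \<psi>) then show ?case by (simp add: tight_trans_comp)
qed (auto simp: modifD tight_transD trans_comp_id loose_transD)

end

section \<open>Full subcategories and postcomposition\<close>

lemma full_sub_sel [simp]:
  "Obj (full_sub C P) = {X \<in> Obj C. X \<in> P}"
  "Loose (full_sub C P) = {f \<in> Loose C. Dom C f \<in> P \<and> Cod C f \<in> P}"
  "Tight (full_sub C P) = {f \<in> Tight C. Dom C f \<in> P \<and> Cod C f \<in> P}"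
  "Cell (full_sub C P) = {x \<in> Cell C. Dom C (Src C x) \<in> P \<and> Cod C (Src C x) \<in> P}"
  "Dom (full_sub C P) = Dom C" "Cod (full_sub C P) = Cod C" "Id1 (full_sub C P) = Id1 C"
  "Cmp (full_sub C P) = Cmp C" "Src (full_sub C P) = Src C" "Trg (full_sub C P) = Trg C"
  "Id2 (full_sub C P) = Id2 C" "VCmp (full_sub C P) = VCmp C" "HCmp (full_sub C P) = HCmp C"
  by (simp_all add: full_sub_def)

lemma full_sub_full_sub: "full_sub (full_sub C P) Q = full_sub C (P \<inter> Q)"
  by (rule fcat.equality) auto

context fcategory
begin

lemma fcategory_full_sub: "fcategory (full_sub C P)"
  by unfold_locales
    (auto simp: cmp_assoc vcmp_assoc hcmp_assoc hcmp_id2 interchange)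

text \<open>An inverse has the same source and target objects as the cell, so it lies in the full
  subcategory as well.\<close>

lemma invertible_cell_full_sub:
  "x \<in> Cell (full_sub C P) \<Longrightarrow> invertible_cell (full_sub C P) x = invertible_cell C x"
  unfolding invertible_cell_def full_sub_sel using dom_trg cod_trg by (auto; metis)

lemma weak_cell_full_sub:
  "x \<in> Cell (full_sub C P) \<Longrightarrow> weak_cell (full_sub C P) w x = weak_cell C w x"
  using invertible_cell_full_sub[of x P] by (cases w) auto

end

context fcat_pair
begin

lemma ffunctor_full_sub_iff:
  "is_ffunctor S (full_sub C P) M \<longleftrightarrow> is_ffunctor S C M \<and> (\<forall>X\<in>Obj S. FOb M X \<in> P)"
  unfolding is_ffunctor_def full_sub_sel by (auto simp: PiE_iff)

lemma wnat_full_sub_iff: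
  "is_wnat w S (full_sub C P) \<phi> \<longleftrightarrow> is_wnat w S C \<phi> \<and>
    (\<forall>X\<in>Obj S. FOb (asrc \<phi>) X \<in> P) \<and> (\<forall>X\<in>Obj S. FOb (atrg \<phi>) X \<in> P)" (is "?l \<longleftrightarrow> ?r")
proof
  assume l: ?l
  show ?r
  proof (intro conjI wnatI)
    fix s assume s: "s \<in> Loose S"
    show "weak_cell C w (nc \<phi> s)"
      using s wnatD(6,10)[OF l, of s] C.weak_cell_full_sub[of "nc \<phi> s" P w] by simp
    show "directed_cell C w (cm \<phi> (Dom S s)) (FLo (asrc \<phi>) s) (FLo (atrg \<phi>) s)
       (cm \<phi> (Cod S s)) (nc \<phi> s)"
      using wnatD(7)[OF l s] by (simp add: directed_cell_def cong: if_cong)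
  qed (use wnatD[OF l] in \<open>auto simp: ffunctor_full_sub_iff\<close>)
next
  assume r: ?r
  note p = conjunct1[OF r]
  note [simp] = wnatD(3-6,8-9)[OF p] ffunctorD[OF wnatD(1)[OF p]] ffunctorD[OF wnatD(2)[OF p]]
  have nc: "nc \<phi> s \<in> Cell (full_sub C P)" if "s \<in> Loose S" for s
    using that r by simp
  show ?l
  proof (intro wnatI)
    fix s assume s: "s \<in> Loose S"
    show "weak_cell (full_sub C P) w (nc \<phi> s)"
      using nc[OF s] wnatD(10)[OF p s] C.weak_cell_full_sub by blast
    show "directed_cell (full_sub C P) w (cm \<phi> (Dom S s)) (FLo (asrc \<phi>) s) (FLo (atrg \<phi>) s)
       (cm \<phi> (Cod S s)) (nc \<phi> s)"
      using nc[OF s] wnatD(7)[OF p s] by (simp add: directed_cell_def)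
  qed (use r in \<open>auto simp: ffunctor_full_sub_iff wnatD[OF p]\<close>)
qed

lemma loose_trans_full_sub_iff:
  "is_loose_trans w' w S (full_sub C P) \<phi> \<longleftrightarrow> is_loose_trans w' w S C \<phi> \<and>
    (\<forall>X\<in>Obj S. FOb (asrc \<phi>) X \<in> P) \<and> (\<forall>X\<in>Obj S. FOb (atrg \<phi>) X \<in> P)"
proof (cases "is_wnat w S (full_sub C P) \<phi>")
  case True
  then have "weak_cell (full_sub C P) w' (nc \<phi> s) = weak_cell C w' (nc \<phi> s)" if "s \<in> Tight S" for s
    using that by (intro C.weak_cell_full_sub wnatD(6)) auto
  with True show ?thesis
    unfolding is_loose_trans_def by (auto simp: wnat_full_sub_iff)
qed (auto simp: is_loose_trans_def wnat_full_sub_iff)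

lemma tight_trans_full_sub_iff:
  "is_tight_trans w' w S (full_sub C P) \<phi> \<longleftrightarrow> is_tight_trans w' w S C \<phi> \<and>
    (\<forall>X\<in>Obj S. FOb (asrc \<phi>) X \<in> P) \<and> (\<forall>X\<in>Obj S. FOb (atrg \<phi>) X \<in> P)"
proof (cases "is_loose_trans w' w S (full_sub C P) \<phi>")
  case True
  then have w: "is_wnat w S (full_sub C P) \<phi>" by (rule loose_transD)
  then have "weak_cell (full_sub C P) w' (nc \<phi> s) = weak_cell C w' (nc \<phi> s)" if "s \<in> Loose S" for s
    using that by (intro C.weak_cell_full_sub wnatD(6)) auto
  with True wnatD(4,5)[OF w] show ?thesis
    unfolding is_tight_trans_def by (auto simp: loose_trans_full_sub_iff)
qed (auto simp: is_tight_trans_def loose_trans_full_sub_iff)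

lemma modif_full_sub_iff:
  "is_modif w' w S (full_sub C P) \<mu> \<longleftrightarrow> is_modif w' w S C \<mu> \<and>
    (\<forall>X\<in>Obj S. FOb (asrc (asrc \<mu>)) X \<in> P) \<and> (\<forall>X\<in>Obj S. FOb (atrg (asrc \<mu>)) X \<in> P)"
    (is "?l \<longleftrightarrow> ?r")
proof
  assume l: ?l
  show ?r
    by (intro conjI modifI)
      (use modifD[OF l] in \<open>auto simp: loose_trans_full_sub_iff\<close>)
next
  assume r: ?r
  note m = conjunct1[OF r]
  show ?l
    by (intro modifI)
      (use r in \<open>auto simp: loose_trans_full_sub_iff modifD[OF m]
         wnatD[OF loose_transD(1)[OF modifD(1)[OF m]]]\<close>)
qed

text \<open>An equality rather than an isomorphism, since \<open>full_sub\<close> restricts the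
  carriers and keeps all operations. It makes functors into models accessible as functors into a
  functor category, so that transposition need only be done there.\<close>

lemma Fun_full_sub:
  "Fun w' w S (full_sub C P) = full_sub (Fun w' w S C) {M. \<forall>X\<in>Obj S. FOb M X \<in> P}"
proof (rule fcat.equality)
  show "Loose (Fun w' w S (full_sub C P)) =
    Loose (full_sub (Fun w' w S C) {M. \<forall>X\<in>Obj S. FOb M X \<in> P})"
    by (auto simp: loose_trans_full_sub_iff)
  show "Tight (Fun w' w S (full_sub C P)) =
    Tight (full_sub (Fun w' w S C) {M. \<forall>X\<in>Obj S. FOb M X \<in> P})"
    by (auto simp: tight_trans_full_sub_iff)
  show "Cell (Fun w' w S (full_sub C P)) =
    Cell (full_sub (Fun w' w S C) {M. \<forall>X\<in>Obj S. FOb M X \<in> P})"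
    by (auto simp: modif_full_sub_iff)
qed (auto simp: ffunctor_full_sub_iff fun_eq_iff trans_id_def trans_comp_def cong: if_cong)

end

section \<open>Postcomposition with an \<F>-functor\<close>

lemma ffun_comp_sel [simp]:
  "X \<in> Obj A \<Longrightarrow> FOb (ffun_comp A G F) X = FOb G (FOb F X)"
  "f \<in> Loose A \<Longrightarrow> FLo (ffun_comp A G F) f = FLo G (FLo F f)"
  "x \<in> Cell A \<Longrightarrow> FCe (ffun_comp A G F) x = FCe G (FCe F x)"
  by (simp_all add: ffun_comp_def compose_def)

lemma ffunctor_comp:
  assumes "fcategory A" and F: "is_ffunctor A B F" and G: "is_ffunctor B C G"
  shows "is_ffunctor A C (ffun_comp A G F)"
proof -
  interpret A: fcategory A by fact
  note [simp] = ffunctorD[OF F] ffunctorD[OF G]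
  have "FOb (ffun_comp A G F) \<in> extensional (Obj A)" "FLo (ffun_comp A G F) \<in> extensional (Loose A)"
    "FCe (ffun_comp A G F) \<in> extensional (Cell A)"
    by (simp_all add: ffun_comp_def)
  then show ?thesis by (simp add: is_ffunctor_def PiE_iff)
qed

lemma invertible_cell_ffunctor:
  assumes "fcategory A" and F: "is_ffunctor A B F" and x: "x \<in> Cell A" "invertible_cell A x"
  shows "invertible_cell B (FCe F x)"
proof -
  interpret A: fcategory A by fact
  obtain y where y: "y \<in> Cell A" "Src A y = Trg A x" "Trg A y = Src A x"
    "y \<bullet>\<^bsub>A\<^esub> x = Id2 A (Src A x)" "x \<bullet>\<^bsub>A\<^esub> y = Id2 A (Trg A x)"
    using x(2) unfolding invertible_cell_def by blast
  show ?thesis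
    unfolding invertible_cell_def
    by (rule bexI[of _ "FCe F y"])
      (use x y ffunctorD(11)[OF F, of x y] ffunctorD(11)[OF F, of y x]
        in \<open>simp_all add: ffunctorD[OF F]\<close>)
qed

lemma weak_cell_ffunctor:
  assumes "fcategory A" and F: "is_ffunctor A B F" and x: "x \<in> Cell A" "weak_cell A w x"
  shows "weak_cell B w (FCe F x)"
proof (cases w)
  case Strict
  interpret A: fcategory A by fact
  from Strict x have "FCe F x = FCe F (Id2 A (Src A x))" by simp
  also have "\<dots> = Id2 B (Src B (FCe F x))"
    using x by (simp only: ffunctorD[OF F] A.src_in)
  finally show ?thesis using Strict by simp
qed (use assms invertible_cell_ffunctor in auto)

text \<open>Applied with \<open>F\<close> an evaluation at \<open>Y\<close>, this gives the slice at
  \<open>Y\<close> of a transformation between functors of two variables.\<close>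

definition post_trans :: "('so, 's1, 's2) fcat \<Rightarrow> ('bo, 'b1, 'b2, 'co, 'c1, 'c2) ffun \<Rightarrow>
    ('so, 's1, 's2, 'bo, 'b1, 'b2) trans \<Rightarrow> ('so, 's1, 's2, 'co, 'c1, 'c2) trans" where
  "post_trans S F \<phi> = \<lparr>asrc = ffun_comp S F (asrc \<phi>), atrg = ffun_comp S F (atrg \<phi>),
     adata = \<lparr>cmpt = (\<lambda>X\<in>Obj S. FLo F (cm \<phi> X)), ncell = (\<lambda>s\<in>Loose S. FCe F (nc \<phi> s))\<rparr>\<rparr>"

definition post_modif :: "('so, 's1, 's2) fcat \<Rightarrow> ('bo, 'b1, 'b2, 'co, 'c1, 'c2) ffun \<Rightarrow>
    ('so, 's1, 's2, 'bo, 'b1, 'b2) modif \<Rightarrow> ('so, 's1, 's2, 'co, 'c1, 'c2) modif" where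
  "post_modif S F \<mu> = \<lparr>asrc = post_trans S F (asrc \<mu>), atrg = post_trans S F (atrg \<mu>),
     adata = (\<lambda>X\<in>Obj S. FCe F (adata \<mu> X))\<rparr>"

lemma post_sel [simp]:
  "asrc (post_trans S F \<phi>) = ffun_comp S F (asrc \<phi>)"
  "atrg (post_trans S F \<phi>) = ffun_comp S F (atrg \<phi>)"
  "X \<in> Obj S \<Longrightarrow> cm (post_trans S F \<phi>) X = FLo F (cm \<phi> X)"
  "s \<in> Loose S \<Longrightarrow> nc (post_trans S F \<phi>) s = FCe F (nc \<phi> s)"
  "asrc (post_modif S F \<mu>) = post_trans S F (asrc \<mu>)"
  "atrg (post_modif S F \<mu>) = post_trans S F (atrg \<mu>)"
  "X \<in> Obj S \<Longrightarrow> adata (post_modif S F \<mu>) X = FCe F (adata \<mu> X)"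
  by (simp_all add: post_trans_def post_modif_def)

context fcat_pair
begin

lemma wnat_post:
  assumes F: "is_ffunctor C D F" and p: "is_wnat w S C \<phi>"
  shows "is_wnat w S D (post_trans S F \<phi>)"
proof -
  note [simp] = wnatD(3-6,8-9)[OF p] ffunctorD[OF wnatD(1)[OF p]] ffunctorD[OF wnatD(2)[OF p]]
  note [simp] = ffunctorD[OF F] wnatD(11)[OF p]
  show ?thesis
  proof (rule wnatI, goal_cases)
    case (9 s r)
    then show ?case by (simp add: wnatD(12)[OF p] C.cmp_assoc)
  next
    case (10 x)
    then show ?case
      \<comment> \<open>The conditional equation is split into two implications so that
        \<open>F\<close> can be applied to both sides within each branch.\<close>
      using arg_cong[where f = "FCe F", OF wnatD(13)[OF p, of x, unfolded if_bool_eq_conj, THEN conjunct1, THEN mp]]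
        arg_cong[where f = "FCe F", OF wnatD(13)[OF p, of x, unfolded if_bool_eq_conj, THEN conjunct2, THEN mp]]
      by (cases "w = Colax") simp_all
  next
    case (7 s)
    then show ?case
      using weak_cell_ffunctor[OF C.fcategory_axioms F] wnatD(10)[OF p] by simp
  qed (simp_all add: directed_cell_def ffunctor_comp[OF S.fcategory_axioms _ F] wnatD[OF p]
      , simp_all add: post_trans_def)
qed

lemma loose_trans_post:
  assumes F: "is_ffunctor C D F" and p: "is_loose_trans w' w S C \<phi>"
  shows "is_loose_trans w' w S D (post_trans S F \<phi>)"
  using wnat_post[OF F loose_transD(1)[OF p]] weak_cell_ffunctor[OF C.fcategory_axioms F]
    loose_transD(2)[OF p] wnatD(6)[OF loose_transD(1)[OF p]]
  by (auto simp: is_loose_trans_def)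

lemma tight_trans_post:
  assumes F: "is_ffunctor C D F" and p: "is_tight_trans w' w S C \<phi>"
  shows "is_tight_trans w' w S D (post_trans S F \<phi>)"
  using loose_trans_post[OF F tight_transD(1)[OF p]] weak_cell_ffunctor[OF C.fcategory_axioms F]
    tight_transD(2,3)[OF p] wnatD(6)[OF loose_transD(1)[OF tight_transD(1)[OF p]]]
  by (auto simp: is_tight_trans_def ffunctorD[OF F])

lemma modif_post:
  assumes F: "is_ffunctor C D F" and m: "is_modif w' w S C \<mu>"
  shows "is_modif w' w S D (post_modif S F \<mu>)"
proof -
  note p = loose_transD(1)[OF modifD(1)[OF m]] and q = loose_transD(1)[OF modifD(2)[OF m]]
  note [simp] = wnatD(3-6,8-9)[OF p] ffunctorD[OF wnatD(1)[OF p]] ffunctorD[OF wnatD(2)[OF p]]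
  note [simp] = wnatD(3-6,8-9)[OF q] modifD(3-7)[OF m] ffunctorD[OF F]
  show ?thesis
  proof (rule modifI, goal_cases)
    case (7 s)
    then show ?case
      using arg_cong[where f = "FCe F", OF modifD(8)[OF m, of s, unfolded if_bool_eq_conj, THEN conjunct1, THEN mp]]
        arg_cong[where f = "FCe F", OF modifD(8)[OF m, of s, unfolded if_bool_eq_conj, THEN conjunct2, THEN mp]]
      by (cases "w = Colax") simp_all
  qed (simp_all add: loose_trans_post[OF F] modifD[OF m], simp_all add: post_modif_def)
qed

end

section \<open>Evaluation, and properties of modifications that are detected by components\<close>

lemma eval_at_sel [simp]:
  "M \<in> Obj A \<Longrightarrow> FOb (eval_at A X) M = FOb M X"
  "\<phi> \<in> Loose A \<Longrightarrow> FLo (eval_at A X) \<phi> = cm \<phi> X"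
  "\<mu> \<in> Cell A \<Longrightarrow> FCe (eval_at A X) \<mu> = adata \<mu> X"
  by (simp_all add: eval_at_def)

lemma dual_eq_Colax [simp]: "dual w = Colax \<longleftrightarrow> w = Lax"
  by (cases w) auto

lemma Fun_adata [simp]:
  "X \<in> Obj S \<Longrightarrow> adata (Id2 (Fun w' w S C) \<phi>) X = Id2 C (cm \<phi> X)"
  "X \<in> Obj S \<Longrightarrow> adata (VCmp (Fun w' w S C) \<nu> \<mu>) X = adata \<nu> X \<bullet>\<^bsub>C\<^esub> adata \<mu> X"
  "X \<in> Obj S \<Longrightarrow> adata (HCmp (Fun w' w S C) \<nu> \<mu>) X = adata \<nu> X \<star>\<^bsub>C\<^esub> adata \<mu> X"
  by simp_all

lemma Fun_cell_eqI:
  assumes "\<mu> \<in> Cell (Fun w' w S C)" "\<nu> \<in> Cell (Fun w' w S C)"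
    "Src (Fun w' w S C) \<mu> = Src (Fun w' w S C) \<nu>" "Trg (Fun w' w S C) \<mu> = Trg (Fun w' w S C) \<nu>"
    "\<And>X. X \<in> Obj S \<Longrightarrow> adata \<mu> X = adata \<nu> X"
  shows "\<mu> = \<nu>"
  using modif_eqI[of w' w S C \<mu> \<nu>] assms by simp

text \<open>The boundary of each structure cell of a transformation is determined by its components.\<close>

lemma Fun_trans_eqI:
  assumes p: "is_wnat v T (Fun w' w S C) \<phi>" and q: "is_wnat v T (Fun w' w S C) \<psi>"
    and "asrc \<phi> = asrc \<psi>" "atrg \<phi> = atrg \<psi>" and "fcategory T"
    and cm: "\<And>Y. Y \<in> Obj T \<Longrightarrow> cm \<phi> Y = cm \<psi> Y"
    and nc: "\<And>t X. t \<in> Loose T \<Longrightarrow> X \<in> Obj S \<Longrightarrow> adata (nc \<phi> t) X = adata (nc \<psi> t) X"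
  shows "\<phi> = \<psi>"
proof (rule trans_eqI[OF p q])
  fix t assume t: "t \<in> Loose T"
  interpret T: fcategory T by fact
  show "nc \<phi> t = nc \<psi> t"
    by (rule Fun_cell_eqI[OF wnatD(6)[OF p t] wnatD(6)[OF q t]])
      (simp_all add: wnatD(8,9)[OF p t] wnatD(8,9)[OF q t] assms t del: Fun_sel)
qed (use assms in simp_all)

context fcategory
begin

text \<open>A commuting square of 2-cells with two opposite invertible sides still commutes when
  these are inverted. With whiskered components of a modification as those sides, this is the
  modification axiom for the inverse.\<close>

lemma conjugate_invertible:
  assumes "a \<in> Cell C" "invertible_cell C a" "b \<in> Cell C" "invertible_cell C b"
    and "hom2 C x (Src C b) (Src C a)" "hom2 C y (Trg C b) (Trg C a)"
    and e: "a \<bullet> x = y \<bullet> b"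
  shows "inv2 C a \<bullet> y = x \<bullet> inv2 C b"
proof -
  note [simp] = assms(1-6)
  have "inv2 C a \<bullet> y = inv2 C a \<bullet> ((y \<bullet> b) \<bullet> inv2 C b)"
    by (simp add: vcmp_assoc' inv2_props)
  also have "\<dots> = (inv2 C a \<bullet> a) \<bullet> (x \<bullet> inv2 C b)"
    unfolding e[symmetric] by (simp add: vcmp_assoc')
  also have "\<dots> = x \<bullet> inv2 C b"
    by (simp add: inv2_props)
  finally show ?thesis .
qed

end

context fcat_pair
begin

lemma ffunctor_eval:
  assumes "X \<in> Obj S"
  shows "is_ffunctor (full_sub (Fun w' w S C) P) C (eval_at (full_sub (Fun w' w S C) P) X)"
proof -
  interpret F: fcategory "full_sub (Fun w' w S C) P"
    by (intro fcategory.fcategory_full_sub fcategory_Fun)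
  have [simp]: "is_ffunctor S C (asrc \<phi>)" "is_ffunctor S C (atrg \<phi>)" "cm \<phi> X \<in> Loose C"
    "Dom C (cm \<phi> X) = FOb (asrc \<phi>) X" "Cod C (cm \<phi> X) = FOb (atrg \<phi>) X"
    if "is_loose_trans w' w S C \<phi>" for \<phi>
    using wnatD(1-5)[OF loose_transD(1)[OF that]] assms by simp_all
  note F.cmp_in F.id1_in F.id2_in F.vcmp_in F.hcmp_in F.tight_loose
  then show ?thesis
    unfolding is_ffunctor_def using assms
    by (auto simp: PiE_iff eval_at_def extensional_def modifD dest: tight_transD(2)
      intro: ffunctorD(1))
qed

lemma ffunctor_eval_Fun:
  assumes "X \<in> Obj S"
  shows "is_ffunctor (Fun w' w S C) C (eval_at (Fun w' w S C) X)"
proof -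
  have "full_sub (Fun w' w S C) UNIV = Fun w' w S C"
    by (rule fcat.equality) simp_all
  with ffunctor_eval[OF assms, of w' w UNIV] show ?thesis by (simp only:)
qed

lemma invertible_modif:
  assumes m: "is_modif w' w S C \<mu>" and i: "\<And>X. X \<in> Obj S \<Longrightarrow> invertible_cell C (adata \<mu> X)"
  shows "invertible_cell (Fun w' w S C) \<mu>"
proof -
  let ?n = "\<lparr>asrc = atrg \<mu>, atrg = asrc \<mu>, adata = (\<lambda>X\<in>Obj S. inv2 C (adata \<mu> X))\<rparr>"
  note p = loose_transD(1)[OF modifD(1)[OF m]] and q = loose_transD(1)[OF modifD(2)[OF m]]
  note [simp] = wnatD(3-6,8-9)[OF p] ffunctorD[OF wnatD(1)[OF p]] ffunctorD[OF wnatD(2)[OF p]]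
  note [simp] = wnatD(3-6,8-9)[OF q] modifD(3-7)[OF m] i
  have n: "is_modif w' w S C ?n"
  proof (rule modifI, goal_cases)
    case (7 s)
    let ?a = "FLo (atrg (asrc \<mu>)) s \<rhd>\<^bsub>C\<^esub> adata \<mu> (Dom S s)"
    let ?b = "adata \<mu> (Cod S s) \<lhd>\<^bsub>C\<^esub> FLo (asrc (asrc \<mu>)) s"
    have "inv2 C ?a = FLo (atrg (asrc \<mu>)) s \<rhd>\<^bsub>C\<^esub> inv2 C (adata \<mu> (Dom S s))"
      "inv2 C ?b = inv2 C (adata \<mu> (Cod S s)) \<lhd>\<^bsub>C\<^esub> FLo (asrc (asrc \<mu>)) s"
      "invertible_cell C ?a" "invertible_cell C ?b"
      using 7 by (simp_all add: C.inv2_lwhisk C.inv2_rwhisk)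
    then show ?case
      using 7 modifD(8)[OF m, of s] C.conjugate_invertible[of ?a ?b "nc (asrc \<mu>) s" "nc (atrg \<mu>) s"]
        C.conjugate_invertible[of ?b ?a "nc (asrc \<mu>) s" "nc (atrg \<mu>) s"]
      by (cases "w = Colax") simp_all
  qed (simp_all add: modifD[OF m])
  show ?thesis
    unfolding invertible_cell_def
    by (rule bexI[of _ ?n]) (use n in \<open>auto simp: C.inv2_props intro!: restrict_ext\<close>)
qed

text \<open>This is how structure cells of a transposed transformation, which are modifications,
  inherit their weakness from \<open>C\<close>. For \<open>Pseudo\<close> the componentwise inverses
  form a modification; \<open>Strict\<close> needs more than identity components, namely that source
  and target coincide.\<close>

lemma weak_cell_Fun:
  assumes m: "is_modif w' w S C \<mu>" and i: "\<And>X. X \<in> Obj S \<Longrightarrow> weak_cell C v (adata \<mu> X)"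
  shows "weak_cell (Fun w' w S C) v \<mu>"
proof (cases v)
  case Strict
  have id: "is_modif w' w S C (Id2 (Fun w' w S C) (asrc \<mu>))"
    using modif_id modifD(1)[OF m] .
  have e: "adata \<mu> X = Id2 C (cm (asrc \<mu>) X)" if "X \<in> Obj S" for X
    using i[OF that] that Strict by (simp add: modifD[OF m])
  \<comment> \<open>Identity components give equal components of the two transformations; the
    modification axiom then has identities on both sides and forces their structure cells to
    agree.\<close>
  have "atrg \<mu> = asrc \<mu>"
  proof (rule trans_eqI)
    show wa: "is_wnat w S C (atrg \<mu>)" and ws: "is_wnat w S C (asrc \<mu>)"
      using modifD(1,2)[OF m] by (auto dest: loose_transD)
    fix X assume X: "X \<in> Obj S"
    show "cm (atrg \<mu>) X = cm (asrc \<mu>) X"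
      using e[OF X] X modifD(6,7)[OF m X] wnatD(3)[OF ws X] C.trg_id2 by metis
  next
    fix s assume s: "s \<in> Loose S"
    note ws = loose_transD(1)[OF modifD(1)[OF m]] and wa = loose_transD(1)[OF modifD(2)[OF m]]
    note [simp] = wnatD(3-6,8-9)[OF ws] wnatD(3-6,8-9)[OF wa] ffunctorD[OF wnatD(1)[OF ws]]
      ffunctorD[OF wnatD(2)[OF ws]]
    have c: "cm (atrg \<mu>) X = cm (asrc \<mu>) X" if X: "X \<in> Obj S" for X
      using e[OF X] X modifD(6,7)[OF m X] wnatD(3)[OF ws X] C.trg_id2 by metis
    show "nc (atrg \<mu>) s = nc (asrc \<mu>) s"
      using modifD(8)[OF m s] s
      by (cases "w = Colax") (simp_all add: e c C.hcmp_id2 modifD(3,4)[OF m])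
  qed (simp_all add: modifD[OF m])
  then have "\<mu> = Id2 (Fun w' w S C) (asrc \<mu>)"
    by (intro modif_eqI[OF m id]) (simp_all add: e)
  then show ?thesis using Strict by simp
qed (use invertible_modif[OF m] i in auto)

lemma post_trans_id:
  assumes F: "is_ffunctor C D F" and M: "is_ffunctor S C M"
  shows "post_trans S F (trans_id S C M) = trans_id S D (ffun_comp S F M)"
  by (auto simp: post_trans_def trans_id_def ffunctorD[OF F] ffunctorD[OF M] intro!: restrict_ext)

lemma post_trans_comp:
  assumes F: "is_ffunctor C D F" and p: "is_wnat w S C \<phi>" and q: "is_wnat w S C \<psi>"
    and e: "asrc \<psi> = atrg \<phi>"
  shows "post_trans S F (trans_comp w S C \<psi> \<phi>) = trans_comp w S D (post_trans S F \<psi>) (post_trans S F \<phi>)"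
proof -
  note [simp] = wnatD(3-6,8-9)[OF p] wnatD(3-6,8-9)[OF q] e
    ffunctorD[OF wnatD(1)[OF p]] ffunctorD[OF wnatD(2)[OF p]] ffunctorD[OF wnatD(2)[OF q]]
  note [simp] = ffunctorD[OF F]
  show ?thesis
    by (auto simp: post_trans_def trans_comp_def Let_def C.cmp_assoc intro!: restrict_ext)
qed

lemma post_modif_id:
  assumes F: "is_ffunctor C D F" and p: "is_wnat w S C \<phi>"
  shows "post_modif S F (Id2 (Fun w' w S C) \<phi>) = Id2 (Fun w' w S D) (post_trans S F \<phi>)"
  by (auto simp: post_modif_def ffunctorD[OF F] wnatD[OF p] intro!: restrict_ext)

lemma post_modif_vcmp:
  assumes F: "is_ffunctor C D F" and m: "is_modif w' w S C \<mu>" and n: "is_modif w' w S C \<nu>"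
    and e: "asrc \<nu> = atrg \<mu>"
  shows "post_modif S F (VCmp (Fun w' w S C) \<nu> \<mu>) =
    VCmp (Fun w' w S D) (post_modif S F \<nu>) (post_modif S F \<mu>)"
  by (auto simp: post_modif_def ffunctorD[OF F] modifD[OF m] modifD[OF n] e intro!: restrict_ext)

lemma post_modif_hcmp:
  assumes F: "is_ffunctor C D F" and m: "is_modif w' w S C \<mu>" and n: "is_modif w' w S C \<nu>"
    and e: "asrc (asrc \<nu>) = atrg (asrc \<mu>)"
  shows "post_modif S F (HCmp (Fun w' w S C) \<nu> \<mu>) =
    HCmp (Fun w' w S D) (post_modif S F \<nu>) (post_modif S F \<mu>)"
proof -
  note a = loose_transD(1)[OF modifD(1)[OF m]] loose_transD(1)[OF modifD(1)[OF n]]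
    loose_transD(1)[OF modifD(2)[OF m]] loose_transD(1)[OF modifD(2)[OF n]]
  show ?thesis
    by (auto simp: post_modif_def ffunctorD[OF F] modifD[OF m] modifD[OF n] e
      wnatD[OF a(1)] wnatD[OF a(2)]
      post_trans_comp[OF F a(1,2)] post_trans_comp[OF F a(3,4)] intro!: restrict_ext)
qed

end

section \<open>Transposition\<close>

locale fcat_swap = S: fcategory S + T: fcategory T + C: fcategory C
  for S :: "('so, 's1, 's2) fcat" and T :: "('to, 't1, 't2) fcat" and C :: "('co, 'c1, 'c2) fcat" +
  fixes w' w :: weakness
begin

sublocale TC: fcat_pair T C by unfold_locales
sublocale SC: fcat_pair S C by unfold_locales

abbreviation FT :: "('to, 't1, 't2, 'co, 'c1, 'c2) fun_fcat" where
  "FT \<equiv> Fun (dual w') (dual w) T C"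

abbreviation FS :: "('so, 's1, 's2, 'co, 'c1, 'c2) fun_fcat" where
  "FS \<equiv> Fun w' w S C"

abbreviation ev :: "'to \<Rightarrow> _" where
  "ev Y \<equiv> eval_at FT Y"

sublocale FT: fcategory FT by (rule TC.fcategory_Fun)
sublocale FS: fcategory FS by (rule SC.fcategory_Fun)
sublocale SFT: fcat_pair S FT by unfold_locales
sublocale TFS: fcat_pair T FS by unfold_locales

text \<open>
  The structure cell of \<open>M s\<close> at \<open>t\<close> and that of the transposed \<open>t\<close> at \<open>s\<close> fill the same square,
  whose sides have been exchanged. Duality absorbs the change of direction for lax and colax
  transformations; pseudonatural ones need the inverse cell.
\<close>

definition swap_lo where
  "swap_lo M t = \<lparr>asrc = ffun_comp S (ev (Dom T t)) M, atrg = ffun_comp S (ev (Cod T t)) M,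
     adata = \<lparr>cmpt = (\<lambda>X\<in>Obj S. FLo (FOb M X) t),
       ncell = (\<lambda>s\<in>Loose S. flip C w (nc (FLo M s) t))\<rparr>\<rparr>"

definition swap_ob where
  "swap_ob M = \<lparr>FOb = (\<lambda>Y\<in>Obj T. ffun_comp S (ev Y) M), FLo = (\<lambda>t\<in>Loose T. swap_lo M t),
     FCe = (\<lambda>y\<in>Cell T. \<lparr>asrc = swap_lo M (Src T y), atrg = swap_lo M (Trg T y),
       adata = (\<lambda>X\<in>Obj S. FCe (FOb M X) y)\<rparr>)\<rparr>"

lemma swap_lo_sel [simp]:
  "asrc (swap_lo M t) = ffun_comp S (ev (Dom T t)) M"
  "atrg (swap_lo M t) = ffun_comp S (ev (Cod T t)) M"
  "X \<in> Obj S \<Longrightarrow> cm (swap_lo M t) X = FLo (FOb M X) t"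
  "s \<in> Loose S \<Longrightarrow> nc (swap_lo M t) s = flip C w (nc (FLo M s) t)"
  by (simp_all add: swap_lo_def)

lemma swap_ob_sel [simp]:
  "Y \<in> Obj T \<Longrightarrow> FOb (swap_ob M) Y = ffun_comp S (ev Y) M"
  "t \<in> Loose T \<Longrightarrow> FLo (swap_ob M) t = swap_lo M t"
  "y \<in> Cell T \<Longrightarrow> asrc (FCe (swap_ob M) y) = swap_lo M (Src T y)"
  "y \<in> Cell T \<Longrightarrow> atrg (FCe (swap_ob M) y) = swap_lo M (Trg T y)"
  "\<lbrakk>y \<in> Cell T; X \<in> Obj S\<rbrakk> \<Longrightarrow> adata (FCe (swap_ob M) y) X = FCe (FOb M X) y"
  by (simp_all add: swap_ob_def)

text \<open>
  The equations on \<open>w\<close> have \<open>True\<close> as right-hand side since, used as rewrite rules, they must not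
  replace \<open>w\<close> itself, which is a parameter of the constants of this locale.
\<close>

lemma orientation_cases [case_names inv Lax Colax]:
  obtains "(w = Lax) = False" "(w = Colax) = False" "(w = Strict \<or> w = Pseudo) = True"
      "\<And>x. flip C w x = inv2 C x"
    | "(w = Lax) = True" "(w = Colax) = False" "\<And>x. flip C w x = x"
    | "(w = Lax) = False" "(w = Colax) = True" "\<And>x. flip C w x = x"
  by (cases w) (auto simp: flip_def)

lemma bifunctorD:
  assumes M: "is_ffunctor S FT M"
  shows "X \<in> Obj S \<Longrightarrow> is_ffunctor T C (FOb M X)"
    "s \<in> Loose S \<Longrightarrow> is_loose_trans (dual w') (dual w) T C (FLo M s)"
    "s \<in> Loose S \<Longrightarrow> is_wnat (dual w) T C (FLo M s)"
    "s \<in> Loose S \<Longrightarrow> asrc (FLo M s) = FOb M (Dom S s)"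
    "s \<in> Loose S \<Longrightarrow> atrg (FLo M s) = FOb M (Cod S s)"
    "x \<in> Cell S \<Longrightarrow> is_modif (dual w') (dual w) T C (FCe M x)"
    "x \<in> Cell S \<Longrightarrow> asrc (FCe M x) = FLo M (Src S x)"
    "x \<in> Cell S \<Longrightarrow> atrg (FCe M x) = FLo M (Trg S x)"
  using ffunctorD[OF M] by (auto dest: loose_transD)

text \<open>The conditionals test for \<open>Lax\<close> because the cells
  \<open>nc (FLo M s) t\<close> belong to a transformation of weakness \<open>dual w\<close>, which
  is \<open>Colax\<close> exactly when \<open>w\<close> is \<open>Lax\<close>.\<close>

lemma bifunctor_typing:
  assumes M: "is_ffunctor S FT M"
  shows "X \<in> Obj S \<Longrightarrow> Y \<in> Obj T \<Longrightarrow> FOb (FOb M X) Y \<in> Obj C"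
    "X \<in> Obj S \<Longrightarrow> t \<in> Loose T \<Longrightarrow> FLo (FOb M X) t \<in> Loose C"
    "X \<in> Obj S \<Longrightarrow> t \<in> Loose T \<Longrightarrow> Dom C (FLo (FOb M X) t) = FOb (FOb M X) (Dom T t)"
    "X \<in> Obj S \<Longrightarrow> t \<in> Loose T \<Longrightarrow> Cod C (FLo (FOb M X) t) = FOb (FOb M X) (Cod T t)"
    "X \<in> Obj S \<Longrightarrow> y \<in> Cell T \<Longrightarrow> FCe (FOb M X) y \<in> Cell C"
    "X \<in> Obj S \<Longrightarrow> y \<in> Cell T \<Longrightarrow> Src C (FCe (FOb M X) y) = FLo (FOb M X) (Src T y)"
    "X \<in> Obj S \<Longrightarrow> y \<in> Cell T \<Longrightarrow> Trg C (FCe (FOb M X) y) = FLo (FOb M X) (Trg T y)"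
    "s \<in> Loose S \<Longrightarrow> Y \<in> Obj T \<Longrightarrow> cm (FLo M s) Y \<in> Loose C"
    "s \<in> Loose S \<Longrightarrow> Y \<in> Obj T \<Longrightarrow> Dom C (cm (FLo M s) Y) = FOb (FOb M (Dom S s)) Y"
    "s \<in> Loose S \<Longrightarrow> Y \<in> Obj T \<Longrightarrow> Cod C (cm (FLo M s) Y) = FOb (FOb M (Cod S s)) Y"
    "x \<in> Cell S \<Longrightarrow> Y \<in> Obj T \<Longrightarrow> adata (FCe M x) Y \<in> Cell C"
    "x \<in> Cell S \<Longrightarrow> Y \<in> Obj T \<Longrightarrow> Src C (adata (FCe M x) Y) = cm (FLo M (Src S x)) Y"
    "x \<in> Cell S \<Longrightarrow> Y \<in> Obj T \<Longrightarrow> Trg C (adata (FCe M x) Y) = cm (FLo M (Trg S x)) Y"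
    "s \<in> Loose S \<Longrightarrow> t \<in> Loose T \<Longrightarrow> nc (FLo M s) t \<in> Cell C"
    "s \<in> Loose S \<Longrightarrow> t \<in> Loose T \<Longrightarrow> weak_cell C w (nc (FLo M s) t)"
    "s \<in> Loose S \<Longrightarrow> t \<in> Loose T \<Longrightarrow> Src C (nc (FLo M s) t) =
       (if w = Lax then cm (FLo M s) (Cod T t) \<cdot>\<^bsub>C\<^esub> FLo (FOb M (Dom S s)) t
        else FLo (FOb M (Cod S s)) t \<cdot>\<^bsub>C\<^esub> cm (FLo M s) (Dom T t))"
    "s \<in> Loose S \<Longrightarrow> t \<in> Loose T \<Longrightarrow> Trg C (nc (FLo M s) t) =
       (if w = Lax then FLo (FOb M (Cod S s)) t \<cdot>\<^bsub>C\<^esub> cm (FLo M s) (Dom T t)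
        else cm (FLo M s) (Cod T t) \<cdot>\<^bsub>C\<^esub> FLo (FOb M (Dom S s)) t)"
  using wnatD(8-10)[OF bifunctorD(3)[OF M], of s t]
  by (simp_all add: ffunctorD[OF bifunctorD(1)[OF M]] wnatD(3-6)[OF bifunctorD(3)[OF M]]
      modifD(5-7)[OF bifunctorD(6)[OF M]] bifunctorD(4,5,7,8)[OF M])

lemma slice_ffunctor:
  "is_ffunctor S FT M \<Longrightarrow> Y \<in> Obj T \<Longrightarrow> is_ffunctor S C (ffun_comp S (ev Y) M)"
  using ffunctor_comp[OF S.fcategory_axioms _ TC.ffunctor_eval_Fun] .

lemma slice_sel:
  assumes M: "is_ffunctor S FT M"
  shows "X \<in> Obj S \<Longrightarrow> FOb (ffun_comp S (ev Y) M) X = FOb (FOb M X) Y"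
    "s \<in> Loose S \<Longrightarrow> FLo (ffun_comp S (ev Y) M) s = cm (FLo M s) Y"
    "x \<in> Cell S \<Longrightarrow> FCe (ffun_comp S (ev Y) M) x = adata (FCe M x) Y"
  by (simp_all add: bifunctorD[OF M])

text \<open>The axioms in the variable \<open>S\<close> come from the functoriality of
  \<open>M\<close>: its preservation of identities and composites gives the unit and composition
  laws, and the modification axiom of \<open>FCe M x\<close> at \<open>t\<close> gives compatibility
  with the 2-cell \<open>x\<close>.\<close>

lemma swap_lo_wnat:
  assumes M: "is_ffunctor S FT M" and t: "t \<in> Loose T"
  shows "is_wnat w S C (swap_lo M t)"
proof -
  note [simp] = bifunctor_typing[OF M] slice_sel[OF M] t
  \<comment> \<open>\<open>slice_sel\<close> evaluates a slice in one step;
    \<open>ffun_comp_sel\<close> would expose \<open>ev\<close> and with it membership conditions in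
    \<open>FT\<close>.\<close>
  note [simp del] = ffun_comp_sel
  note [simp] = bifunctorD(4,5)[OF M]
  have weak: "weak_cell C w (nc (FLo M s) t)" if "s \<in> Loose S" for s
    using that by simp
  show ?thesis
  proof (rule wnatI, goal_cases)
    case (6 s)
    have "directed_cell C w (FLo (FOb M (Dom S s)) t) (cm (FLo M s) (Dom T t))
        (cm (FLo M s) (Cod T t)) (FLo (FOb M (Cod S s)) t) (flip C w (nc (FLo M s) t))"
      by (rule C.directed_cell_flip)
        (use wnatD(7)[OF bifunctorD(3)[OF M 6] t] 6 in simp_all)
    with 6 show ?case by simp
  next
    case (8 X)
    then show ?case by (simp add: ffunctorD(6)[OF M])
  next
    case (9 s r)
    then have c: "FLo M (r \<cdot>\<^bsub>S\<^esub> s) = trans_comp (dual w) T C (FLo M r) (FLo M s)"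
      by (simp add: ffunctorD(7)[OF M])
    have i: "w = Strict \<or> w = Pseudo \<Longrightarrow> invertible_cell C (nc (FLo M s) t)"
      "w = Strict \<or> w = Pseudo \<Longrightarrow> invertible_cell C (nc (FLo M r) t)"
      using 9 weak C.weak_cell_invertible[of _ w] by simp_all
    show ?case
    proof (cases rule: orientation_cases)
      case inv
      note [simp] = inv
      show ?thesis using 9 i by (simp add: c C.cmp_assoc C.inv2_vcmp C.inv2_lwhisk C.inv2_rwhisk)
    next
      case Lax
      note [simp] = Lax
      show ?thesis using 9 i by (simp add: c C.cmp_assoc C.inv2_vcmp C.inv2_lwhisk C.inv2_rwhisk)
    next
      case Colax
      note [simp] = Colax
      show ?thesis using 9 i by (simp add: c C.cmp_assoc C.inv2_vcmp C.inv2_lwhisk C.inv2_rwhisk)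
    qed
  next
    case (10 x)
    note sq = C.flip_square[of "nc (FLo M (Src S x)) t" w "nc (FLo M (Trg S x)) t"
          "FLo (FOb M (Cod S (Src S x))) t \<rhd>\<^bsub>C\<^esub> adata (FCe M x) (Dom T t)"
          "adata (FCe M x) (Cod T t) \<lhd>\<^bsub>C\<^esub> FLo (FOb M (Dom S (Src S x))) t"]
      modifD(8)[OF bifunctorD(6)[OF M 10] t]
    show ?case
    proof (cases rule: orientation_cases)
      case inv
      note [simp] = inv
      show ?thesis using 10 sq by (simp add: bifunctorD(7,8)[OF M])
    next
      case Lax
      note [simp] = Lax
      show ?thesis using 10 sq by (simp add: bifunctorD(7,8)[OF M])
    next
      case Colax
      note [simp] = Colax
      show ?thesis using 10 sq by (simp add: bifunctorD(7,8)[OF M])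
    qed
  qed (simp_all add: slice_ffunctor[OF M], simp_all add: swap_lo_def)
qed

text \<open>The tightness clauses trade places under transposition. For tight \<open>s\<close> the
  transformation \<open>FLo M s\<close> is tight, so its cells are \<open>w'\<close>-cells at every
  \<open>t\<close>; this is the clause that a loose transpose has to satisfy at tight
  \<open>s\<close>.\<close>

lemma swap_lo_loose:
  assumes M: "is_ffunctor S FT M" and t: "t \<in> Loose T"
  shows "is_loose_trans w' w S C (swap_lo M t)"
proof -
  have "weak_cell C w' (nc (FLo M s) t)" if "s \<in> Tight S" for s
    using ffunctorD(13)[OF M that] t by (auto dest: tight_transD(3))
  then show ?thesis
    using swap_lo_wnat[OF assms] t by (simp add: is_loose_trans_def bifunctor_typing[OF M])
qed

text \<open>Conversely, for every \<open>s\<close> the transformation \<open>FLo M s\<close> is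
  loose, hence has a \<open>w'\<close>-cell at each tight \<open>t\<close>; the components are tight
  since each \<open>FOb M X\<close> preserves tightness.\<close>

lemma swap_lo_tight:
  assumes M: "is_ffunctor S FT M" and t: "t \<in> Tight T"
  shows "is_tight_trans w' w S C (swap_lo M t)"
proof -
  have "weak_cell C w' (nc (FLo M s) t)" if "s \<in> Loose S" for s
    using loose_transD(2)[OF bifunctorD(2)[OF M that] t] by simp
  then show ?thesis
    using swap_lo_loose[OF M] t
    by (simp add: is_tight_trans_def bifunctor_typing[OF M] ffunctorD(13)[OF bifunctorD(1)[OF M]])
qed

text \<open>The modification axiom at \<open>s\<close> is the compatibility of
  \<open>FLo M s\<close> with the 2-cell \<open>y\<close>, reversed by \<open>flip_square\<close>
  where the structure cells are inverted.\<close>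

lemma swap_cell_modif:
  assumes M: "is_ffunctor S FT M" and y: "y \<in> Cell T"
  shows "is_modif w' w S C (FCe (swap_ob M) y)"
proof -
  note [simp] = bifunctor_typing[OF M] slice_sel[OF M] y bifunctorD(4,5)[OF M]
  note [simp del] = ffun_comp_sel
  show ?thesis
  proof (rule modifI, goal_cases)
    case (7 s)
    note sq = C.flip_square[of "nc (FLo M s) (Src T y)" w "nc (FLo M s) (Trg T y)"
          "FCe (FOb M (Cod S s)) y \<lhd>\<^bsub>C\<^esub> cm (FLo M s) (Dom T (Src T y))"
          "cm (FLo M s) (Cod T (Src T y)) \<rhd>\<^bsub>C\<^esub> FCe (FOb M (Dom S s)) y"]
      wnatD(13)[OF bifunctorD(3)[OF M 7] y]
    show ?case
    proof (cases rule: orientation_cases)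
      case inv
      note [simp] = inv
      show ?thesis using 7 sq by simp
    next
      case Lax
      note [simp] = Lax
      show ?thesis using 7 sq by simp
    next
      case Colax
      note [simp] = Colax
      show ?thesis using 7 sq by simp
    qed
  qed (simp_all add: swap_lo_loose[OF M], simp_all add: swap_ob_def)
qed

text \<open>Functoriality in \<open>T\<close> comes from the transformation axioms of the
  \<open>FLo M s\<close> for identities and composites, together with the functoriality of each
  \<open>FOb M X\<close>. In the strict and pseudo cases the inverse of a pasted cell is the pasting
  of the inverses.\<close>

lemma swap_ob_ffunctor:
  assumes M: "is_ffunctor S FT M"
  shows "is_ffunctor T FS (swap_ob M)"
proof -
  note [simp] = bifunctor_typing[OF M] slice_sel[OF M] bifunctorD(4,5)[OF M]
  note [simp del] = ffun_comp_sel
  have ext: "FOb (swap_ob M) \<in> extensional (Obj T)" "FLo (swap_ob M) \<in> extensional (Loose T)"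
    "FCe (swap_ob M) \<in> extensional (Cell T)"
    by (simp_all add: swap_ob_def)
  have id: "swap_lo M (Id1 T Y) = trans_id S C (ffun_comp S (ev Y) M)" if Y: "Y \<in> Obj T" for Y
    by (rule trans_eqI[OF swap_lo_wnat[OF M] SC.wnat_id[OF slice_ffunctor[OF M]]])
      (simp_all add: Y wnatD(11)[OF bifunctorD(3)[OF M]] ffunctorD(6)[OF bifunctorD(1)[OF M]])
  have cmp: "swap_lo M (t' \<cdot>\<^bsub>T\<^esub> t) = trans_comp w S C (swap_lo M t') (swap_lo M t)"
    if t: "t \<in> Loose T" "t' \<in> Loose T" "Dom T t' = Cod T t" for t t'
  proof (rule trans_eqI[OF swap_lo_wnat[OF M] SC.wnat_comp[OF swap_lo_wnat[OF M] swap_lo_wnat[OF M]]])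
    fix s assume s: "s \<in> Loose S"
    have i: "w = Strict \<or> w = Pseudo \<Longrightarrow> invertible_cell C (nc (FLo M s) t)"
      "w = Strict \<or> w = Pseudo \<Longrightarrow> invertible_cell C (nc (FLo M s) t')"
      using s t C.weak_cell_invertible[of _ w] by simp_all
    show "nc (swap_lo M (t' \<cdot>\<^bsub>T\<^esub> t)) s = nc (trans_comp w S C (swap_lo M t') (swap_lo M t)) s"
    proof (cases rule: orientation_cases)
      case inv
      note [simp] = inv
      show ?thesis using s t i by (simp add: wnatD(12)[OF bifunctorD(3)[OF M]] C.cmp_assoc C.inv2_vcmp C.inv2_lwhisk C.inv2_rwhisk)
    next
      case Lax
      note [simp] = Lax
      show ?thesis using s t i by (simp add: wnatD(12)[OF bifunctorD(3)[OF M]] C.cmp_assoc C.inv2_vcmp C.inv2_lwhisk C.inv2_rwhisk)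
    next
      case Colax
      note [simp] = Colax
      show ?thesis using s t i by (simp add: wnatD(12)[OF bifunctorD(3)[OF M]] C.cmp_assoc C.inv2_vcmp C.inv2_lwhisk C.inv2_rwhisk)
    qed
  qed (simp_all add: t ffunctorD(7)[OF bifunctorD(1)[OF M]])
  have id2: "FCe (swap_ob M) (Id2 T t) = Id2 FS (swap_lo M t)" if "t \<in> Loose T" for t
    by (rule modif_eqI[OF swap_cell_modif[OF M] SC.modif_id[OF swap_lo_loose[OF M]]])
      (use that ffunctorD(10)[OF bifunctorD(1)[OF M]] in simp_all)
  have vcmp: "FCe (swap_ob M) (y' \<bullet>\<^bsub>T\<^esub> y) = VCmp FS (FCe (swap_ob M) y') (FCe (swap_ob M) y)"
    if y: "y \<in> Cell T" "y' \<in> Cell T" "Src T y' = Trg T y" for y y'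
    by (rule modif_eqI[OF swap_cell_modif[OF M] SC.modif_vcmp[OF swap_cell_modif[OF M] swap_cell_modif[OF M]]])
      (use y ffunctorD(11)[OF bifunctorD(1)[OF M]] in simp_all)
  have hcmp: "FCe (swap_ob M) (y' \<star>\<^bsub>T\<^esub> y) = HCmp FS (FCe (swap_ob M) y') (FCe (swap_ob M) y)"
    if y: "y \<in> Cell T" "y' \<in> Cell T" "Dom T (Src T y') = Cod T (Src T y)" for y y'
    by (rule modif_eqI[OF swap_cell_modif[OF M] SC.modif_hcmp[OF swap_cell_modif[OF M] swap_cell_modif[OF M]]])
      (use y ffunctorD(12)[OF bifunctorD(1)[OF M]] cmp in simp_all)
  show ?thesis
    unfolding is_ffunctor_def
    using ext id cmp id2 vcmp hcmp slice_ffunctor[OF M] swap_lo_loose[OF M] swap_lo_tight[OF M]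
      swap_cell_modif[OF M]
    by (simp add: PiE_iff del: Fun_sel(11-13))
qed

section \<open>Transposing transformations and modifications\<close>

definition swap_nc where
  "swap_nc \<phi> t = (let
     a = trans_comp w S C (post_trans S (ev (Cod T t)) \<phi>) (swap_lo (asrc \<phi>) t);
     b = trans_comp w S C (swap_lo (atrg \<phi>) t) (post_trans S (ev (Dom T t)) \<phi>)
     in \<lparr>asrc = if w = Lax then a else b, atrg = if w = Lax then b else a,
       adata = (\<lambda>X\<in>Obj S. nc (cm \<phi> X) t)\<rparr>)"

text \<open>Unlike the cells of \<open>swap_lo\<close>, those of \<open>swap_nc\<close> are not
  flipped: the structure cells of the components \<open>cm \<phi> X\<close> along \<open>T\<close>
  already have weakness \<open>dual w\<close>, which is the weakness of the transpose.\<close>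

definition swap_trans where
  "swap_trans \<phi> = \<lparr>asrc = swap_ob (asrc \<phi>), atrg = swap_ob (atrg \<phi>), adata = \<lparr>
     cmpt = (\<lambda>Y\<in>Obj T. post_trans S (ev Y) \<phi>), ncell = (\<lambda>t\<in>Loose T. swap_nc \<phi> t)\<rparr>\<rparr>"

definition swap_modif where
  "swap_modif \<mu> = \<lparr>asrc = swap_trans (asrc \<mu>), atrg = swap_trans (atrg \<mu>),
     adata = (\<lambda>Y\<in>Obj T. post_modif S (ev Y) \<mu>)\<rparr>"

lemma swap_trans_sel [simp]:
  "asrc (swap_trans \<phi>) = swap_ob (asrc \<phi>)"
  "atrg (swap_trans \<phi>) = swap_ob (atrg \<phi>)"
  "Y \<in> Obj T \<Longrightarrow> cm (swap_trans \<phi>) Y = post_trans S (ev Y) \<phi>"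
  "t \<in> Loose T \<Longrightarrow> nc (swap_trans \<phi>) t = swap_nc \<phi> t"
  "asrc (swap_modif \<mu>) = swap_trans (asrc \<mu>)"
  "atrg (swap_modif \<mu>) = swap_trans (atrg \<mu>)"
  "Y \<in> Obj T \<Longrightarrow> adata (swap_modif \<mu>) Y = post_modif S (ev Y) \<mu>"
  by (simp_all add: swap_trans_def swap_modif_def)

lemma swap_nc_sel [simp]:
  "asrc (swap_nc \<phi> t) =
     (if w = Lax then trans_comp w S C (post_trans S (ev (Cod T t)) \<phi>) (swap_lo (asrc \<phi>) t)
      else trans_comp w S C (swap_lo (atrg \<phi>) t) (post_trans S (ev (Dom T t)) \<phi>))"
  "atrg (swap_nc \<phi> t) =
     (if w = Lax then trans_comp w S C (swap_lo (atrg \<phi>) t) (post_trans S (ev (Dom T t)) \<phi>)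
      else trans_comp w S C (post_trans S (ev (Cod T t)) \<phi>) (swap_lo (asrc \<phi>) t))"
  "X \<in> Obj S \<Longrightarrow> adata (swap_nc \<phi> t) X = nc (cm \<phi> X) t"
  by (simp_all add: swap_nc_def Let_def)

lemma bitransD:
  assumes p: "is_wnat w S FT \<phi>"
  shows "X \<in> Obj S \<Longrightarrow> is_loose_trans (dual w') (dual w) T C (cm \<phi> X)"
    "X \<in> Obj S \<Longrightarrow> is_wnat (dual w) T C (cm \<phi> X)"
    "X \<in> Obj S \<Longrightarrow> asrc (cm \<phi> X) = FOb (asrc \<phi>) X"
    "X \<in> Obj S \<Longrightarrow> atrg (cm \<phi> X) = FOb (atrg \<phi>) X"
    "s \<in> Loose S \<Longrightarrow> is_modif (dual w') (dual w) T C (nc \<phi> s)"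
    "s \<in> Loose S \<Longrightarrow> asrc (nc \<phi> s) =
       (if w = Colax then trans_comp (dual w) T C (cm \<phi> (Cod S s)) (FLo (asrc \<phi>) s)
        else trans_comp (dual w) T C (FLo (atrg \<phi>) s) (cm \<phi> (Dom S s)))"
    "s \<in> Loose S \<Longrightarrow> atrg (nc \<phi> s) =
       (if w = Colax then trans_comp (dual w) T C (FLo (atrg \<phi>) s) (cm \<phi> (Dom S s))
        else trans_comp (dual w) T C (cm \<phi> (Cod S s)) (FLo (asrc \<phi>) s))"
  using wnatD[OF p] by (auto dest: loose_transD)

lemma bitrans_typing:
  assumes p: "is_wnat w S FT \<phi>"
  shows "X \<in> Obj S \<Longrightarrow> Y \<in> Obj T \<Longrightarrow> cm (cm \<phi> X) Y \<in> Loose C"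
    "X \<in> Obj S \<Longrightarrow> Y \<in> Obj T \<Longrightarrow> Dom C (cm (cm \<phi> X) Y) = FOb (FOb (asrc \<phi>) X) Y"
    "X \<in> Obj S \<Longrightarrow> Y \<in> Obj T \<Longrightarrow> Cod C (cm (cm \<phi> X) Y) = FOb (FOb (atrg \<phi>) X) Y"
    "X \<in> Obj S \<Longrightarrow> t \<in> Loose T \<Longrightarrow> nc (cm \<phi> X) t \<in> Cell C"
    "X \<in> Obj S \<Longrightarrow> t \<in> Loose T \<Longrightarrow> weak_cell C w (nc (cm \<phi> X) t)"
    "X \<in> Obj S \<Longrightarrow> t \<in> Loose T \<Longrightarrow> Src C (nc (cm \<phi> X) t) =
       (if w = Lax then cm (cm \<phi> X) (Cod T t) \<cdot>\<^bsub>C\<^esub> FLo (FOb (asrc \<phi>) X) t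
        else FLo (FOb (atrg \<phi>) X) t \<cdot>\<^bsub>C\<^esub> cm (cm \<phi> X) (Dom T t))"
    "X \<in> Obj S \<Longrightarrow> t \<in> Loose T \<Longrightarrow> Trg C (nc (cm \<phi> X) t) =
       (if w = Lax then FLo (FOb (atrg \<phi>) X) t \<cdot>\<^bsub>C\<^esub> cm (cm \<phi> X) (Dom T t)
        else cm (cm \<phi> X) (Cod T t) \<cdot>\<^bsub>C\<^esub> FLo (FOb (asrc \<phi>) X) t)"
    "s \<in> Loose S \<Longrightarrow> Y \<in> Obj T \<Longrightarrow> adata (nc \<phi> s) Y \<in> Cell C"
    "s \<in> Loose S \<Longrightarrow> Y \<in> Obj T \<Longrightarrow> Src C (adata (nc \<phi> s) Y) =
       (if w = Colax then cm (cm \<phi> (Cod S s)) Y \<cdot>\<^bsub>C\<^esub> cm (FLo (asrc \<phi>) s) Y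
        else cm (FLo (atrg \<phi>) s) Y \<cdot>\<^bsub>C\<^esub> cm (cm \<phi> (Dom S s)) Y)"
    "s \<in> Loose S \<Longrightarrow> Y \<in> Obj T \<Longrightarrow> Trg C (adata (nc \<phi> s) Y) =
       (if w = Colax then cm (FLo (atrg \<phi>) s) Y \<cdot>\<^bsub>C\<^esub> cm (cm \<phi> (Dom S s)) Y
        else cm (cm \<phi> (Cod S s)) Y \<cdot>\<^bsub>C\<^esub> cm (FLo (asrc \<phi>) s) Y)"
  using wnatD(8-10)[OF bitransD(2)[OF p], of X t]
  by (simp_all add: wnatD(3-6)[OF bitransD(2)[OF p]] modifD(5-7)[OF bitransD(5)[OF p]]
      bitransD(3,4,6,7)[OF p])

lemma post_sel_ev:
  assumes p: "is_wnat w S FT \<phi>"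
  shows "X \<in> Obj S \<Longrightarrow> cm (post_trans S (ev Y) \<phi>) X = cm (cm \<phi> X) Y"
    "s \<in> Loose S \<Longrightarrow> nc (post_trans S (ev Y) \<phi>) s = adata (nc \<phi> s) Y"
  by (simp_all add: bitransD[OF p])

lemma post_trans_ev:
  assumes "is_loose_trans w' w S FT \<phi>" "Y \<in> Obj T"
  shows "is_loose_trans w' w S C (post_trans S (ev Y) \<phi>)"
  by (rule SFT.loose_trans_post[OF TC.ffunctor_eval_Fun[OF assms(2)] assms(1)])

text \<open>
  The modification axioms for the structure cells of a transformation and of its transpose are the
  same commuting cube.
\<close>

lemma swap_nc_modif:
  assumes l: "is_loose_trans w' w S FT \<phi>" and t: "t \<in> Loose T"
  shows "is_modif w' w S C (swap_nc \<phi> t)"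
proof -
  note p = loose_transD(1)[OF l]
  note M = wnatD(1)[OF p] and N = wnatD(2)[OF p]
  note [simp] = bifunctor_typing[OF M] bifunctor_typing[OF N] slice_sel[OF M] slice_sel[OF N]
    bitrans_typing[OF p] post_sel_ev[OF p] bifunctorD(4,5)[OF M] bifunctorD(4,5)[OF N] bitransD(3,4)[OF p] t
  note [simp del] = ffun_comp_sel post_sel(3,4)
  have c: "is_loose_trans w' w S C (trans_comp w S C (post_trans S (ev (Cod T t)) \<phi>) (swap_lo (asrc \<phi>) t))"
    "is_loose_trans w' w S C (trans_comp w S C (swap_lo (atrg \<phi>) t) (post_trans S (ev (Dom T t)) \<phi>))"
    by (auto intro!: SC.loose_trans_comp post_trans_ev[OF l] swap_lo_loose[OF M] swap_lo_loose[OF N])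
  let ?A = "asrc (swap_nc \<phi> t)" and ?B = "atrg (swap_nc \<phi> t)"
  have bd: "is_loose_trans w' w S C ?A \<and> is_loose_trans w' w S C ?B \<and> asrc ?B = asrc ?A \<and>
      atrg ?B = atrg ?A \<and> (\<forall>X\<in>Obj S. hom2 C (nc (cm \<phi> X) t) (cm ?A X) (cm ?B X))"
  proof (cases "w = Lax")
    case True
    note [simp] = eqTrueI[OF True]
    show ?thesis using c by simp
  next
    case False
    note [simp] = False
    show ?thesis using c by simp
  qed
  show ?thesis
  proof (rule modifI, goal_cases)
    case (7 s)
    let ?m = "cm (FLo (asrc \<phi>) s)" and ?n = "cm (FLo (atrg \<phi>) s)"
    let ?l = "FLo (FOb (asrc \<phi>) (Dom S s)) t" and ?k = "FLo (FOb (atrg \<phi>) (Cod S s)) t"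
    \<comment> \<open>The six whiskered faces of the cube: \<open>?a\<close> and \<open>?b\<close>
      come from the two bifunctors, \<open>?v\<close> and \<open>?p\<close> from the components of
      \<phi>, \<open>?u\<close> and \<open>?q\<close> from its structure cell at \<open>s\<close>.
      Transposition flips only \<open>?a\<close> and \<open>?b\<close>.\<close>
    let ?a = "cm (cm \<phi> (Cod S s)) (Cod T t) \<rhd>\<^bsub>C\<^esub> nc (FLo (asrc \<phi>) s) t"
    let ?b = "nc (FLo (atrg \<phi>) s) t \<lhd>\<^bsub>C\<^esub> cm (cm \<phi> (Dom S s)) (Dom T t)"
    let ?v = "nc (cm \<phi> (Cod S s)) t \<lhd>\<^bsub>C\<^esub> ?m (Dom T t)"
    let ?p = "?n (Cod T t) \<rhd>\<^bsub>C\<^esub> nc (cm \<phi> (Dom S s)) t"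
    let ?u = "?k \<rhd>\<^bsub>C\<^esub> adata (nc \<phi> s) (Dom T t)"
    let ?q = "adata (nc \<phi> s) (Cod T t) \<lhd>\<^bsub>C\<^esub> ?l"
    note cube = modifD(8)[OF bitransD(5)[OF p 7] t]
    have i: "w = Strict \<or> w = Pseudo \<Longrightarrow> invertible_cell C (nc (FLo (asrc \<phi>) s) t)"
      "w = Strict \<or> w = Pseudo \<Longrightarrow> invertible_cell C (nc (FLo (atrg \<phi>) s) t)"
      using 7 C.weak_cell_invertible[of _ w] by simp_all
    show ?case
    proof (cases rule: orientation_cases)
      case inv
      note [simp] = inv
      have ii: "invertible_cell C (nc (FLo (asrc \<phi>) s) t)" "invertible_cell C (nc (FLo (atrg \<phi>) s) t)"
        using i by simp_all
      \<comment> \<open>The cube in the form of a hexagon, with the two faces to be inverted as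
        opposite edges.\<close>
      have e: "(?a \<bullet>\<^bsub>C\<^esub> ?v) \<bullet>\<^bsub>C\<^esub> ?u = ?q \<bullet>\<^bsub>C\<^esub> (?p \<bullet>\<^bsub>C\<^esub> ?b)"
        using 7 cube by (simp add: bitransD(6,7)[OF p])
      have "(inv2 C ?a \<bullet>\<^bsub>C\<^esub> ?q) \<bullet>\<^bsub>C\<^esub> ?p = ?v \<bullet>\<^bsub>C\<^esub> (?u \<bullet>\<^bsub>C\<^esub> inv2 C ?b)"
        by (rule C.cancel_invertible[OF _ _ _ _ _ _ _ _ _ e])
          (use 7 ii in \<open>simp_all add: C.inv2_lwhisk C.inv2_rwhisk C.cmp_assoc\<close>)
      then show ?thesis using 7 ii by (simp add: C.inv2_lwhisk C.inv2_rwhisk)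
    next
      case Lax
      note [simp] = Lax
      show ?thesis using 7 cube by (simp add: bitransD(6,7)[OF p] C.whisk_nf)
    next
      case Colax
      note [simp] = Colax
      show ?thesis using 7 cube by (simp add: bitransD(6,7)[OF p] C.whisk_nf)
    qed
  qed (use bd in \<open>simp_all only: swap_nc_sel(3)\<close>, simp_all add: swap_nc_def Let_def)
qed

text \<open>Equations between modifications are compared at each \<open>X\<close>, where they become
  the axioms of the transformation \<open>cm \<phi> X\<close>. The selectors of the transposed data
  are mostly disabled so that the boundaries can be computed in \<open>FS\<close>.\<close>

lemma swap_trans_wnat:
  assumes l: "is_loose_trans w' w S FT \<phi>"
  shows "is_wnat (dual w) T FS (swap_trans \<phi>)"
proof -
  note p = loose_transD(1)[OF l]
  note M = wnatD(1)[OF p] and N = wnatD(2)[OF p]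
  note sM = swap_ob_ffunctor[OF M] and sN = swap_ob_ffunctor[OF N]
  have cells: "swap_nc \<phi> t \<in> Cell FS" if "t \<in> Loose T" for t
    using swap_nc_modif[OF l that] by simp
  have src: "Src FS (swap_nc \<phi> t) =
      (if w = Lax then post_trans S (ev (Cod T t)) \<phi> \<cdot>\<^bsub>FS\<^esub> FLo (swap_ob (asrc \<phi>)) t
       else FLo (swap_ob (atrg \<phi>)) t \<cdot>\<^bsub>FS\<^esub> post_trans S (ev (Dom T t)) \<phi>)"
    "Trg FS (swap_nc \<phi> t) =
      (if w = Lax then FLo (swap_ob (atrg \<phi>)) t \<cdot>\<^bsub>FS\<^esub> post_trans S (ev (Dom T t)) \<phi>
       else post_trans S (ev (Cod T t)) \<phi> \<cdot>\<^bsub>FS\<^esub> FLo (swap_ob (asrc \<phi>)) t)"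
    if "t \<in> Loose T" for t
    by (simp_all only: swap_nc_sel Fun_sel swap_ob_sel that)
  have cmps: "post_trans S (ev Y) \<phi> \<in> Loose FS" "Dom FS (post_trans S (ev Y) \<phi>) = FOb (swap_ob (asrc \<phi>)) Y"
    "Cod FS (post_trans S (ev Y) \<phi>) = FOb (swap_ob (atrg \<phi>)) Y" if "Y \<in> Obj T" for Y
    using that post_trans_ev[OF l that] by simp_all
  have lo: "cm (FLo (swap_ob M) t) X = FLo (FOb M X) t" if "X \<in> Obj S" "t \<in> Loose T" for X t M
    using that by simp
  note [simp] = bifunctor_typing[OF M] bifunctor_typing[OF N] bitrans_typing[OF p] post_sel_ev[OF p]
    bitransD(3,4)[OF p] cells src cmps ffunctorD[OF sM] ffunctorD[OF sN] lo
  note [simp del] = ffun_comp_sel post_sel Fun_sel swap_ob_sel(1,2) swap_lo_sel swap_nc_sel(1,2)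
  show ?thesis
  proof (rule wnatI, goal_cases)
    case (6 t)
    show ?case
    proof (cases "w = Lax")
      case True
      note [simp] = eqTrueI[OF True]
      show ?thesis using 6 by (simp add: directed_cell_def)
    next
      case False
      note [simp] = False
      show ?thesis using 6 by (simp add: directed_cell_def)
    qed
  next
    case (7 t)
    then show ?case using SC.weak_cell_Fun[OF swap_nc_modif[OF l], of t "dual w"] by simp
  next
    case (8 Y)
    show ?case
    proof (cases "w = Lax")
      case True
      note [simp] = eqTrueI[OF True]
      show ?thesis
        using 8 by (intro Fun_cell_eqI[of _ w' w S C]) (auto simp: wnatD(11)[OF bitransD(2)[OF p]])
    next
      case False
      note [simp] = False
      show ?thesis
        using 8 by (intro Fun_cell_eqI[of _ w' w S C]) (auto simp: wnatD(11)[OF bitransD(2)[OF p]])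
    qed
  next
    case (9 s r)
    show ?case
    proof (cases "w = Lax")
      case True
      note [simp] = eqTrueI[OF True]
      show ?thesis
        using 9 by (intro Fun_cell_eqI[of _ w' w S C])
          (auto simp: wnatD(12)[OF bitransD(2)[OF p]] FS.cmp_assoc)
    next
      case False
      note [simp] = False
      show ?thesis
        using 9 by (intro Fun_cell_eqI[of _ w' w S C])
          (auto simp: wnatD(12)[OF bitransD(2)[OF p]] FS.cmp_assoc)
    qed
  next
    case (10 y)
    note eq = wnatD(13)[OF bitransD(2)[OF p] 10]
    show ?case
    proof (cases "w = Lax")
      case True
      note [simp] = eqTrueI[OF True]
      show ?thesis
        using 10 eq by (simp, intro Fun_cell_eqI[of _ w' w S C]) (auto simp: FS.cmp_assoc)
    next
      case False
      note [simp] = False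
      show ?thesis
        using 10 eq by (simp, intro Fun_cell_eqI[of _ w' w S C]) (auto simp: FS.cmp_assoc)
    qed
  qed (simp_all add: sM sN, simp_all add: swap_trans_def)
qed

lemma swap_trans_loose:
  assumes l: "is_loose_trans w' w S FT \<phi>"
  shows "is_loose_trans (dual w') (dual w) T FS (swap_trans \<phi>)"
  unfolding is_loose_trans_def
proof (intro conjI ballI swap_trans_wnat[OF l])
  fix t assume t: "t \<in> Tight T"
  have "weak_cell C (dual w') (adata (swap_nc \<phi> t) X)" if "X \<in> Obj S" for X
    using loose_transD(2)[OF bitransD(1)[OF loose_transD(1)[OF l] that] t] that by simp
  then show "weak_cell FS (dual w') (nc (swap_trans \<phi>) t)"
    using SC.weak_cell_Fun[OF swap_nc_modif[OF l]] t by simp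
qed

text \<open>If \<phi> is tight, each \<open>cm \<phi> X\<close> is a tight transformation, so its
  structure cells are \<open>w'\<close>-cells at every arrow of \<open>T\<close>; tight components
  of the transpose come from postcomposing the tight \<phi> with evaluation.\<close>

lemma swap_trans_tight:
  assumes l: "is_tight_trans w' w S FT \<phi>"
  shows "is_tight_trans (dual w') (dual w) T FS (swap_trans \<phi>)"
  unfolding is_tight_trans_def
proof (intro conjI ballI swap_trans_loose tight_transD(1)[OF l])
  fix t assume t: "t \<in> Loose T"
  have "weak_cell C (dual w') (adata (swap_nc \<phi> t) X)" if "X \<in> Obj S" for X
    using tight_transD(2)[OF l that] that tight_transD(3)[of "dual w'" "dual w" T C "cm \<phi> X", OF _ t]
    by simp
  then show "weak_cell FS (dual w') (nc (swap_trans \<phi>) t)"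
    using SC.weak_cell_Fun[OF swap_nc_modif[OF tight_transD(1)[OF l]]] t by simp
next
  fix Y assume "Y \<in> Obj T"
  then show "cm (swap_trans \<phi>) Y \<in> Tight FS"
    using SFT.tight_trans_post[OF TC.ffunctor_eval_Fun l] by simp
qed

text \<open>At the component \<open>X\<close> the axiom to be shown is the modification axiom of
  \<open>adata \<mu> X\<close> in the variable \<open>T\<close>.\<close>

lemma swap_modif_modif:
  assumes m: "is_modif w' w S FT \<mu>"
  shows "is_modif (dual w') (dual w) T FS (swap_modif \<mu>)"
proof -
  note l = modifD(1)[OF m] and l' = modifD(2)[OF m]
  note p = loose_transD(1)[OF l] and q = loose_transD(1)[OF l']
  note sp = swap_trans_wnat[OF l] and sq = swap_trans_wnat[OF l']
  note sM = swap_ob_ffunctor[OF wnatD(1)[OF p]] and sN = swap_ob_ffunctor[OF wnatD(2)[OF p]]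
  have ad: "is_modif (dual w') (dual w) T C (adata \<mu> X)" "asrc (adata \<mu> X) = cm (asrc \<mu>) X"
    "atrg (adata \<mu> X) = cm (atrg \<mu>) X" if "X \<in> Obj S" for X
    using modifD(5-7)[OF m that] by simp_all
  have pm: "post_modif S (ev Y) \<mu> \<in> Cell FS" "Src FS (post_modif S (ev Y) \<mu>) = cm (swap_trans (asrc \<mu>)) Y"
    "Trg FS (post_modif S (ev Y) \<mu>) = cm (swap_trans (atrg \<mu>)) Y" if "Y \<in> Obj T" for Y
    using SFT.modif_post[OF TC.ffunctor_eval_Fun m] that by simp_all
  have pma: "adata (post_modif S (ev Y) \<mu>) X = adata (adata \<mu> X) Y" if "X \<in> Obj S" for X Y
    using that ad by simp
  have nca: "adata (nc (swap_trans \<phi>) t) X = nc (cm \<phi> X) t" if "X \<in> Obj S" "t \<in> Loose T" for \<phi> X t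
    using that by simp
  have lo: "cm (FLo (swap_ob M) t) X = FLo (FOb M X) t" if "X \<in> Obj S" "t \<in> Loose T" for X t M
    using that by simp
  note [simp] = modifD(3,4)[OF m]
  note [simp] = wnatD(3-6,8-9)[OF sp] wnatD(3-6,8-9)[OF sq] ffunctorD[OF sM] ffunctorD[OF sN]
    pm pma nca lo ad bitransD(3,4)[OF p]
  note [simp del] = ffun_comp_sel post_sel Fun_sel swap_ob_sel swap_lo_sel swap_nc_sel
    swap_trans_sel(3,4)
  show ?thesis
  proof (rule modifI, goal_cases)
    case (7 t)
    show ?case
    proof (cases "w = Lax")
      case True
      note [simp] = eqTrueI[OF True]
      show ?thesis
        using 7 modifD(8)[OF ad(1) 7]
        by simp (intro Fun_cell_eqI[of _ w' w S C]; simp)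
    next
      case False
      note [simp] = False
      show ?thesis
        using 7 modifD(8)[OF ad(1) 7]
        by simp (intro Fun_cell_eqI[of _ w' w S C]; simp)
    qed
  qed (simp_all add: swap_trans_loose l l', simp_all add: swap_modif_def)
qed

definition swap where
  "swap = \<lparr>FOb = restrict swap_ob (Obj (Fun w' w S FT)), FLo = restrict swap_trans (Loose (Fun w' w S FT)),
     FCe = restrict swap_modif (Cell (Fun w' w S FT))\<rparr>"

lemma swap_trans_id:
  assumes M: "is_ffunctor S FT M"
  shows "swap_trans (trans_id S FT M) = trans_id T FS (swap_ob M)"
proof (rule Fun_trans_eqI[OF swap_trans_wnat TFS.wnat_id[OF swap_ob_ffunctor[OF M]] _ _ T.fcategory_axioms])
  show "is_loose_trans w' w S FT (trans_id S FT M)"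
    using SFT.tight_trans_id[OF M] by (rule tight_transD)
  fix Y assume "Y \<in> Obj T"
  then show "cm (swap_trans (trans_id S FT M)) Y = cm (trans_id T FS (swap_ob M)) Y"
    using SFT.post_trans_id[OF TC.ffunctor_eval_Fun M] by simp
qed simp_all

lemma swap_trans_comp:
  assumes l: "is_loose_trans w' w S FT \<phi>" and k: "is_loose_trans w' w S FT \<psi>"
    and e: "asrc \<psi> = atrg \<phi>"
  shows "swap_trans (trans_comp w S FT \<psi> \<phi>) = trans_comp (dual w) T FS (swap_trans \<psi>) (swap_trans \<phi>)"
proof (rule Fun_trans_eqI[OF swap_trans_wnat TFS.wnat_comp[OF swap_trans_wnat[OF l] swap_trans_wnat[OF k]]
      _ _ T.fcategory_axioms])
  show "is_loose_trans w' w S FT (trans_comp w S FT \<psi> \<phi>)"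
    by (rule SFT.loose_trans_comp[OF l k e])
  fix Y assume "Y \<in> Obj T"
  then show "cm (swap_trans (trans_comp w S FT \<psi> \<phi>)) Y =
      cm (trans_comp (dual w) T FS (swap_trans \<psi>) (swap_trans \<phi>)) Y"
    using SFT.post_trans_comp[OF TC.ffunctor_eval_Fun loose_transD(1)[OF l] loose_transD(1)[OF k] e]
    by simp
next
  fix t X assume tX: "t \<in> Loose T" "X \<in> Obj S"
  note [simp] = post_sel_ev[OF loose_transD(1)[OF l]] post_sel_ev[OF loose_transD(1)[OF k]]
  note [simp del] = post_sel
  show "adata (nc (swap_trans (trans_comp w S FT \<psi> \<phi>)) t) X =
      adata (nc (trans_comp (dual w) T FS (swap_trans \<psi>) (swap_trans \<phi>)) t) X"
  proof (cases "w = Lax")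
    case True
    note [simp] = eqTrueI[OF True]
    show ?thesis using tX by simp
  next
    case False
    note [simp] = False
    show ?thesis using tX by simp
  qed
qed (simp_all add: e)

lemma swap_modif_id:
  assumes l: "is_loose_trans w' w S FT \<phi>"
  shows "swap_modif (Id2 (Fun w' w S FT) \<phi>) = Id2 (Fun (dual w') (dual w) T FS) (swap_trans \<phi>)"
  using SFT.post_modif_id[OF TC.ffunctor_eval_Fun loose_transD(1)[OF l], of _ w']
  by (intro modif_eqI[OF swap_modif_modif[OF SFT.modif_id[OF l]] TFS.modif_id[OF swap_trans_loose[OF l]]])
    \<comment> \<open>The first pass keeps \<open>Id2\<close> folded so that the law for
      postcomposition matches; the second unfolds what is left.\<close>
    (simp_all del: Fun_sel(11), simp_all)

lemma swap_modif_vcmp: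
  assumes m: "is_modif w' w S FT \<mu>" and n: "is_modif w' w S FT \<nu>" and e: "asrc \<nu> = atrg \<mu>"
  shows "swap_modif (VCmp (Fun w' w S FT) \<nu> \<mu>) =
    VCmp (Fun (dual w') (dual w) T FS) (swap_modif \<nu>) (swap_modif \<mu>)"
  using SFT.post_modif_vcmp[OF TC.ffunctor_eval_Fun m n e]
  by (intro modif_eqI[OF swap_modif_modif[OF SFT.modif_vcmp[OF m n e]]
        TFS.modif_vcmp[OF swap_modif_modif[OF m] swap_modif_modif[OF n]]])
    (simp_all add: e del: Fun_sel(12), simp_all add: e)

lemma swap_modif_hcmp:
  assumes m: "is_modif w' w S FT \<mu>" and n: "is_modif w' w S FT \<nu>"
    and e: "asrc (asrc \<nu>) = atrg (asrc \<mu>)"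
  shows "swap_modif (HCmp (Fun w' w S FT) \<nu> \<mu>) =
    HCmp (Fun (dual w') (dual w) T FS) (swap_modif \<nu>) (swap_modif \<mu>)"
  using SFT.post_modif_hcmp[OF TC.ffunctor_eval_Fun m n e]
    swap_trans_comp[OF modifD(1)[OF m] modifD(1)[OF n] e]
    swap_trans_comp[OF modifD(2)[OF m] modifD(2)[OF n]]
  by (intro modif_eqI[OF swap_modif_modif[OF SFT.modif_hcmp[OF m n e]]
        TFS.modif_hcmp[OF swap_modif_modif[OF m] swap_modif_modif[OF n]]])
    (simp_all add: e modifD(3,4)[OF m] modifD(3,4)[OF n] del: Fun_sel(13), simp_all add: e modifD(3,4)[OF m] modifD(3,4)[OF n])

lemma swap_ffunctor: "is_ffunctor (Fun w' w S FT) (Fun (dual w') (dual w) T FS) swap"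
proof -
  interpret F: fcategory "Fun w' w S FT" by (rule SFT.fcategory_Fun)
  have s: "is_ffunctor S FT (asrc \<phi>)" "is_ffunctor S FT (atrg \<phi>)" if "is_loose_trans w' w S FT \<phi>" for \<phi>
    using wnatD(1,2)[OF loose_transD(1)[OF that]] .
  show ?thesis
    unfolding is_ffunctor_def
    using F.id1_in F.cmp_in F.id2_in F.vcmp_in F.hcmp_in
    by (simp add: PiE_iff swap_def swap_ob_ffunctor swap_trans_loose swap_modif_modif s swap_trans_id
        swap_trans_comp swap_modif_id swap_modif_vcmp swap_modif_hcmp modifD tight_transD
        swap_trans_tight del: Fun_sel(11-13))
qed

section \<open>Transposing twice gives back the original data\<close>

context
begin

text \<open>Transposition in the other direction. Rewriting the double duals identifies its
  \<open>FT\<close> with the present \<open>FS\<close> and conversely, so that the two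
  transpositions compose.\<close>

interpretation op: fcat_swap T S C "dual w'" "dual w"
  rewrites "dual (dual w') = w'" and "dual (dual w) = w"
  by unfold_locales simp_all

text \<open>Needed twice: for the double transpose, and to recognise the evaluations of a transposed
  model as the given models \<open>FOb M X\<close>.\<close>

lemma slice_swap_ob:
  assumes M: "is_ffunctor S FT M" and X: "X \<in> Obj S"
  shows "ffun_comp T (eval_at FS X) (swap_ob M) = FOb M X"
  by (rule ffunctor_eqI[OF op.slice_ffunctor[OF swap_ob_ffunctor[OF M] X] bifunctorD(1)[OF M X]])
    (use X op.slice_sel[OF swap_ob_ffunctor[OF M]] slice_sel[OF M] in
      \<open>simp_all del: ffun_comp_sel\<close>)

text \<open>The two flips cancel: \<open>flip\<close> is the same for \<open>w\<close> and
  \<open>dual w\<close>, and it is an involution on \<open>w\<close>-cells.\<close>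

lemma swap_swap_ob:
  assumes M: "is_ffunctor S FT M"
  shows "op.swap_ob (swap_ob M) = M"
proof -
  note sM = swap_ob_ffunctor[OF M]
  note ssM = op.swap_ob_ffunctor[OF sM]
  have lo: "op.swap_lo (swap_ob M) s = FLo M s" if s: "s \<in> Loose S" for s
    by (rule trans_eqI[OF op.swap_lo_wnat[OF sM s] bifunctorD(3)[OF M s]])
      (use s slice_swap_ob[OF M] bifunctorD(4,5)[OF M] bifunctor_typing(14,15)[OF M] slice_sel[OF M] in
        \<open>simp_all del: ffun_comp_sel add: flip_dual\<close>)
  show ?thesis
  proof (rule ffunctor_eqI[OF ssM M])
    fix x assume x: "x \<in> Cell S"
    show "FCe (op.swap_ob (swap_ob M)) x = FCe M x"
      by (rule modif_eqI[OF op.swap_cell_modif[OF sM x] bifunctorD(6)[OF M x]])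
        (use x lo slice_sel[OF M] bifunctorD(7,8)[OF M] in \<open>simp_all del: ffun_comp_sel\<close>)
  qed (simp_all add: slice_swap_ob[OF M] lo)
qed

lemma slice_swap_trans:
  assumes l: "is_loose_trans w' w S FT \<phi>" and X: "X \<in> Obj S"
  shows "post_trans T (eval_at FS X) (swap_trans \<phi>) = cm \<phi> X"
proof -
  note p = loose_transD(1)[OF l] and sl = swap_trans_loose[OF l]
  note sp = loose_transD(1)[OF sl]
  note M = wnatD(1)[OF p] and N = wnatD(2)[OF p]
  show ?thesis
    by (rule trans_eqI[OF loose_transD(1)[OF op.post_trans_ev[OF sl X]] bitransD(2)[OF p X]])
      (use X slice_swap_ob[OF M X] slice_swap_ob[OF N X] bitransD(3,4)[OF p X] op.post_sel_ev[OF sp]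
         post_sel_ev[OF p]
       in \<open>simp_all del: post_sel(3,4)\<close>)
qed

lemma swap_swap_trans:
  assumes l: "is_loose_trans w' w S FT \<phi>"
  shows "op.swap_trans (swap_trans \<phi>) = \<phi>"
proof -
  note p = loose_transD(1)[OF l] and sl = swap_trans_loose[OF l]
  show ?thesis
    by (rule Fun_trans_eqI[OF op.swap_trans_wnat[OF sl] p _ _ S.fcategory_axioms])
      (use slice_swap_trans[OF l] post_sel_ev[OF p] swap_swap_ob[OF wnatD(1)[OF p]]
         swap_swap_ob[OF wnatD(2)[OF p]] in \<open>simp_all del: post_sel(3,4)\<close>)
qed

lemma swap_swap_modif:
  assumes m: "is_modif w' w S FT \<mu>"
  shows "op.swap_modif (swap_modif \<mu>) = \<mu>"
proof (rule modif_eqI[OF op.swap_modif_modif[OF swap_modif_modif[OF m]] m])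
  note l = modifD(1)[OF m] and l' = modifD(2)[OF m]
  show "asrc (op.swap_modif (swap_modif \<mu>)) = asrc \<mu>" "atrg (op.swap_modif (swap_modif \<mu>)) = atrg \<mu>"
    using swap_swap_trans[OF l] swap_swap_trans[OF l'] by simp_all
  fix X assume X: "X \<in> Obj S"
  have a: "is_modif (dual w') (dual w) T C (adata \<mu> X)" "asrc (adata \<mu> X) = cm (asrc \<mu>) X"
    "atrg (adata \<mu> X) = cm (atrg \<mu>) X"
    using modifD(5-7)[OF m X] by simp_all
  have b: "is_modif (dual w') (dual w) T C (post_modif T (eval_at FS X) (swap_modif \<mu>))"
    using TFS.modif_post[OF SC.ffunctor_eval_Fun[OF X] swap_modif_modif[OF m]] .
  have c: "is_modif w' w S C (post_modif S (ev Y) \<mu>)" if "Y \<in> Obj T" for Y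
    using SFT.modif_post[OF TC.ffunctor_eval_Fun[OF that] m] .
  have "post_modif T (eval_at FS X) (swap_modif \<mu>) = adata \<mu> X"
    by (rule modif_eqI[OF b a(1)])
      (use X a c slice_swap_trans[OF l X] slice_swap_trans[OF l' X] in simp_all)
  then show "adata (op.swap_modif (swap_modif \<mu>)) X = adata \<mu> X"
    using X by simp
qed

end

end

section \<open>Restricting an isomorphism to full subcategories\<close>

lemma ffunctor_restrict:
  assumes "fcategory A" and H: "is_ffunctor A B H"
    and P: "\<And>X. X \<in> Obj A \<Longrightarrow> X \<in> P \<Longrightarrow> FOb H X \<in> Q"
  shows "is_ffunctor (full_sub A P) (full_sub B Q)
    \<lparr>FOb = restrict (FOb H) (Obj (full_sub A P)), FLo = restrict (FLo H) (Loose (full_sub A P)),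
     FCe = restrict (FCe H) (Cell (full_sub A P))\<rparr>"
proof -
  interpret A: fcategory A by fact
  interpret P: fcategory "full_sub A P" by (rule A.fcategory_full_sub)
  show ?thesis
    unfolding is_ffunctor_def
    using P P.id1_in P.cmp_in P.id2_in P.vcmp_in P.hcmp_in
    by (simp add: PiE_iff ffunctorD[OF H])
qed

lemma isomorphic_full_sub:
  assumes "fcategory A" "fcategory B" and F: "is_ffunctor A B F" and G: "is_ffunctor B A G"
    and GF: "\<And>X. X \<in> Obj A \<Longrightarrow> FOb G (FOb F X) = X" "\<And>f. f \<in> Loose A \<Longrightarrow> FLo G (FLo F f) = f"
      "\<And>x. x \<in> Cell A \<Longrightarrow> FCe G (FCe F x) = x"
    and FG: "\<And>X. X \<in> Obj B \<Longrightarrow> FOb F (FOb G X) = X" "\<And>f. f \<in> Loose B \<Longrightarrow> FLo F (FLo G f) = f"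
      "\<And>x. x \<in> Cell B \<Longrightarrow> FCe F (FCe G x) = x"
    and P: "\<And>X. X \<in> Obj A \<Longrightarrow> X \<in> P \<Longrightarrow> FOb F X \<in> Q"
    and Q: "\<And>X. X \<in> Obj B \<Longrightarrow> X \<in> Q \<Longrightarrow> FOb G X \<in> P"
  shows "isomorphic_fcat (full_sub A P) (full_sub B Q)"
proof -
  interpret A: fcategory A by fact
  interpret B: fcategory B by fact
  show ?thesis
    unfolding isomorphic_fcat_def
    by (rule exI, rule exI, intro conjI, rule ffunctor_restrict[OF assms(1) F], erule (1) P,
        rule ffunctor_restrict[OF assms(2) G], erule (1) Q)
      (auto simp: ffun_comp_def ffun_id_def compose_def restrict_def fun_eq_iff GF FG P Q
        ffunctorD[OF F] ffunctorD[OF G])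
qed

section \<open>Cones and models\<close>

abbreviation "cJ \<kappa> \<equiv> wJ (cWeight \<kappa>)"
abbreviation "cW \<kappa> \<equiv> wF (cWeight \<kappa>)"

lemma functorD:
  assumes "is_functor A B F"
  shows "a \<in> cOb A \<Longrightarrow> onOb F a \<in> cOb B" "f \<in> cAr A \<Longrightarrow> onAr F f \<in> cAr B"
    "f \<in> cAr A \<Longrightarrow> cDom B (onAr F f) = onOb F (cDom A f)"
    "f \<in> cAr A \<Longrightarrow> cCod B (onAr F f) = onOb F (cCod A f)"
    "a \<in> cOb A \<Longrightarrow> onAr F (cId A a) = cId B (onOb F a)"
    "\<lbrakk>f \<in> cAr A; g \<in> cAr A; cDom A g = cCod A f\<rbrakk>
      \<Longrightarrow> onAr F (cCmp A g f) = cCmp B (onAr F g) (onAr F f)"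
  using assms by (auto simp: is_functor_def PiE_iff)

lemma hom_obj_sel [simp]:
  "cOb (hom_obj C X Y) = {f \<in> Loose C. Dom C f = X \<and> Cod C f = Y}"
  "cAr (hom_obj C X Y) = {x \<in> Cell C. Dom C (Src C x) = X \<and> Cod C (Src C x) = Y}"
  "tOb (hom_obj C X Y) = {f \<in> Tight C. Dom C f = X \<and> Cod C f = Y}"
  "cDom (hom_obj C X Y) = Src C" "cCod (hom_obj C X Y) = Trg C"
  "cId (hom_obj C X Y) = Id2 C" "cCmp (hom_obj C X Y) = VCmp C"
  by (simp_all add: hom_obj_def)

lemma hom_functor_sel [simp]:
  "Y \<in> Obj C \<Longrightarrow> FOb (hom_functor C X) Y = hom_obj C X Y"
  "\<lbrakk>g \<in> Loose C; f \<in> Loose C; Dom C f = X; Cod C f = Dom C g\<rbrakk>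
    \<Longrightarrow> onOb (adata (FLo (hom_functor C X) g)) f = g \<cdot>\<^bsub>C\<^esub> f"
  "\<lbrakk>g \<in> Loose C; x \<in> Cell C; Dom C (Src C x) = X; Cod C (Src C x) = Dom C g\<rbrakk>
    \<Longrightarrow> onAr (adata (FLo (hom_functor C X) g)) x = g \<rhd>\<^bsub>C\<^esub> x"
  "\<lbrakk>y \<in> Cell C; f \<in> Loose C; Dom C f = X; Cod C f = Dom C (Src C y)\<rbrakk>
    \<Longrightarrow> adata (FCe (hom_functor C X) y) f = y \<lhd>\<^bsub>C\<^esub> f"
  by (simp_all add: hom_functor_def hom_map_def)

lemma weight_typing:
  assumes "is_weight W"
  shows "j \<in> Obj (wJ W) \<Longrightarrow> category (FOb (wF W) j)"
    "j \<in> Obj (wJ W) \<Longrightarrow> tOb (FOb (wF W) j) \<subseteq> cOb (FOb (wF W) j)"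
    "u \<in> Loose (wJ W) \<Longrightarrow> is_functor (FOb (wF W) (Dom (wJ W) u)) (FOb (wF W) (Cod (wJ W) u))
      (adata (FLo (wF W) u))"
    "\<lbrakk>x \<in> Cell (wJ W); a \<in> cOb (FOb (wF W) (Dom (wJ W) (Src (wJ W) x)))\<rbrakk>
      \<Longrightarrow> adata (FCe (wF W) x) a \<in> cAr (FOb (wF W) (Cod (wJ W) (Src (wJ W) x)))"
proof -
  have J: "fcategory (wJ W)" and F: "is_ffunctor (wJ W) FF (wF W)"
    using assms by (auto simp: is_weight_def)
  interpret fcategory "wJ W" by (rule J)
  show "category (FOb (wF W) j)" "tOb (FOb (wF W) j) \<subseteq> cOb (FOb (wF W) j)" if "j \<in> Obj (wJ W)" for j
    using ffunctorD(1)[OF F that] by (simp_all add: FF_def is_fobj_def)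
  show "is_functor (FOb (wF W) (Dom (wJ W) u)) (FOb (wF W) (Cod (wJ W) u)) (adata (FLo (wF W) u))"
    if "u \<in> Loose (wJ W)" for u
    using ffunctorD(2,4,5)[OF F that] by (simp add: FF_def)
  show "adata (FCe (wF W) x) a \<in> cAr (FOb (wF W) (Cod (wJ W) (Src (wJ W) x)))"
    if x: "x \<in> Cell (wJ W)" and a: "a \<in> cOb (FOb (wF W) (Dom (wJ W) (Src (wJ W) x)))" for x a
  proof -
    have "asrc (FLo (wF W) (Src (wJ W) x)) = FOb (wF W) (Dom (wJ W) (Src (wJ W) x))"
      "atrg (FLo (wF W) (Src (wJ W) x)) = FOb (wF W) (Cod (wJ W) (Src (wJ W) x))"
      "asrc (FCe (wF W) x) = FLo (wF W) (Src (wJ W) x)"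
      using ffunctorD(4,5)[OF F src_in[OF x]] ffunctorD(8)[OF F x] by (simp_all add: FF_def)
    then show ?thesis
      using ffunctorD(3)[OF F x] a by (auto simp: FF_def is_nat_def PiE_iff)
  qed
qed

text \<open>The definition of a cone states naturality of the legs through equal composite functors.
  Here these are evaluated at objects and arrows, the form to which another \<F>-functor can be
  applied.\<close>

lemma coneD:
  assumes "is_cone C \<kappa>"
  shows "is_weight (cWeight \<kappa>)" "fcategory (cJ \<kappa>)" "is_ffunctor (cJ \<kappa>) C (cDiag \<kappa>)"
    "cApex \<kappa> \<in> Obj C"
    "j \<in> Obj (cJ \<kappa>) \<Longrightarrow> is_functor (FOb (cW \<kappa>) j) (hom_obj C (cApex \<kappa>) (FOb (cDiag \<kappa>) j)) (cLeg \<kappa> j)"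
    "\<lbrakk>u \<in> Loose (cJ \<kappa>); a \<in> cOb (FOb (cW \<kappa>) (Dom (cJ \<kappa>) u))\<rbrakk> \<Longrightarrow>
      onOb (cLeg \<kappa> (Cod (cJ \<kappa>) u)) (onOb (adata (FLo (cW \<kappa>) u)) a) =
      FLo (cDiag \<kappa>) u \<cdot>\<^bsub>C\<^esub> onOb (cLeg \<kappa> (Dom (cJ \<kappa>) u)) a"
    "\<lbrakk>u \<in> Loose (cJ \<kappa>); b \<in> cAr (FOb (cW \<kappa>) (Dom (cJ \<kappa>) u))\<rbrakk> \<Longrightarrow>
      onAr (cLeg \<kappa> (Cod (cJ \<kappa>) u)) (onAr (adata (FLo (cW \<kappa>) u)) b) =
      FLo (cDiag \<kappa>) u \<rhd>\<^bsub>C\<^esub> onAr (cLeg \<kappa> (Dom (cJ \<kappa>) u)) b"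
    "\<lbrakk>x \<in> Cell (cJ \<kappa>); a \<in> cOb (FOb (cW \<kappa>) (Dom (cJ \<kappa>) (Src (cJ \<kappa>) x)))\<rbrakk> \<Longrightarrow>
      onAr (cLeg \<kappa> (Cod (cJ \<kappa>) (Src (cJ \<kappa>) x))) (adata (FCe (cW \<kappa>) x) a) =
      FCe (cDiag \<kappa>) x \<lhd>\<^bsub>C\<^esub> onOb (cLeg \<kappa> (Dom (cJ \<kappa>) (Src (cJ \<kappa>) x))) a"
    "\<lbrakk>j \<in> Obj (cJ \<kappa>); a \<in> tOb (FOb (cW \<kappa>) j)\<rbrakk> \<Longrightarrow> onOb (cLeg \<kappa> j) a \<in> Tight C"
proof -
  let ?V = "ffun_comp (cJ \<kappa>) (hom_functor C (cApex \<kappa>)) (cDiag \<kappa>)"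
  show W: "is_weight (cWeight \<kappa>)" and J: "fcategory (cJ \<kappa>)"
    and D: "is_ffunctor (cJ \<kappa>) C (cDiag \<kappa>)" and "cApex \<kappa> \<in> Obj C"
    using assms by (auto simp: is_cone_def is_weight_def)
  interpret J: fcategory "cJ \<kappa>" by fact
  have l: "loose_nat (cJ \<kappa>) (cW \<kappa>) ?V (cLeg \<kappa>)"
    and t: "\<And>j. j \<in> Obj (cJ \<kappa>) \<Longrightarrow> preserves_tight (FOb (cW \<kappa>) j) (FOb ?V j) (cLeg \<kappa> j)"
    using assms by (auto simp: is_cone_def f_nat_def)
  show fn: "is_functor (FOb (cW \<kappa>) j) (hom_obj C (cApex \<kappa>) (FOb (cDiag \<kappa>) j)) (cLeg \<kappa> j)"
    if "j \<in> Obj (cJ \<kappa>)" for j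
    using l that by (simp add: loose_nat_def ffunctorD[OF D])
  show "onOb (cLeg \<kappa> j) a \<in> Tight C" if "j \<in> Obj (cJ \<kappa>)" "a \<in> tOb (FOb (cW \<kappa>) j)" for j a
    using t[OF that(1)] that by (simp add: preserves_tight_def ffunctorD[OF D])
  have eq: "cfun_comp (FOb (cW \<kappa>) (Dom (cJ \<kappa>) u)) (cLeg \<kappa> (Cod (cJ \<kappa>) u)) (adata (FLo (cW \<kappa>) u)) =
      cfun_comp (FOb (cW \<kappa>) (Dom (cJ \<kappa>) u)) (adata (FLo ?V u)) (cLeg \<kappa> (Dom (cJ \<kappa>) u))"
    if "u \<in> Loose (cJ \<kappa>)" for u
    using l that by (simp add: loose_nat_def)
  show "onOb (cLeg \<kappa> (Cod (cJ \<kappa>) u)) (onOb (adata (FLo (cW \<kappa>) u)) a) =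
      FLo (cDiag \<kappa>) u \<cdot>\<^bsub>C\<^esub> onOb (cLeg \<kappa> (Dom (cJ \<kappa>) u)) a"
    if u: "u \<in> Loose (cJ \<kappa>)" and a: "a \<in> cOb (FOb (cW \<kappa>) (Dom (cJ \<kappa>) u))" for u a
    using arg_cong[where f = "\<lambda>F. onOb F a", OF eq[OF u]] u a functorD(1)[OF fn a]
    by (simp add: cfun_comp_def compose_def ffunctorD[OF D])
  show "onAr (cLeg \<kappa> (Cod (cJ \<kappa>) u)) (onAr (adata (FLo (cW \<kappa>) u)) b) =
      FLo (cDiag \<kappa>) u \<rhd>\<^bsub>C\<^esub> onAr (cLeg \<kappa> (Dom (cJ \<kappa>) u)) b"
    if u: "u \<in> Loose (cJ \<kappa>)" and b: "b \<in> cAr (FOb (cW \<kappa>) (Dom (cJ \<kappa>) u))" for u b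
    using arg_cong[where f = "\<lambda>F. onAr F b", OF eq[OF u]] u b functorD(2)[OF fn b]
    by (simp add: cfun_comp_def compose_def ffunctorD[OF D])
  show "onAr (cLeg \<kappa> (Cod (cJ \<kappa>) (Src (cJ \<kappa>) x))) (adata (FCe (cW \<kappa>) x) a) =
      FCe (cDiag \<kappa>) x \<lhd>\<^bsub>C\<^esub> onOb (cLeg \<kappa> (Dom (cJ \<kappa>) (Src (cJ \<kappa>) x))) a"
    if x: "x \<in> Cell (cJ \<kappa>)" and a: "a \<in> cOb (FOb (cW \<kappa>) (Dom (cJ \<kappa>) (Src (cJ \<kappa>) x)))" for x a
    using l x a functorD(1)[OF fn a] by (simp add: loose_nat_def ffunctorD[OF D])
qed

lemma map_cone_sel [simp]:
  "cWeight (map_cone F \<kappa>) = cWeight \<kappa>"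
  "cDiag (map_cone F \<kappa>) = ffun_comp (cJ \<kappa>) F (cDiag \<kappa>)"
  "cApex (map_cone F \<kappa>) = FOb F (cApex \<kappa>)"
  "\<lbrakk>j \<in> Obj (cJ \<kappa>); a \<in> cOb (FOb (cW \<kappa>) j)\<rbrakk> \<Longrightarrow> onOb (cLeg (map_cone F \<kappa>) j) a = FLo F (onOb (cLeg \<kappa> j) a)"
  "\<lbrakk>j \<in> Obj (cJ \<kappa>); b \<in> cAr (FOb (cW \<kappa>) j)\<rbrakk> \<Longrightarrow> onAr (cLeg (map_cone F \<kappa>) j) b = FCe F (onAr (cLeg \<kappa> j) b)"
  by (simp_all add: map_cone_def)

text \<open>Joint reflection of limits speaks about cones, so the image of a sketch cone under a
  transposed model must be known to be one before reflection applies.\<close>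

lemma is_cone_map_cone:
  assumes A: "fcategory A" and F: "is_ffunctor A B F" and k: "is_cone A \<kappa>"
  shows "is_cone B (map_cone F \<kappa>)"
proof -
  note W = coneD(1)[OF k] and J = coneD(2)[OF k] and D = coneD(3)[OF k] and leg = coneD(5)[OF k]
  interpret A: fcategory A by fact
  interpret J: fcategory "cJ \<kappa>" by fact
  let ?V = "ffun_comp (cJ \<kappa>) (hom_functor B (FOb F (cApex \<kappa>))) (ffun_comp (cJ \<kappa>) F (cDiag \<kappa>))"
  note [simp] = ffunctorD[OF F] ffunctorD[OF D]
  have lo: "onOb (cLeg \<kappa> j) a \<in> Loose A" "Dom A (onOb (cLeg \<kappa> j) a) = cApex \<kappa>"
    "Cod A (onOb (cLeg \<kappa> j) a) = FOb (cDiag \<kappa>) j"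
    if "j \<in> Obj (cJ \<kappa>)" "a \<in> cOb (FOb (cW \<kappa>) j)" for j a
    using functorD(1)[OF leg[OF that(1)] that(2)] by simp_all
  have ce: "onAr (cLeg \<kappa> j) b \<in> Cell A" "Src A (onAr (cLeg \<kappa> j) b) = onOb (cLeg \<kappa> j) (cDom (FOb (cW \<kappa>) j) b)"
    "Trg A (onAr (cLeg \<kappa> j) b) = onOb (cLeg \<kappa> j) (cCod (FOb (cW \<kappa>) j) b)"
    if "j \<in> Obj (cJ \<kappa>)" "b \<in> cAr (FOb (cW \<kappa>) j)" for j b
    using functorD(2-4)[OF leg[OF that(1)] that(2)] by simp_all
  have "is_functor (FOb (cW \<kappa>) j) (hom_obj B (FOb F (cApex \<kappa>)) (FOb F (FOb (cDiag \<kappa>) j)))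
      (cLeg (map_cone F \<kappa>) j)" if j: "j \<in> Obj (cJ \<kappa>)" for j
  proof -
    interpret W: category "FOb (cW \<kappa>) j" by (rule weight_typing(1)[OF W j])
    have "onOb (cLeg (map_cone F \<kappa>) j) \<in> extensional (cOb (FOb (cW \<kappa>) j))"
      "onAr (cLeg (map_cone F \<kappa>) j) \<in> extensional (cAr (FOb (cW \<kappa>) j))"
      using j by (simp_all add: map_cone_def)
    then show ?thesis
      using functorD(5,6)[OF leg[OF j]] j
      by (simp add: is_functor_def PiE_iff lo ce W.dom_in W.cod_in W.id_in W.cmp_in)
  qed
  moreover have "cfun_comp (FOb (cW \<kappa>) (Dom (cJ \<kappa>) u)) (cLeg (map_cone F \<kappa>) (Cod (cJ \<kappa>) u))
        (adata (FLo (cW \<kappa>) u)) =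
      cfun_comp (FOb (cW \<kappa>) (Dom (cJ \<kappa>) u)) (adata (FLo ?V u)) (cLeg (map_cone F \<kappa>) (Dom (cJ \<kappa>) u))"
    if u: "u \<in> Loose (cJ \<kappa>)" for u
  proof -
    interpret W: category "FOb (cW \<kappa>) (Dom (cJ \<kappa>) u)" by (rule weight_typing(1)[OF W]) (simp add: u)
    show ?thesis
      using coneD(6,7)[OF k u] functorD(1,2)[OF weight_typing(3)[OF W u]] u
      by (auto simp: cfun_comp_def compose_def restrict_def fun_eq_iff lo ce W.dom_in W.cod_in)
  qed
  moreover have "onAr (cLeg (map_cone F \<kappa>) (Cod (cJ \<kappa>) (Src (cJ \<kappa>) x))) (adata (FCe (cW \<kappa>) x) a) =
      adata (FCe ?V x) (onOb (cLeg (map_cone F \<kappa>) (Dom (cJ \<kappa>) (Src (cJ \<kappa>) x))) a)"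
    if "x \<in> Cell (cJ \<kappa>)" "a \<in> cOb (FOb (cW \<kappa>) (Dom (cJ \<kappa>) (Src (cJ \<kappa>) x)))" for x a
    using coneD(8)[OF k that] weight_typing(4)[OF W that] that by (simp add: lo)
  moreover have "cLeg (map_cone F \<kappa>) \<in> extensional (Obj (cJ \<kappa>))"
    by (simp add: map_cone_def)
  moreover have "FLo F (onOb (cLeg \<kappa> j) a) \<in> Tight B" if "j \<in> Obj (cJ \<kappa>)" "a \<in> tOb (FOb (cW \<kappa>) j)" for j a
    using coneD(9)[OF k that] by simp
  ultimately show ?thesis
    using weight_typing(2)[OF W] coneD(4)[OF k] ffunctor_comp[OF J D F]
    by (auto simp: is_cone_def W f_nat_def loose_nat_def preserves_tight_def lo subset_iff)
qed

text \<open>Lets an evaluation of a model be treated as evaluation applied to the image cone. The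
  cone hypothesis places the diagram, apex and legs in the carriers of \<open>A\<close>, outside
  which the composite is \<open>undefined\<close>.\<close>

lemma map_cone_comp:
  assumes k: "is_cone A \<kappa>"
  shows "map_cone (ffun_comp A G F) \<kappa> = map_cone G (map_cone F \<kappa>)"
proof -
  note D = coneD(3)[OF k] and leg = coneD(5)[OF k]
  have "ffun_comp (cJ \<kappa>) (ffun_comp A G F) (cDiag \<kappa>) = ffun_comp (cJ \<kappa>) G (ffun_comp (cJ \<kappa>) F (cDiag \<kappa>))"
    by (rule ffun.equality)
      (auto simp: ffun_comp_def compose_def restrict_def fun_eq_iff ffunctorD[OF D])
  moreover have "onOb (cLeg \<kappa> j) a \<in> Loose A" if "j \<in> Obj (cJ \<kappa>)" "a \<in> cOb (FOb (cW \<kappa>) j)" for j a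
    using functorD(1)[OF leg[OF that(1)] that(2)] by simp
  moreover have "onAr (cLeg \<kappa> j) b \<in> Cell A" if "j \<in> Obj (cJ \<kappa>)" "b \<in> cAr (FOb (cW \<kappa>) j)" for j b
    using functorD(2)[OF leg[OF that(1)] that(2)] by simp
  ultimately show ?thesis
    using coneD(4)[OF k] by (auto simp: map_cone_def intro!: restrict_ext)
qed

section \<open>Categories of models\<close>

lemma sketch_morphism_fcat_sketch:
  "sketch_morphism S (fcat_sketch C) M \<longleftrightarrow>
    is_ffunctor (sCat S) C M \<and> (\<forall>\<kappa>\<in>sCones S. limit_cone C (map_cone M \<kappa>))"
  by (simp add: sketch_morphism_def fcat_sketch_def)

lemma limit_sketchD:
  assumes "limit_sketch \<Psi> S"
  shows "fcategory (sCat S)" "\<kappa> \<in> sCones S \<Longrightarrow> is_cone (sCat S) \<kappa>" "\<kappa> \<in> sCones S \<Longrightarrow> cWeight \<kappa> \<in> \<Psi>"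
  using assms by (auto simp: limit_sketch_def is_sketch_def)

lemma fcategory_Mod:
  assumes "fcategory (sCat S)" "fcategory C"
  shows "fcategory (Mod w' w S C)"
proof -
  interpret fcat_pair "sCat S" C
    using assms by (rule fcat_pair.intro)
  show ?thesis
    unfolding Mod_def by (intro fcategory.fcategory_full_sub fcategory_Fun)
qed

text \<open>Collects the two conditions, values that are models and preservation of the cones of
  \<open>S\<close>, into one predicate on objects of the iterated functor category, ready for
  \<open>isomorphic_full_sub\<close>.\<close>

lemma Mod_Mod:
  assumes "fcategory (sCat S)" "fcategory (sCat T)" "fcategory C"
  shows "Mod w' w S (Mod v' v T C) = full_sub (Fun w' w (sCat S) (Fun v' v (sCat T) C))
    {M. (\<forall>X\<in>Obj (sCat S). sketch_morphism T (fcat_sketch C) (FOb M X)) \<and>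
      sketch_morphism S (fcat_sketch (Mod v' v T C)) M}"
proof -
  interpret TC: fcat_pair "sCat T" C
    using assms(2,3) by (rule fcat_pair.intro)
  interpret S: fcat_pair "sCat S" "Fun v' v (sCat T) C"
    using assms(1) TC.fcategory_Fun by (rule fcat_pair.intro)
  have "{M. \<forall>X\<in>Obj (sCat S). FOb M X \<in> {N. sketch_morphism T (fcat_sketch C) N}} \<inter> Q =
      {M. (\<forall>X\<in>Obj (sCat S). sketch_morphism T (fcat_sketch C) (FOb M X)) \<and> M \<in> Q}" for Q
    by auto
  then show ?thesis
    unfolding Mod_def[of w' w S] unfolding Mod_def[of v' v T C] S.Fun_full_sub full_sub_full_sub
    by simp
qed

text \<open>Creation for \<open>T\<close> supplies preservation by evaluations, creation for
  \<open>S\<close> their joint reflection. The converse passage is the instance with the sketches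
  exchanged and the weaknesses dualised.\<close>

lemma swap_models:
  fixes S :: "('jo, 'j1, 'j2, 'wo, 'wa, 'so, 's1, 's2) sketch"
    and T :: "('jo, 'j1, 'j2, 'wo, 'wa, 'to, 't1, 't2) sketch"
    and C :: "('co, 'c1, 'c2) fcat"
  assumes crS: "created \<Psi> w' w TYPE(('so, 's1, 's2) fcat) TYPE(('co, 'c1, 'c2) fcat)"
    and crT: "created \<Psi> (dual w') (dual w) TYPE(('to, 't1, 't2) fcat) TYPE(('co, 'c1, 'c2) fcat)"
    and S: "limit_sketch \<Psi> S" and T: "limit_sketch \<Psi> T"
    and C: "fcategory C" "complete \<Psi> C"
    and MX: "\<forall>X\<in>Obj (sCat S). sketch_morphism T (fcat_sketch C) (FOb M X)"
    and Mm: "sketch_morphism S (fcat_sketch (Mod (dual w') (dual w) T C)) M"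
  defines "N \<equiv> fcat_swap.swap_ob (sCat S) (sCat T) C w' w M"
  shows "(\<forall>Y\<in>Obj (sCat T). sketch_morphism S (fcat_sketch C) (FOb N Y)) \<and>
    sketch_morphism T (fcat_sketch (Mod w' w S C)) N"
proof -
  interpret fcat_swap "sCat S" "sCat T" C w' w
    using limit_sketchD(1)[OF S] limit_sketchD(1)[OF T] C(1) by (rule fcat_swap.intro)
  let ?MT = "Mod (dual w') (dual w) T C" and ?MS = "Mod w' w S C"
  have M': "is_ffunctor (sCat S) ?MT M" and lim: "\<And>\<kappa>. \<kappa> \<in> sCones S \<Longrightarrow> limit_cone ?MT (map_cone M \<kappa>)"
    using Mm by (auto simp: sketch_morphism_fcat_sketch)
  have M: "is_ffunctor (sCat S) FT M"
    using M' by (simp add: Mod_def SFT.ffunctor_full_sub_iff)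
  note N = swap_ob_ffunctor[OF M, folded N_def]
  have pres: "\<And>Y. Y \<in> Obj (sCat T) \<Longrightarrow> preserves_limits \<Psi> ?MT C (eval_at ?MT Y)"
    using crT T C unfolding created_def by blast
  have refl: "jointly_reflect_limits \<Psi> ?MS C (eval_at ?MS ` Obj (sCat S))"
    using crS S C unfolding created_def by blast
  have NY: "sketch_morphism S (fcat_sketch C) (FOb N Y)" if Y: "Y \<in> Obj (sCat T)" for Y
  proof -
    \<comment> \<open>Transposition evaluates on all of \<open>FT\<close>, preservation concerns
      evaluation on the models; the two agree on the values of \<open>M\<close>.\<close>
    have FN: "FOb N Y = ffun_comp (sCat S) (eval_at ?MT Y) M"
      unfolding N_def swap_ob_sel(1)[OF Y]
      by (rule ffun.equality)
        (use ffunctorD(1-3)[OF M'] ffunctorD(1-3)[OF M] in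
          \<open>auto simp: ffun_comp_def compose_def intro!: restrict_ext simp del: Fun_sel\<close>)
    have "limit_cone C (map_cone (FOb N Y) \<kappa>)" if k: "\<kappa> \<in> sCones S" for \<kappa>
      unfolding FN map_cone_comp[OF limit_sketchD(2)[OF S k]]
      using pres[OF Y] lim[OF k] limit_sketchD(3)[OF S k] unfolding preserves_limits_def by simp
    then show ?thesis
      using slice_ffunctor[OF M Y] unfolding sketch_morphism_fcat_sketch N_def swap_ob_sel(1)[OF Y]
      by blast
  qed
  have N': "is_ffunctor (sCat T) ?MS N"
    unfolding Mod_def TFS.ffunctor_full_sub_iff using N NY by blast
  have MSc: "fcategory ?MS"
    using S.fcategory_axioms C(1) by (rule fcategory_Mod)
  have "limit_cone ?MS (map_cone N \<kappa>)" if k: "\<kappa> \<in> sCones T" for \<kappa>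
  proof -
    note ck = limit_sketchD(2)[OF T k]
    have "limit_cone C (map_cone (eval_at ?MS X) (map_cone N \<kappa>))" if X: "X \<in> Obj (sCat S)" for X
    proof -
      \<comment> \<open>Again evaluation on models is replaced by evaluation on all functors, where
        the slice of the transpose is known.\<close>
      have "ffun_comp (sCat T) (eval_at ?MS X) N = ffun_comp (sCat T) (eval_at FS X) N"
        by (rule ffun.equality)
          (use ffunctorD(1-3)[OF N'] ffunctorD(1-3)[OF N] in
            \<open>auto simp: ffun_comp_def compose_def intro!: restrict_ext simp del: Fun_sel\<close>)
      also have "\<dots> = FOb M X"
        unfolding N_def by (rule slice_swap_ob[OF M X])
      finally show ?thesis
        using MX X k unfolding sketch_morphism_fcat_sketch
        by (simp flip: map_cone_comp[OF ck])
    qed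
    then show ?thesis
      using refl is_cone_map_cone[OF T.fcategory_axioms N' ck] limit_sketchD(3)[OF T k]
      unfolding jointly_reflect_limits_def by auto
  qed
  with NY N' show ?thesis
    by (simp add: sketch_morphism_fcat_sketch)
qed

lemma isomorphic_Mod_Mod:
  fixes S :: "('jo, 'j1, 'j2, 'wo, 'wa, 'so, 's1, 's2) sketch"
    and T :: "('jo, 'j1, 'j2, 'wo, 'wa, 'to, 't1, 't2) sketch"
    and C :: "('co, 'c1, 'c2) fcat"
  assumes crS: "created \<Psi> w' w TYPE(('so, 's1, 's2) fcat) TYPE(('co, 'c1, 'c2) fcat)"
    and crT: "created \<Psi> (dual w') (dual w) TYPE(('to, 't1, 't2) fcat) TYPE(('co, 'c1, 'c2) fcat)"
    and S: "limit_sketch \<Psi> S" and T: "limit_sketch \<Psi> T"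
    and C: "fcategory C" "complete \<Psi> C"
  shows "isomorphic_fcat (Mod w' w S (Mod (dual w') (dual w) T C))
    (Mod (dual w') (dual w) T (Mod w' w S C))"
proof -
  note fS = limit_sketchD(1)[OF S] and fT = limit_sketchD(1)[OF T]
  interpret fcat_swap "sCat S" "sCat T" C w' w
    using fS fT C(1) by (rule fcat_swap.intro)
  interpret op: fcat_swap "sCat T" "sCat S" C "dual w'" "dual w"
    rewrites "dual (dual w') = w'" and "dual (dual w) = w"
    by unfold_locales simp_all
  show ?thesis
    unfolding Mod_Mod[OF fS fT C(1)] Mod_Mod[OF fT fS C(1)]
  proof (rule isomorphic_full_sub[OF SFT.fcategory_Fun TFS.fcategory_Fun swap_ffunctor op.swap_ffunctor],
      goal_cases)
    case (7 M)
    then show ?case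
      using swap_models[OF crS crT S T C, of M] by (simp add: swap_def)
  next
    case (8 M)
    then show ?case
      \<comment> \<open>In the exchanged instance the remaining creation hypothesis has doubly
        dualised weaknesses, which simplify to those of \<open>crS\<close>.\<close>
      using swap_models[OF crT _ T S C, of M] crS by (simp add: op.swap_def)
  qed (simp_all add: swap_def op.swap_def swap_ob_ffunctor swap_trans_loose swap_modif_modif
      op.swap_ob_ffunctor op.swap_trans_loose op.swap_modif_modif swap_swap_ob swap_swap_trans
      swap_swap_modif op.swap_swap_ob op.swap_swap_trans op.swap_swap_modif)
qed

theorem theorem7p4:
  fixes w' w :: weakness
    and \<Psi> :: "('jo, 'j1, 'j2, 'wo, 'wa) weight set"
    and S :: "('jo, 'j1, 'j2, 'wo, 'wa, 'so, 's1, 's2) sketch"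
    and T :: "('jo, 'j1, 'j2, 'wo, 'wa, 'to, 't1, 't2) sketch"
    and C :: "('co, 'c1, 'c2) fcat"
  assumes "w' \<le> w"
    and "\<forall>W\<in>\<Psi>. is_weight W"
    and "created \<Psi> w' w TYPE(('so, 's1, 's2) fcat) TYPE(('co, 'c1, 'c2) fcat)"
    and "created \<Psi> w' w TYPE(('so, 's1, 's2) fcat) TYPE(('to, 't1, 't2, 'co, 'c1, 'c2) fun_fcat)"
    and "created \<Psi> (dual w') (dual w) TYPE(('to, 't1, 't2) fcat) TYPE(('co, 'c1, 'c2) fcat)"
    and "created \<Psi> (dual w') (dual w) TYPE(('to, 't1, 't2) fcat)
      TYPE(('so, 's1, 's2, 'co, 'c1, 'c2) fun_fcat)"
    and "limit_sketch \<Psi> S"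
    and "limit_sketch \<Psi> T"
    and "fcategory C"
    and "complete \<Psi> C"
  defines "L \<equiv> Mod w' w S (Mod (dual w') (dual w) T C)"
    and "R \<equiv> Mod (dual w') (dual w) T (Mod w' w S C)"
  shows "fcategory L \<and> complete \<Psi> L \<and> fcategory R \<and> complete \<Psi> R \<and> isomorphic_fcat L R"
proof (intro conjI)
  note fS = limit_sketchD(1)[OF assms(7)] and fT = limit_sketchD(1)[OF assms(8)]
  have MS: "fcategory (Mod w' w S C)" and MT: "fcategory (Mod (dual w') (dual w) T C)"
    using fS fT assms(9) by (simp_all add: fcategory_Mod)
  \<comment> \<open>Creation over \<open>C\<close> makes the inner categories of models complete.
    These live on types of functors, so the outer ones require the instances of creation at those
    types.\<close>
  have "complete \<Psi> (Mod w' w S C)" "complete \<Psi> (Mod (dual w') (dual w) T C)"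
    using assms(3,5,7-10) unfolding created_def by blast+
  then show "complete \<Psi> L" "complete \<Psi> R"
    unfolding L_def R_def using assms(4,6-8) MS MT unfolding created_def by blast+
  show "fcategory L" "fcategory R"
    unfolding L_def R_def using fS fT MS MT by (simp_all add: fcategory_Mod)
  show "isomorphic_fcat L R"
    unfolding L_def R_def by (rule isomorphic_Mod_Mod[OF assms(3,5,7-10)])
qed

end
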